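(* Let $(A,\mathfrak m)$ be a cyclic unital $A_\infty$ algebra, with unit $\mathbf 1$ and constant symplectic structure $\omega$. Then its normalized Hochschild cohomology $H(\overline C^\bullet(A,A),\delta)$ is a BV algebra (with cup product, bracket and BV operator induced by $D\smile E=\mathfrak m\{D,E\}$, $[D,E]=D\{E\}-(-1)^{|D||E|}E\{D\}$, and $\Delta$).
   Context: Let $\Bbbk$ be the ground field and $A$ a (differential) graded vector space; $|\cdot|$ denotes degree (shifted-degree sign convention), cochains in formulas are homogeneous. $C^\bullet(A,A)=\prod_{k\ge1}\mathrm{Hom}(A^{\otimes k},A)$. Brace operation: $D\{E_1,\dots,E_m\}(a_1,\dots,a_k)=\sum(-1)^{*}D(a_{I_0},E_1(a_{K_1}),a_{I_1},\dots,E_m(a_{K_m}),a_{I_m})$, summed over decompositions of $(1,\dots,k)$ into successive, possibly empty, intervals $I_0,K_1,I_1,\dots,K_m,I_m$, where $a_I$ is the tensor of the $a_i$, $i\in I$, and $*=\sum_{j=1}^m|E_j|\big(\sum_{i=0}^{j-1}|a_{I_i}|+\sum_{i=1}^{j-1}|a_{K_i}|\big)$. $A_\infty$ algebra: $\mathfrak m=\{\mathfrak m_k\}_{k\ge1}\in C^\bullet(A,A)$ of degree $1$, $\mathfrak m_1=d_A$, with $\mathfrak m\{\mathfrak m\}=0$. Constant symplectic structure: a non-degenerate bilinear $\omega:A\otimes A\to\Bbbk$ with $\omega(a_1,a_2)=(-1)^{|a_1||a_2|+1}\omega(a_2,a_1)$ and an integer $|\omega|$ such that $\omega(a_1,a_2)=0$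 unless $|a_1|+|a_2|+|\omega|=0$. Cyclic: $\omega(\mathfrak m(a_1,\dots,a_k),a_0)=(-1)^{|a_0|\sum_{i=1}^k|a_i|}\omega(\mathfrak m(a_0,a_1,\dots,a_{k-1}),a_k)$. Unital: $\mathbf 1\in A$, $|\mathbf 1|=-1$, $\mathfrak m_2(\mathbf 1,a)=(-1)^{|a|-1}\mathfrak m_2(a,\mathbf 1)=a$, and $\mathfrak m_k(\dots,\mathbf 1,\dots)=0$ for $k\ne2$. Hochschild differential: $\delta(D)=\mathfrak m\{D\}-(-1)^{|D|}D\{\mathfrak m\}$. $D$ is normalized if $D(a_1,\dots,a_k)=0$ whenever some $a_i=\mathbf 1$; the normalized cochains form a subcomplex $\overline C^\bullet(A,A)$. BV operator: $\Delta D\in C^\bullet(A,A)$ (components $k\ge1$) is determined via non-degeneracy of $\omega$ by $\omega(\Delta D(a_1,\dots,a_k),a_0)=\sum_{i=0}^k(-1)^{(|a_1|+\cdots+|a_i|)(|a_{i+1}|+\cdots+|a_k|+|a_0|)}\omega(D(a_{i+1},\dots,a_k,a_0,a_1,\dots,a_i),\mathbf 1)$. BV algebra: a Gerstenhaber algebra $(G,\smile,[\,,])$ with an operator $\Delta$ satisfying $\Delta^2=0$ and $[a,b]=\Delta(a\smile b)+\Delta a\smile b-(-1)^{|a||b|}\Delta b\smile a$. In the shifted degrees used here ($|x\smile y|=|x|+|y|+1$, $|[x,y]|=|x|+|y|$), the Gerstenhaber axioms read: $x\smile y=(-1)^{|x||y|+1}y\smile x$; $(x\smile y)\smile w=(-1)^{|x|+1}x\smile(y\smile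 w)$; $[x,y]=-(-1)^{|x||y|}[y,x]$; $[x,[y,w]]=[[x,y],w]+(-1)^{|x||y|}[y,[x,w]]$; $[x,y\smile w]=(-1)^{|x|}[x,y]\smile w+(-1)^{|x|+|x||y|}y\smile[x,w]$.
   Formalization: Cochains include arity 0 (k≥0 instead of k≥1), the BV operator is (−1)^{|ω|}Δ, and non-degenerate means that ω identifies A with its graded dual; with k≥1 only, or with Δ itself for odd |ω|, the BV relation fails. *)

theory Defs
  imports Complex_Main "HOL-Library.Function_Algebras"
begin

section \<open>BV algebras\<close>

text \<open>
  A graded vector space, presented as a family of carriers \<open>G p\<close> indexed by the degree \<open>p\<close>,
  each with its own vector space operations. In this presentation the degree of an element is
  passed explicitly to all operations; only homogeneous elements occur. It is used for cohomology,
  whose elements are cosets.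
\<close>

locale graded_space =
  fixes G :: "int \<Rightarrow> 'g set"
    and add :: "int \<Rightarrow> 'g \<Rightarrow> 'g \<Rightarrow> 'g"
    and zero :: "int \<Rightarrow> 'g"
    and smult :: "int \<Rightarrow> 'k::field \<Rightarrow> 'g \<Rightarrow> 'g"
  assumes add_closed: "\<lbrakk>x \<in> G p; y \<in> G p\<rbrakk> \<Longrightarrow> add p x y \<in> G p"
    and zero_closed: "zero p \<in> G p"
    and smult_closed: "x \<in> G p \<Longrightarrow> smult p c x \<in> G p"
    and add_assoc: "\<lbrakk>x \<in> G p; y \<in> G p; z \<in> G p\<rbrakk> \<Longrightarrow> add p (add p x y) z = add p x (add p y z)"
    and add_commute: "\<lbrakk>x \<in> G p; y \<in> G p\<rbrakk> \<Longrightarrow> add p x y = add p y x"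
    and add_zero: "x \<in> G p \<Longrightarrow> add p x (zero p) = x"
    and add_inverse: "x \<in> G p \<Longrightarrow> \<exists>y\<in>G p. add p x y = zero p"
    and smult_add_right: "\<lbrakk>x \<in> G p; y \<in> G p\<rbrakk> \<Longrightarrow>
          smult p c (add p x y) = add p (smult p c x) (smult p c y)"
    and smult_add_left: "x \<in> G p \<Longrightarrow> smult p (c + d) x = add p (smult p c x) (smult p d x)"
    and smult_smult: "x \<in> G p \<Longrightarrow> smult p c (smult p d x) = smult p (c * d) x"
    and smult_one: "x \<in> G p \<Longrightarrow> smult p 1 x = x"

text \<open>Shifted degrees: \<open>|x \<smile> y| = |x| + |y| + 1\<close> and \<open>|[x,y]| = |x| + |y|\<close>.\<close>

locale gerstenhaber_algebra = graded_space G add zero smult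
  for G :: "int \<Rightarrow> 'g set"
    and add :: "int \<Rightarrow> 'g \<Rightarrow> 'g \<Rightarrow> 'g"
    and zero :: "int \<Rightarrow> 'g"
    and smult :: "int \<Rightarrow> 'k::field \<Rightarrow> 'g \<Rightarrow> 'g" +
  fixes cup :: "int \<Rightarrow> int \<Rightarrow> 'g \<Rightarrow> 'g \<Rightarrow> 'g"
    and bracket :: "int \<Rightarrow> int \<Rightarrow> 'g \<Rightarrow> 'g \<Rightarrow> 'g"
  assumes cup_closed: "\<lbrakk>x \<in> G p; y \<in> G q\<rbrakk> \<Longrightarrow> cup p q x y \<in> G (p + q + 1)"
    and cup_add_left: "\<lbrakk>x \<in> G p; x' \<in> G p; y \<in> G q\<rbrakk> \<Longrightarrow>
          cup p q (add p x x') y = add (p + q + 1) (cup p q x y) (cup p q x' y)"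
    and cup_add_right: "\<lbrakk>x \<in> G p; y \<in> G q; y' \<in> G q\<rbrakk> \<Longrightarrow>
          cup p q x (add q y y') = add (p + q + 1) (cup p q x y) (cup p q x y')"
    and cup_smult_left: "\<lbrakk>x \<in> G p; y \<in> G q\<rbrakk> \<Longrightarrow>
          cup p q (smult p c x) y = smult (p + q + 1) c (cup p q x y)"
    and cup_smult_right: "\<lbrakk>x \<in> G p; y \<in> G q\<rbrakk> \<Longrightarrow>
          cup p q x (smult q c y) = smult (p + q + 1) c (cup p q x y)"
    and bracket_closed: "\<lbrakk>x \<in> G p; y \<in> G q\<rbrakk> \<Longrightarrow> bracket p q x y \<in> G (p + q)"
    and bracket_add_left: "\<lbrakk>x \<in> G p; x' \<in> G p; y \<in> G q\<rbrakk> \<Longrightarrow>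
          bracket p q (add p x x') y = add (p + q) (bracket p q x y) (bracket p q x' y)"
    and bracket_add_right: "\<lbrakk>x \<in> G p; y \<in> G q; y' \<in> G q\<rbrakk> \<Longrightarrow>
          bracket p q x (add q y y') = add (p + q) (bracket p q x y) (bracket p q x y')"
    and bracket_smult_left: "\<lbrakk>x \<in> G p; y \<in> G q\<rbrakk> \<Longrightarrow>
          bracket p q (smult p c x) y = smult (p + q) c (bracket p q x y)"
    and bracket_smult_right: "\<lbrakk>x \<in> G p; y \<in> G q\<rbrakk> \<Longrightarrow>
          bracket p q x (smult q c y) = smult (p + q) c (bracket p q x y)"
    and cup_commute: "\<lbrakk>x \<in> G p; y \<in> G q\<rbrakk> \<Longrightarrow>
          cup p q x y = smult (p + q + 1) ((-1) powi (p * q + 1)) (cup q p y x)"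
    and cup_assoc: "\<lbrakk>x \<in> G p; y \<in> G q; z \<in> G r\<rbrakk> \<Longrightarrow>
          cup (p + q + 1) r (cup p q x y) z =
          smult (p + q + r + 2) ((-1) powi (p + 1)) (cup p (q + r + 1) x (cup q r y z))"
    and bracket_antisym: "\<lbrakk>x \<in> G p; y \<in> G q\<rbrakk> \<Longrightarrow>
          bracket p q x y = smult (p + q) (- ((-1) powi (p * q))) (bracket q p y x)"
    and bracket_jacobi: "\<lbrakk>x \<in> G p; y \<in> G q; z \<in> G r\<rbrakk> \<Longrightarrow>
          bracket p (q + r) x (bracket q r y z) =
          add (p + q + r)
            (bracket (p + q) r (bracket p q x y) z)
            (smult (p + q + r) ((-1) powi (p * q)) (bracket q (p + r) y (bracket p r x z)))"
    and bracket_cup: "\<lbrakk>x \<in> G p; y \<in> G q; z \<in> G r\<rbrakk> \<Longrightarrow>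
          bracket p (q + r + 1) x (cup q r y z) =
          add (p + q + r + 1)
            (smult (p + q + r + 1) ((-1) powi p) (cup (p + q) r (bracket p q x y) z))
            (smult (p + q + r + 1) ((-1) powi (p + p * q)) (cup q (p + r) y (bracket p r x z)))"

locale bv_algebra = gerstenhaber_algebra G add zero smult cup bracket
  for G :: "int \<Rightarrow> 'g set"
    and add :: "int \<Rightarrow> 'g \<Rightarrow> 'g \<Rightarrow> 'g"
    and zero :: "int \<Rightarrow> 'g"
    and smult :: "int \<Rightarrow> 'k::field \<Rightarrow> 'g \<Rightarrow> 'g"
    and cup :: "int \<Rightarrow> int \<Rightarrow> 'g \<Rightarrow> 'g \<Rightarrow> 'g"
    and bracket :: "int \<Rightarrow> int \<Rightarrow> 'g \<Rightarrow> 'g \<Rightarrow> 'g" +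
  fixes \<Delta> :: "int \<Rightarrow> 'g \<Rightarrow> 'g"
  assumes Delta_closed: "x \<in> G p \<Longrightarrow> \<Delta> p x \<in> G (p - 1)"
    and Delta_add: "\<lbrakk>x \<in> G p; y \<in> G p\<rbrakk> \<Longrightarrow> \<Delta> p (add p x y) = add (p - 1) (\<Delta> p x) (\<Delta> p y)"
    and Delta_smult: "x \<in> G p \<Longrightarrow> \<Delta> p (smult p c x) = smult (p - 1) c (\<Delta> p x)"
    and Delta_Delta: "x \<in> G p \<Longrightarrow> \<Delta> (p - 1) (\<Delta> p x) = zero (p - 2)"
    and bv_relation: "\<lbrakk>x \<in> G p; y \<in> G q\<rbrakk> \<Longrightarrow>
          bracket p q x y =
          add (p + q)
            (add (p + q) (\<Delta> (p + q + 1) (cup p q x y)) (cup (p - 1) q (\<Delta> p x) y))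
            (smult (p + q) (- ((-1) powi (p * q))) (cup (q - 1) p (\<Delta> q y) x))"


section \<open>Cochains on a graded vector space\<close>

text \<open>
  Here the graded vector space is a whole type with its decomposition \<open>A = \<Oplus>\<^sub>n gr n\<close>.
  Signs depend on the degrees of the arguments, so the formulas below are written for
  \<^emph>\<open>tagged\<close> lists \<open>[(n\<^sub>1,a\<^sub>1), \<dots>, (n\<^sub>k,a\<^sub>k)]\<close> with \<open>a\<^sub>i \<in> gr n\<^sub>i\<close>.
\<close>

abbreviation deg :: "(int \<times> 'a) list \<Rightarrow> int" where
  "deg ts \<equiv> sum_list (map fst ts)"

abbreviation elts :: "(int \<times> 'a) list \<Rightarrow> 'a list" where
  "elts ts \<equiv> map snd ts"

locale graded_vector_space = vector_space scale
  for scale :: "'k::field \<Rightarrow> 'a::ab_group_add \<Rightarrow> 'a" (infixr \<open>*s\<close> 75) +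
  fixes gr :: "int \<Rightarrow> 'a set"
  assumes subspace_gr: "subspace (gr n)"
    and direct_sum:
      "\<exists>!c. (\<forall>n. c n \<in> gr n) \<and> finite {n. c n \<noteq> 0} \<and> (\<Sum>n | c n \<noteq> 0. c n) = a"
begin

definition component :: "'a \<Rightarrow> int \<Rightarrow> 'a" where
  "component a =
    (THE c. (\<forall>n. c n \<in> gr n) \<and> finite {n. c n \<noteq> 0} \<and> (\<Sum>n | c n \<noteq> 0. c n) = a)"

definition homogeneous :: "(int \<times> 'a) list \<Rightarrow> bool" where
  "homogeneous ts \<longleftrightarrow> (\<forall>(n, a) \<in> set ts. a \<in> gr n)"

definition multilinear :: "('a list \<Rightarrow> 'a) \<Rightarrow> bool" where
  "multilinear D \<longleftrightarrow> (\<forall>xs ys. Vector_Spaces.linear scale scale (\<lambda>x. D (xs @ x # ys)))"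

text \<open>
  A cochain is a function \<open>D\<close> on lists; its component in \<open>Hom(A\<^sup>\<otimes>\<^sup>k, A)\<close> is the restriction of
  \<open>D\<close> to lists of length \<open>k\<close>. All arities \<open>k \<ge> 0\<close> are included. With components in arities
  \<open>k \<ge> 1\<close> only, the BV relation fails: for the Frobenius algebra \<open>k[x]/(x\<^sup>3)\<close>, placed in
  shifted degree \<open>-1\<close>, the derivations \<open>D = x \<partial>\<^sub>x\<close> and \<open>E = x\<^sup>2 \<partial>\<^sub>x\<close> satisfy \<open>[D,E] = E\<close>, and
  this comes entirely from the arity \<open>0\<close> components of \<open>\<Delta> D\<close> and \<open>\<Delta> E\<close>.
\<close>

definition cochains :: "int \<Rightarrow> ('a list \<Rightarrow> 'a) set" where
  "cochains d = {D. multilinear D \<and>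
     (\<forall>ts. homogeneous ts \<longrightarrow> D (elts ts) \<in> gr (d + deg ts))}"

text \<open>
  The multilinear extension of a formula \<open>f\<close> given on tagged lists of homogeneous elements:
  the sum of the values of \<open>f\<close> on all choices of homogeneous components of the arguments.
\<close>

definition multilinear_extension :: "((int \<times> 'a) list \<Rightarrow> 'a) \<Rightarrow> 'a list \<Rightarrow> 'a" where
  "multilinear_extension f xs =
     (\<Sum>ns | list_all2 (\<lambda>x n. component x n \<noteq> 0) xs ns. f (zip ns (map2 component xs ns)))"

text \<open>
  In \<open>brace D [(e\<^sub>1,E\<^sub>1), \<dots>, (e\<^sub>m,E\<^sub>m)]\<close> the integer \<open>e\<^sub>j\<close> is the degree of \<open>E\<^sub>j\<close>. A decomposition
  of the arguments is the list \<open>Js = [I\<^sub>0, K\<^sub>1, I\<^sub>1, \<dots>, K\<^sub>m, I\<^sub>m]\<close> of the corresponding sublists,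
  so the block at an odd position \<open>2 * j + 1\<close> is fed to the \<open>j\<close>-th cochain, counted from \<open>0\<close>.
\<close>

definition brace :: "('a list \<Rightarrow> 'a) \<Rightarrow> (int \<times> ('a list \<Rightarrow> 'a)) list \<Rightarrow> 'a list \<Rightarrow> 'a" where
  "brace D Es = multilinear_extension (\<lambda>ts.
     \<Sum>Js | length Js = 2 * length Es + 1 \<and> concat Js = ts.
       (-1) powi (\<Sum>j<length Es. fst (Es ! j) * deg (concat (take (2 * j + 1) Js))) *s
       D (concat (map (\<lambda>p. if even p then elts (Js ! p) else [snd (Es ! (p div 2)) (elts (Js ! p))])
            [0..<length Js])))"

definition bracket :: "int \<Rightarrow> int \<Rightarrow> ('a list \<Rightarrow> 'a) \<Rightarrow> ('a list \<Rightarrow> 'a) \<Rightarrow> 'a list \<Rightarrow> 'a" where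
  "bracket p q D E = (\<lambda>xs. brace D [(q, E)] xs - (-1) powi (p * q) *s brace E [(p, D)] xs)"

end


section \<open>Cyclic unital A-infinity algebras\<close>

text \<open>The differential \<open>d\<^sub>A\<close> is \<open>\<lambda>a. m [a]\<close>; there is no curvature term \<open>m []\<close>.\<close>

locale A_infinity_algebra = graded_vector_space scale gr
  for scale :: "'k::field \<Rightarrow> 'a::ab_group_add \<Rightarrow> 'a" (infixr \<open>*s\<close> 75)
    and gr :: "int \<Rightarrow> 'a set" +
  fixes m :: "'a list \<Rightarrow> 'a"
  assumes m_cochain: "m \<in> cochains 1"
    and m_Nil: "m [] = 0"
    and m_m: "brace m [(1, m)] = 0"
begin

definition hochschild_diff :: "int \<Rightarrow> ('a list \<Rightarrow> 'a) \<Rightarrow> 'a list \<Rightarrow> 'a" where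
  "hochschild_diff p D = (\<lambda>xs. brace m [(p, D)] xs - (-1) powi p *s brace D [(1, m)] xs)"

definition cup :: "int \<Rightarrow> int \<Rightarrow> ('a list \<Rightarrow> 'a) \<Rightarrow> ('a list \<Rightarrow> 'a) \<Rightarrow> 'a list \<Rightarrow> 'a" where
  "cup p q D E = brace m [(p, D), (q, E)]"

end

locale unital_A_infinity_algebra = A_infinity_algebra scale gr m
  for scale :: "'k::field \<Rightarrow> 'a::ab_group_add \<Rightarrow> 'a" (infixr \<open>*s\<close> 75)
    and gr :: "int \<Rightarrow> 'a set"
    and m :: "'a list \<Rightarrow> 'a" +
  fixes one :: 'a  (\<open>\<one>\<close>)
  assumes one_degree: "\<one> \<in> gr (-1)"
    and m_one_left: "a \<in> gr n \<Longrightarrow> m [\<one>, a] = a"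
    and m_one_right: "a \<in> gr n \<Longrightarrow> (-1) powi (n - 1) *s m [a, \<one>] = a"
    and m_one_other: "\<lbrakk>length xs \<noteq> 2; \<one> \<in> set xs\<rbrakk> \<Longrightarrow> m xs = 0"
begin

definition normalized_cochains :: "int \<Rightarrow> ('a list \<Rightarrow> 'a) set" where
  "normalized_cochains p = {D \<in> cochains p. \<forall>xs. \<one> \<in> set xs \<longrightarrow> D xs = 0}"

definition cocycles :: "int \<Rightarrow> ('a list \<Rightarrow> 'a) set" where
  "cocycles p = {D \<in> normalized_cochains p. hochschild_diff p D = 0}"

definition coboundaries :: "int \<Rightarrow> ('a list \<Rightarrow> 'a) set" where
  "coboundaries p = hochschild_diff (p - 1) ` normalized_cochains (p - 1)"

definition coset :: "int \<Rightarrow> ('a list \<Rightarrow> 'a) \<Rightarrow> ('a list \<Rightarrow> 'a) set" where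
  "coset p D = (+) D ` coboundaries p"

definition HH :: "int \<Rightarrow> ('a list \<Rightarrow> 'a) set set" where
  "HH p = coset p ` cocycles p"

text \<open>
  The operations on cohomology are unions over all representatives. The result is a single coset
  only if it does not depend on the representatives, so the closure axioms of \<^locale>\<open>bv_algebra\<close>
  include well-definedness of the induced operations.
\<close>

definition HH_add :: "int \<Rightarrow> ('a list \<Rightarrow> 'a) set \<Rightarrow> ('a list \<Rightarrow> 'a) set \<Rightarrow> ('a list \<Rightarrow> 'a) set" where
  "HH_add p X Y = (\<Union>D\<in>X. \<Union>E\<in>Y. coset p (D + E))"

definition HH_zero :: "int \<Rightarrow> ('a list \<Rightarrow> 'a) set" where
  "HH_zero p = coset p 0"

definition HH_smult :: "int \<Rightarrow> 'k \<Rightarrow> ('a list \<Rightarrow> 'a) set \<Rightarrow> ('a list \<Rightarrow> 'a) set" where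
  "HH_smult p c X = (\<Union>D\<in>X. coset p (\<lambda>xs. c *s D xs))"

definition HH_cup ::
    "int \<Rightarrow> int \<Rightarrow> ('a list \<Rightarrow> 'a) set \<Rightarrow> ('a list \<Rightarrow> 'a) set \<Rightarrow> ('a list \<Rightarrow> 'a) set" where
  "HH_cup p q X Y = (\<Union>D\<in>X. \<Union>E\<in>Y. coset (p + q + 1) (cup p q D E))"

definition HH_bracket ::
    "int \<Rightarrow> int \<Rightarrow> ('a list \<Rightarrow> 'a) set \<Rightarrow> ('a list \<Rightarrow> 'a) set \<Rightarrow> ('a list \<Rightarrow> 'a) set" where
  "HH_bracket p q X Y = (\<Union>D\<in>X. \<Union>E\<in>Y. coset (p + q) (bracket p q D E))"

end

text \<open>
  The integer \<open>w\<close> is the degree \<open>|\<omega>|\<close>. Non-degeneracy says that \<open>b \<mapsto> \<omega>(b, -)\<close> is an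
  isomorphism of \<open>A\<close> onto its graded dual: every linear functional supported in a single degree
  is represented by exactly one element. (This forces every \<open>gr n\<close> to be finite-dimensional.)
  Injectivity alone would not yield the cochain \<open>\<Delta> D\<close> defined below.
\<close>

locale cyclic_unital_A_infinity_algebra = unital_A_infinity_algebra scale gr m one
  for scale :: "'k::field \<Rightarrow> 'a::ab_group_add \<Rightarrow> 'a" (infixr \<open>*s\<close> 75)
    and gr :: "int \<Rightarrow> 'a set"
    and m :: "'a list \<Rightarrow> 'a"
    and one :: 'a  (\<open>\<one>\<close>) +
  fixes \<omega> :: "'a \<Rightarrow> 'a \<Rightarrow> 'k"
    and w :: int
  assumes omega_linear_left: "Vector_Spaces.linear scale (*) (\<lambda>a. \<omega> a b)"
    and omega_linear_right: "Vector_Spaces.linear scale (*) (\<lambda>b. \<omega> a b)"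
    and omega_degree: "\<lbrakk>a \<in> gr i; b \<in> gr j; i + j + w \<noteq> 0\<rbrakk> \<Longrightarrow> \<omega> a b = 0"
    and omega_symmetry: "\<lbrakk>a \<in> gr i; b \<in> gr j\<rbrakk> \<Longrightarrow> \<omega> a b = (-1) powi (i * j + 1) * \<omega> b a"
    and omega_nondegenerate:
      "\<lbrakk>Vector_Spaces.linear scale (*) f; \<And>j a. \<lbrakk>j \<noteq> n; a \<in> gr j\<rbrakk> \<Longrightarrow> f a = 0\<rbrakk> \<Longrightarrow>
       \<exists>!b. \<forall>a. \<omega> b a = f a"
    and omega_cyclic:
      "homogeneous (t\<^sub>0 # ts @ [t]) \<Longrightarrow>
       \<omega> (m (elts (ts @ [t]))) (snd t\<^sub>0) =
       (-1) powi (fst t\<^sub>0 * deg (ts @ [t])) * \<omega> (m (elts (t\<^sub>0 # ts))) (snd t)"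
begin

text \<open>With \<open>ts = [a\<^sub>1, \<dots>, a\<^sub>k]\<close> and \<open>t\<^sub>0 = a\<^sub>0\<close>:\<close>

definition Delta :: "('a list \<Rightarrow> 'a) \<Rightarrow> 'a list \<Rightarrow> 'a" where
  "Delta D = (THE D'. multilinear D' \<and>
     (\<forall>ts t\<^sub>0. homogeneous (ts @ [t\<^sub>0]) \<longrightarrow>
        \<omega> (D' (elts ts)) (snd t\<^sub>0) =
        (\<Sum>i\<le>length ts.
           (-1) powi (deg (take i ts) * deg (drop i ts @ [t\<^sub>0])) *
           \<omega> (D (elts (drop i ts @ [t\<^sub>0] @ take i ts))) \<one>)))"

definition HH_Delta :: "int \<Rightarrow> ('a list \<Rightarrow> 'a) set \<Rightarrow> ('a list \<Rightarrow> 'a) set" where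
  "HH_Delta p X = (\<Union>D\<in>X. coset (p - 1) (Delta D))"

text \<open>
  The operator in the BV relation. For even \<open>|\<omega>|\<close> it is \<open>\<Delta>\<close>. For odd \<open>|\<omega>|\<close>, with the sign
  conventions used here, the relation as written holds for \<open>- \<Delta>\<close> and not for \<open>\<Delta>\<close>. Example:
  \<open>A\<close> spanned by \<open>\<one>\<close> and \<open>x\<close> with \<open>|x| = 0\<close>, \<open>m [x,x] = 0\<close>, \<open>|\<omega>| = 1\<close>, \<open>\<omega>(x,\<one>) = 1 = - \<omega>(\<one>,x)\<close>;
  \<open>D = x\<close> of arity \<open>0\<close> and \<open>E = x \<partial>\<^sub>x\<close> of arity \<open>1\<close>. Then \<open>[D,E] = - x\<close>, \<open>D \<smile> E = 0\<close>,
  \<open>\<Delta> D = 0\<close>, \<open>\<Delta> E = - \<one>\<close> and \<open>- \<Delta> E \<smile> D = x\<close>.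
\<close>

definition HH_BV_operator :: "int \<Rightarrow> ('a list \<Rightarrow> 'a) set \<Rightarrow> ('a list \<Rightarrow> 'a) set" where
  "HH_BV_operator p X = HH_smult (p - 1) ((-1) powi w) (HH_Delta p X)"

end

end

theory Submission
  imports Defs
begin

text \<open>
  All operations on Hochschild cochains are built from braces, and every identity claimed for the
  cohomology holds for cocycles up to the differential of an explicit cochain. So the proof consists
  of a calculus of braces with signs and of a list of homotopies.

  \<^emph>\<open>Signs.\<close> Moving a symbol of degree \<open>n\<close> across a list of arguments is the same as applying the
  \<open>n\<close>-th power of the parity involution to each of these arguments (\<open>tw\<close>). With this device the
  brace has a description without tags and degrees (\<open>ins\<close>, \<open>brace_eq_ins\<close>), in which cochains are
  characterized by multilinearity and by the way in which they commute with the involution. The form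
  \<open>\<omega>\<close> is non-zero only in one total degree, so its symmetry, its cyclicity and the signs of cyclic
  rotations can be expressed by the involution as well.

  \<^emph>\<open>The Gerstenhaber algebra.\<close> Two brace identities carry this part, one for \<open>D{E}{F\<^sub>1, \<dots>, F\<^sub>n}\<close>
  (\<open>brace_single_brace\<close>) and one for \<open>D{E\<^sub>1, \<dots>, E\<^sub>n}{G}\<close> (\<open>brace_brace_single\<close>). The pre-Lie identity
  is an instance, so the bracket satisfies the Jacobi identity strictly, and the differential, being
  the bracket with \<open>m\<close>, is a derivation of it. For cocycles, the cochains \<open>D{E}\<close>, \<open>m{D,E,F}\<close> and
  \<open>D{E,F}\<close> are homotopies for the commutativity of the cup product, for its associativity and for the
  Leibniz rule of the bracket (\<open>cup_commute_homotopy\<close>, \<open>cup_assoc_homotopy\<close>,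
  \<open>bracket_cup_homotopy\<close>). They are normalized when \<open>D\<close>, \<open>E\<close> and \<open>F\<close> are.

  \<^emph>\<open>The BV operator.\<close> A cochain is determined by its pairings with \<open>\<omega>\<close>, and \<open>\<Delta> D\<close> is the sum of
  \<open>\<omega>(D(\<dots>), \<one>)\<close> over all rotations of the cyclic word of arguments. By cyclicity and unitality,
  \<open>\<omega>(m(\<dots>), \<one>)\<close> only sees the product \<open>m\<^sub>2\<close> (\<open>om_m_one\<close>). This has three consequences. First, \<open>\<Delta>\<close>
  anticommutes with the differential (\<open>hochschild_diff_Delta\<close>); moreover \<open>\<Delta>\<^sup>2 = 0\<close> for normalized
  cochains, since a unit is passed to \<open>D\<close>. Secondly, \<open>\<Delta>(D \<smile> E)\<close> is the sum of
  \<open>\<omega>(D(\<dots>), E(\<dots>))\<close> over all cuts of the cyclic word into two intervals; it has two halves,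
  according to the interval that contains the last argument \<open>a\<close>. Thirdly, for cocycles \<open>D\<close> and \<open>E\<close>
  let \<open>h\<close> be the sum of \<open>\<omega>(D(\<dots>, E(\<dots>), \<dots>, a, \<dots>), \<one>)\<close>, in which \<open>E\<close> stands before \<open>a\<close>.
  The boundary terms in \<open>\<delta> h\<close> are \<open>D{E}\<close> and the first half of \<open>\<Delta>(D \<smile> E)\<close>, and the insertions
  of \<open>m\<close> that \<open>\<delta> h\<close> misses form \<open>\<Delta> D \<smile> E\<close>. So these three agree in cohomology up to signs
  (\<open>brace_BV_homotopy\<close>), and antisymmetrization gives the BV relation.
\<close>

section \<open>Signs and sums over cuts of a list\<close>

text \<open>
  The sign \<open>(-1)\<^sup>n\<close> acts on every abelian group, in particular on functions. With \<open>sg\<close> in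
  place of scalar multiplication, the identities between cochains below are identities in an
  abelian group, and they are decided by a case distinction on the parities of the degrees.
\<close>

definition sg :: "int \<Rightarrow> 'v::ab_group_add \<Rightarrow> 'v" where
  "sg n v = (if even n then v else - v)"

lemma sg_simps [simp]:
  "sg 0 v = v" "sg n 0 = 0" "sg n (sg k v) = sg (n + k) v"
  "sg 1 v = - v" "sg n (- v) = - sg n v"
  by (auto simp: sg_def)

lemma sg_even [simp]: "even n \<Longrightarrow> sg n v = v"
  by (simp add: sg_def)

lemma sg_add: "sg n (u + v) = sg n u + sg n v"
  and sg_diff: "sg n (u - v) = sg n u - sg n v"
  by (auto simp: sg_def)

lemma sg_cong: "even (n - k) \<Longrightarrow> sg n v = sg k v"
  by (auto simp: sg_def)

lemma sg_fun [simp]: "sg n f x = sg n (f x)" for f :: "'b \<Rightarrow> 'v::ab_group_add"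
  by (auto simp: sg_def)

lemma sg_ext: "sg n f = (\<lambda>x. sg n (f x))" for f :: "'b \<Rightarrow> 'v::ab_group_add"
  by (rule ext) simp

lemma sg_additive:
  fixes h :: "'u::ab_group_add \<Rightarrow> 'v::ab_group_add"
  assumes "\<And>x y. h (x + y) = h x + h y"
  shows "h (sg n v) = sg n (h v)"
proof -
  interpret additive h by (rule additive.intro) (rule assms)
  show ?thesis by (simp add: sg_def minus)
qed

lemma sg_eq_powi_mult: "(-1) powi n * x = sg n x" for x :: "'k::field"
  by (cases "even n") (simp_all add: sg_def power_int_minus_left)

text \<open>
  The sum over all cuts \<open>xs = u @ v\<close>, that is, the deconcatenation coproduct of the tensor
  coalgebra in Sweedler notation. Decompositions into several intervals are nested sums;
  \<open>cutsum_assoc\<close> is coassociativity.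
\<close>

primrec cutsum :: "('b list \<Rightarrow> 'b list \<Rightarrow> 'v::comm_monoid_add) \<Rightarrow> 'b list \<Rightarrow> 'v" where
  "cutsum f [] = f [] []"
| "cutsum f (x # xs) = f [] (x # xs) + cutsum (\<lambda>u. f (x # u)) xs"

lemma cutsum_cong:
  assumes "\<And>u v. u @ v = xs \<Longrightarrow> f u v = g u v"
  shows "cutsum f xs = cutsum g xs"
  using assms
proof (induction xs arbitrary: f g)
  case (Cons x xs)
  have "cutsum (\<lambda>u. f (x # u)) xs = cutsum (\<lambda>u. g (x # u)) xs"
    by (rule Cons.IH) (use Cons.prems in auto)
  then show ?case using Cons.prems[of "[]"] by simp
qed simp

lemma cutsum_append_Cons:
  "cutsum f (a @ e # b) = cutsum (\<lambda>u v. f u (v @ e # b)) a + cutsum (\<lambda>u v. f (a @ e # u) v) b"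
  by (induction a arbitrary: f) (simp_all add: add.assoc)

lemma cutsum_0 [simp]: "cutsum (\<lambda>u v. 0) xs = 0"
  by (induction xs) auto

lemma cutsum_add: "cutsum (\<lambda>u v. f u v + g u v) xs = cutsum f xs + cutsum g xs"
  by (induction xs arbitrary: f g) (simp_all add: algebra_simps)

lemma cutsum_additive:
  assumes "h 0 = 0" "\<And>x y. h (x + y) = h x + h y"
  shows "h (cutsum f xs) = cutsum (\<lambda>u v. h (f u v)) xs"
  by (induction xs arbitrary: f) (simp_all add: assms)

lemma cutsum_sg: "cutsum (\<lambda>u v. sg n (f u v)) xs = sg n (cutsum f xs)"
  by (rule cutsum_additive[symmetric]) (simp_all add: sg_add)

lemma cutsum_uminus: "cutsum (\<lambda>u v. - f u v) xs = - cutsum f xs" for f :: "_ \<Rightarrow> _ \<Rightarrow> 'v::ab_group_add"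
  by (rule cutsum_additive[symmetric]) simp_all

lemma cutsum_diff: "cutsum (\<lambda>u v. f u v - g u v) xs = cutsum f xs - cutsum g xs"
  for f :: "_ \<Rightarrow> _ \<Rightarrow> 'v::ab_group_add"
  using cutsum_add[of f "\<lambda>u v. - g u v" xs] by (simp add: cutsum_uminus)

lemma cutsum_map: "cutsum f (map g xs) = cutsum (\<lambda>u v. f (map g u) (map g v)) xs"
  by (induction xs arbitrary: f) simp_all

lemma cutsum_assoc:
  "cutsum (\<lambda>p z. cutsum (\<lambda>x y. f x y z) p) xs = cutsum (\<lambda>x t. cutsum (\<lambda>y z. f x y z) t) xs"
  by (induction xs arbitrary: f) (simp_all add: cutsum_add add.assoc)

lemma cutsum_swap:
  "cutsum (\<lambda>u v. cutsum (\<lambda>x y. f u v x y) ys) xs = cutsum (\<lambda>x y. cutsum (\<lambda>u v. f u v x y) xs) ys"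
  by (induction xs arbitrary: f) (simp_all add: cutsum_add)

text \<open>
  Nested sums over cuts are compared in a normal form, in which the blocks of the list are cut
  off from left to right. Coassociativity does not reach it when a left block \<open>x\<close> is cut after
  some cuts of the rest of the list; the following rules move the cut of \<open>x\<close> outwards across one,
  two or three such cuts.
\<close>

lemma cutsum_interchange:
  "cutsum (\<lambda>x r. cutsum (\<lambda>y t. cutsum (\<lambda>a c. G a c y t) x) r) s =
   cutsum (\<lambda>a q. cutsum (\<lambda>c r. cutsum (\<lambda>y t. G a c y t) r) q) s"
proof -
  have "cutsum (\<lambda>a q. cutsum (\<lambda>c r. cutsum (\<lambda>y t. G a c y t) r) q) s =
      cutsum (\<lambda>x r. cutsum (\<lambda>a c. cutsum (\<lambda>y t. G a c y t) r) x) s"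
    by (rule cutsum_assoc[symmetric])
  also have "\<dots> = cutsum (\<lambda>x r. cutsum (\<lambda>y t. cutsum (\<lambda>a c. G a c y t) x) r) s"
    by (rule cutsum_cong, rule cutsum_swap)
  finally show ?thesis by simp
qed

lemma cutsum_interchange2:
  "cutsum (\<lambda>x r. cutsum (\<lambda>y s. cutsum (\<lambda>z q. cutsum (\<lambda>a c. G a c y z q) x) s) r) xs =
   cutsum (\<lambda>a t. cutsum (\<lambda>c r. cutsum (\<lambda>y s. cutsum (\<lambda>z q. G a c y z q) s) r) t) xs"
proof -
  have "cutsum (\<lambda>x r. cutsum (\<lambda>y s. cutsum (\<lambda>z q. cutsum (\<lambda>a c. G a c y z q) x) s) r) xs =
      cutsum (\<lambda>x r. cutsum (\<lambda>y s. cutsum (\<lambda>a c. cutsum (\<lambda>z q. G a c y z q) s) x) r) xs"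
    by (rule cutsum_cong, rule cutsum_cong, rule cutsum_swap)
  then show ?thesis by (simp only: cutsum_interchange)
qed

lemma cutsum_interchange3:
  "cutsum (\<lambda>x r. cutsum (\<lambda>y s. cutsum (\<lambda>z q. cutsum (\<lambda>f g. cutsum (\<lambda>a c. G a c y z f g) x) q) s) r) xs =
   cutsum (\<lambda>a t. cutsum (\<lambda>c r. cutsum (\<lambda>y s. cutsum (\<lambda>z q. cutsum (\<lambda>f g. G a c y z f g) q) s) r) t) xs"
proof -
  have "cutsum (\<lambda>x r. cutsum (\<lambda>y s. cutsum (\<lambda>z q. cutsum (\<lambda>f g. cutsum (\<lambda>a c. G a c y z f g) x) q) s) r) xs =
      cutsum (\<lambda>x r. cutsum (\<lambda>y s. cutsum (\<lambda>z q. cutsum (\<lambda>a c. cutsum (\<lambda>f g. G a c y z f g) q) x) s) r) xs"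
    by (rule cutsum_cong, rule cutsum_cong, rule cutsum_cong, rule cutsum_swap)
  then show ?thesis by (simp only: cutsum_interchange2)
qed

lemma cutsum_outwards:
  "cutsum (\<lambda>x r. cutsum (\<lambda>y t. cutsum (F x y t) Z) r) xs =
   cutsum (\<lambda>Q S. cutsum (\<lambda>x r. cutsum (\<lambda>y t. F x y t Q S) r) xs) Z"
  by (simp add: cutsum_swap[of _ Z])

text \<open>
  The rules are stated for functions, because nested sums are eta-contracted to partial
  applications of \<open>cutsum\<close>.
\<close>

lemmas cutsum_nest = cutsum_assoc[THEN ext] cutsum_interchange[THEN ext]

lemmas cutsum_nest' = cutsum_nest cutsum_interchange2[THEN ext] cutsum_interchange3[THEN ext]

lemma cutsum_zero: "(\<And>u v. u @ v = xs \<Longrightarrow> f u v = 0) \<Longrightarrow> cutsum f xs = 0"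
  using cutsum_cong[of xs f "\<lambda>u v. 0"] by simp

lemma cutsum_only_first:
  assumes "\<And>u v. u \<noteq> [] \<Longrightarrow> f u v = 0"
  shows "cutsum f xs = f [] xs"
proof (cases xs)
  case (Cons a list)
  have "cutsum (\<lambda>u. f (a # u)) list = cutsum (\<lambda>u v. 0) list" by (rule cutsum_cong) (simp add: assms)
  then show ?thesis by (simp add: Cons)
qed simp

lemma cutsum_only_last:
  assumes "\<And>u v. v \<noteq> [] \<Longrightarrow> f u v = 0"
  shows "cutsum f xs = f xs []"
  using assms by (induction xs arbitrary: f) auto

text \<open>
  Telescoping: moving an element across the cut pairs the terms of the two sums, and only the
  two extreme cuts remain. This is behind the cancellations along a cyclic rotation.
\<close>

lemma cutsum_shift:
  fixes A B :: "'b list \<Rightarrow> 'b list \<Rightarrow> 'v::ab_group_add"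
  assumes "\<And>u b v. A (u @ [b]) v = B u (b # v)"
  shows "cutsum A xs - A [] xs = cutsum B xs - B xs []"
  using assms
proof (induction xs arbitrary: A B)
  case (Cons x xs)
  have "cutsum (\<lambda>u. A (x # u)) xs - A [x] xs = cutsum (\<lambda>u. B (x # u)) xs - B (x # xs) []"
    by (rule Cons.IH) (use Cons.prems[of "x # _"] in simp)
  moreover have "A [x] xs = B [] (x # xs)" using Cons.prems[of "[]"] by simp
  ultimately show ?case by (simp add: algebra_simps)
qed simp

lemma cutsum_eq_sum: "cutsum f xs = (\<Sum>i\<le>length xs. f (take i xs) (drop i xs))"
proof (induction xs arbitrary: f)
  case (Cons x xs)
  show ?case by (simp add: Cons sum.atMost_Suc_shift del: sum.atMost_Suc)
qed simp

text \<open>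
  A decomposition into \<open>n + 1\<close> blocks is a cut followed by a decomposition of the second part
  into \<open>n\<close> blocks.
\<close>

lemma finite_decompositions: "finite {Js. length Js = n \<and> concat Js = xs}"
proof (rule finite_subset)
  show "{Js. length Js = n \<and> concat Js = xs} \<subseteq>
      {Js. set Js \<subseteq> {J. set J \<subseteq> set xs \<and> length J \<le> length xs} \<and> length Js = n}"
  proof
    fix Js assume Js: "Js \<in> {Js. length Js = n \<and> concat Js = xs}"
    have "J \<in> {J. set J \<subseteq> set xs \<and> length J \<le> length xs}" if J: "J \<in> set Js" for J
    proof -
      have "length J \<le> sum_list (map length Js)"
        using J by (intro member_le_sum_list) auto
      moreover have "set J \<subseteq> set (concat Js)" using J by auto
      moreover have "concat Js = xs" using Js by simp
      ultimately show ?thesis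
        by (simp add: length_concat[symmetric] del: set_concat)
    qed
    with Js show "Js \<in> {Js. set Js \<subseteq> {J. set J \<subseteq> set xs \<and> length J \<le> length xs} \<and> length Js = n}"
      by blast
  qed
  show "finite {Js. set Js \<subseteq> {J. set J \<subseteq> set xs \<and> length J \<le> length xs} \<and> length Js = n}"
    by (intro finite_lists_length_eq finite_lists_length_le) simp
qed

lemma sum_decompositions_Suc:
  "(\<Sum>Js | length Js = Suc n \<and> concat Js = xs. f Js) =
   cutsum (\<lambda>u v. \<Sum>Js | length Js = n \<and> concat Js = v. f (u # Js)) xs"
proof -
  let ?D = "\<lambda>n xs. {Js. length Js = n \<and> concat Js = xs}"
  have *: "?D (Suc n) xs = (\<Union>i\<in>{..length xs}. (#) (take i xs) ` ?D n (drop i xs))"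
    (is "_ = ?U")
  proof (rule set_eqI)
    fix Js
    show "Js \<in> ?D (Suc n) xs \<longleftrightarrow> Js \<in> ?U"
    proof
      assume "Js \<in> ?D (Suc n) xs"
      then obtain J Ks where Js: "Js = J # Ks" "length Ks = n" "J @ concat Ks = xs"
        by (auto simp: length_Suc_conv)
      then have "J = take (length J) xs" "concat Ks = drop (length J) xs" "length J \<le> length xs"
        by auto
      with Js show "Js \<in> ?U" by blast
    qed auto
  qed
  have "sum f (?D (Suc n) xs) = (\<Sum>i\<le>length xs. sum f ((#) (take i xs) ` ?D n (drop i xs)))"
    unfolding *
  proof (rule sum.UNION_disjoint)
    show "\<forall>i\<in>{..length xs}. \<forall>j\<in>{..length xs}. i \<noteq> j \<longrightarrow>
        (#) (take i xs) ` ?D n (drop i xs) \<inter> (#) (take j xs) ` ?D n (drop j xs) = {}"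
    proof (intro ballI impI)
      fix i j assume "i \<in> {..length xs}" "j \<in> {..length xs}" "i \<noteq> j"
      then have "length (take i xs) \<noteq> length (take j xs)" by simp
      then have "take i xs \<noteq> take j xs" by metis
      then show "(#) (take i xs) ` ?D n (drop i xs) \<inter> (#) (take j xs) ` ?D n (drop j xs) = {}"
        by blast
    qed
  qed (simp_all add: finite_decompositions)
  also have "\<dots> = (\<Sum>i\<le>length xs. \<Sum>Js\<in>?D n (drop i xs). f (take i xs # Js))"
    by (simp add: sum.reindex)
  finally show ?thesis by (simp add: cutsum_eq_sum)
qed

section \<open>The parity involution\<close>

context graded_vector_space
begin

lemma component_props:
  "(\<forall>n. component a n \<in> gr n) \<and> finite {n. component a n \<noteq> 0} \<and>
    (\<Sum>n | component a n \<noteq> 0. component a n) = a"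
  unfolding component_def by (rule theI'[OF direct_sum])

lemma component_in: "component a n \<in> gr n"
  and component_finite: "finite {n. component a n \<noteq> 0}"
  and component_sum: "(\<Sum>n | component a n \<noteq> 0. component a n) = a"
  using component_props[of a] by auto

lemma component_sum_superset:
  "finite N \<Longrightarrow> {n. component a n \<noteq> 0} \<subseteq> N \<Longrightarrow> (\<Sum>n\<in>N. component a n) = a"
  by (subst sum.mono_neutral_left[symmetric, of N "{n. component a n \<noteq> 0}"])
    (simp_all add: component_sum)

lemma component_unique:
  assumes "\<And>n. c n \<in> gr n" "finite N" "\<And>n. n \<notin> N \<Longrightarrow> c n = 0" "(\<Sum>n\<in>N. c n) = a"
  shows "component a = c"
proof -
  have sub: "{n. c n \<noteq> 0} \<subseteq> N" using assms(3) by auto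
  then have "(\<Sum>n | c n \<noteq> 0. c n) = a" "finite {n. c n \<noteq> 0}"
    using assms(2,4) sum.mono_neutral_left[OF assms(2) sub, of c] finite_subset[OF sub] by simp_all
  then show ?thesis using direct_sum[of a] component_props[of a] assms(1) by blast
qed

lemma gr_0 [simp]: "0 \<in> gr n"
  and gr_add: "a \<in> gr n \<Longrightarrow> b \<in> gr n \<Longrightarrow> a + b \<in> gr n"
  and gr_scale: "a \<in> gr n \<Longrightarrow> c *s a \<in> gr n"
  and gr_uminus: "a \<in> gr n \<Longrightarrow> - a \<in> gr n"
  using subspace_gr[of n]
  by (auto intro: subspace_0 subspace_add subspace_scale subspace_neg)

lemma gr_sg: "a \<in> gr n \<Longrightarrow> sg k a \<in> gr n"
  by (simp add: sg_def gr_uminus)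

lemma component_add: "component (a + b) = (\<lambda>n. component a n + component b n)"
proof (rule component_unique)
  let ?N = "{n. component a n \<noteq> 0} \<union> {n. component b n \<noteq> 0}"
  show "(\<Sum>n\<in>?N. component a n + component b n) = a + b"
    by (simp add: sum.distrib component_sum_superset component_finite)
qed (auto simp: component_finite component_in gr_add)

lemma component_scale: "component (c *s a) = (\<lambda>n. c *s component a n)"
proof (rule component_unique)
  show "(\<Sum>n | component a n \<noteq> 0. c *s component a n) = c *s a"
    by (simp add: scale_sum_right[symmetric] component_sum)
qed (auto simp: component_finite component_in gr_scale)

lemma component_homogeneous: "a \<in> gr k \<Longrightarrow> component a = (\<lambda>n. if n = k then a else 0)"
  by (rule component_unique[of _ "{k}"]) auto

text \<open>
  \<open>tw n\<close> multiplies the component of degree \<open>k\<close> by \<open>(-1)\<^sup>n\<^sup>k\<close>. It is the \<open>n\<close>-th power of the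
  parity involution; moving a symbol of degree \<open>n\<close> across a list of arguments amounts to
  applying \<open>tw n\<close> to each of them. In this way the Koszul signs can be written without
  reference to the degrees of the arguments.
\<close>

definition tw :: "int \<Rightarrow> 'a \<Rightarrow> 'a" where
  "tw n a = (\<Sum>k | component a k \<noteq> 0. sg (n * k) (component a k))"

lemma tw_superset:
  "finite N \<Longrightarrow> {k. component a k \<noteq> 0} \<subseteq> N \<Longrightarrow> tw n a = (\<Sum>k\<in>N. sg (n * k) (component a k))"
  unfolding tw_def by (rule sum.mono_neutral_left) auto

lemma tw_homogeneous: "a \<in> gr k \<Longrightarrow> tw n a = sg (n * k) a"
  by (subst tw_superset[of "{k}"]) (auto simp: component_homogeneous)

lemma tw_add [simp]: "tw n (a + b) = tw n a + tw n b"
proof -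
  let ?N = "{n. component a n \<noteq> 0} \<union> {n. component b n \<noteq> 0}"
  have fin: "finite ?N" by (simp add: component_finite)
  then have "tw n c = (\<Sum>k\<in>?N. sg (n * k) (component c k))" if "c \<in> {a, b, a + b}" for c
    by (rule tw_superset) (use that in \<open>auto simp: component_add\<close>)
  then show ?thesis by (simp add: component_add sg_add sum.distrib)
qed

lemma additive_tw: "additive (tw n)"
  by (rule additive.intro) simp

lemmas tw_0 [simp] = additive.zero[OF additive_tw]

lemma tw_sg: "tw n (sg k a) = sg k (tw n a)"
  by (simp add: sg_additive)

lemma scale_sg: "c *s sg n a = sg n (c *s a)"
  by (simp add: sg_def)

lemma tw_scale: "tw n (c *s a) = c *s tw n a"
  by (cases "c = 0", simp) (simp add: tw_def component_scale scale_sum_right scale_sg)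

lemma tw_even [simp]: "even n \<Longrightarrow> tw n a = a"
  by (simp add: tw_def sg_def component_sum)

lemma tw_cong: "even (n - k) \<Longrightarrow> tw n = tw k"
  by (rule ext, auto simp: tw_def sg_def)

lemma tw_odd: "odd n \<Longrightarrow> tw n = tw 1"
  by (rule tw_cong) simp

lemma homogeneous_induct [consumes 0, case_names homogeneous add]:
  assumes "\<And>n a. a \<in> gr n \<Longrightarrow> P a" "\<And>a b. P a \<Longrightarrow> P b \<Longrightarrow> P (a + b)"
  shows "P a"
proof -
  have "P (\<Sum>n\<in>N. component a n)" if "finite N" for N
    using that by induction (auto intro: assms component_in gr_0[of 0])
  from this[OF component_finite, of a] show ?thesis by (simp add: component_sum)
qed

lemma tw_tw [simp]: "tw n (tw k a) = tw (n + k) a"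
  by (induction a rule: homogeneous_induct) (simp_all add: tw_homogeneous tw_sg algebra_simps)

lemma tw_comp [simp]: "tw n \<circ> tw k = tw (n + k)"
  by (simp add: fun_eq_iff)

lemma tw_gr: "a \<in> gr n \<Longrightarrow> tw k a \<in> gr n"
  by (simp add: tw_homogeneous gr_sg)

abbreviation tws :: "int \<Rightarrow> 'a list \<Rightarrow> 'a list" where
  "tws n \<equiv> map (tw n)"

lemma tws_tws [simp]: "tws n (tws k xs) = tws (n + k) xs"
  by (simp add: comp_def)

lemma tws_even [simp]: "even n \<Longrightarrow> tws n xs = xs"
  by (simp add: map_idI)

text \<open>
  An identity between functions that are additive in each argument needs to be checked on
  homogeneous arguments only.
\<close>

lemma list_homogeneous_induct [consumes 0, case_names homogeneous add]:
  assumes "\<And>ts. homogeneous ts \<Longrightarrow> P (elts ts)"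
    and "\<And>xs a b ys. P (xs @ a # ys) \<Longrightarrow> P (xs @ b # ys) \<Longrightarrow> P (xs @ (a + b) # ys)"
  shows "P xs"
proof -
  have "P (elts ts @ xs)" if "homogeneous ts" for ts
    using that
  proof (induction xs arbitrary: ts)
    case Nil
    then show ?case using assms(1) by simp
  next
    case (Cons x xs)
    show ?case
    proof (induction x rule: homogeneous_induct)
      case (homogeneous n a)
      then show ?case using Cons.IH[of "ts @ [(n, a)]"] Cons.prems by (simp add: homogeneous_def)
    next
      case (add a b)
      then show ?case by (rule assms(2))
    qed
  qed
  from this[of "[]"] show ?thesis by (simp add: homogeneous_def)
qed

section \<open>Multilinear functions and cochains\<close>

text \<open>
  The target is a parameter: cochains take values in \<open>A\<close>, their pairings with a fixed vector
  take values in the ground field.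
\<close>

definition mlin :: "('k \<Rightarrow> 'v::ab_group_add \<Rightarrow> 'v) \<Rightarrow> ('a list \<Rightarrow> 'v) \<Rightarrow> bool" where
  "mlin s F \<longleftrightarrow> (\<forall>xs ys. Vector_Spaces.linear scale s (\<lambda>x. F (xs @ x # ys)))"

lemma multilinear_iff_mlin: "multilinear D \<longleftrightarrow> mlin scale D"
  by (simp add: multilinear_def mlin_def)

text \<open>
  Additivity in each argument suffices to pull out signs and sums; the identities between braces
  use nothing else about the outer function.
\<close>

definition madd :: "('a list \<Rightarrow> 'v::ab_group_add) \<Rightarrow> bool" where
  "madd F \<longleftrightarrow> (\<forall>xs x y ys. F (xs @ (x + y) # ys) = F (xs @ x # ys) + F (xs @ y # ys))"

lemma linear_iff:
  "Vector_Spaces.linear scale s f \<longleftrightarrow>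
    vector_space s \<and> (\<forall>x y. f (x + y) = f x + f y) \<and> (\<forall>c x. f (c *s x) = s c (f x))"
  using vector_space_axioms
  by (auto simp: Vector_Spaces.linear_def module_hom_def module_hom_axioms_def
      vector_space_def module_def)

lemma mlin_iff:
  "mlin s F \<longleftrightarrow> vector_space s \<and> madd F \<and>
    (\<forall>c xs x ys. F (xs @ (c *s x) # ys) = s c (F (xs @ x # ys)))"
  unfolding mlin_def linear_iff madd_def by blast

lemma mlin_madd: "mlin s F \<Longrightarrow> madd F"
  by (simp add: mlin_iff)

lemma madd_additive: "madd F \<Longrightarrow> additive (\<lambda>x. F (xs @ x # ys))"
  by (rule additive.intro) (simp add: madd_def)

lemma madd_add: "madd F \<Longrightarrow> F (xs @ (x + y) # ys) = F (xs @ x # ys) + F (xs @ y # ys)"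
  by (simp add: madd_def)

lemma madd_sg: "madd F \<Longrightarrow> F (xs @ sg n x # ys) = sg n (F (xs @ x # ys))"
  by (rule sg_additive) (rule madd_add)

lemma madd_0: "madd F \<Longrightarrow> F (xs @ 0 # ys) = 0"
  using additive.zero[OF madd_additive] .

lemma madd_minus: "madd F \<Longrightarrow> F (xs @ (- x) # ys) = - F (xs @ x # ys)"
  using additive.minus[OF madd_additive] .

lemma madd_append: "madd F \<Longrightarrow> madd (\<lambda>zs. F (xs @ zs))"
  unfolding madd_def by (metis append.assoc)

lemma madd_append2: "madd F \<Longrightarrow> madd (\<lambda>zs. F (xs @ y # zs))"
  using madd_append[of F "xs @ [y]"] by simp

lemma madd_context: "madd F \<Longrightarrow> madd (\<lambda>x. F (P @ x @ Q))"
  unfolding madd_def by (metis append.assoc append_Cons)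

lemma madd_eqI:
  assumes "madd F" "madd G" "\<And>ts. homogeneous ts \<Longrightarrow> F (elts ts) = G (elts ts)"
  shows "F xs = G xs"
  by (induction xs rule: list_homogeneous_induct) (simp_all add: assms madd_add)

lemma cochainsD: "D \<in> cochains d \<Longrightarrow> mlin scale D" "D \<in> cochains d \<Longrightarrow> madd D"
  by (auto simp: cochains_def multilinear_iff_mlin mlin_madd)

lemma cochains_gr: "D \<in> cochains d \<Longrightarrow> homogeneous ts \<Longrightarrow> D (elts ts) \<in> gr (d + deg ts)"
  by (simp add: cochains_def)

lemma homogeneous_simps [simp]:
  "homogeneous []" "homogeneous (t # ts) \<longleftrightarrow> snd t \<in> gr (fst t) \<and> homogeneous ts"
  "homogeneous (ts @ us) \<longleftrightarrow> homogeneous ts \<and> homogeneous us"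
  by (auto simp: homogeneous_def)

lemma madd_tws_homogeneous:
  assumes "madd F" "homogeneous ts"
  shows "F (us @ tws n (elts ts) @ vs) = sg (n * deg ts) (F (us @ elts ts @ vs))"
  using assms(2)
proof (induction ts arbitrary: us)
  case (Cons t ts)
  have "F (us @ tws n (elts (t # ts)) @ vs) = F ((us @ [tw n (snd t)]) @ tws n (elts ts) @ vs)" by simp
  also have "\<dots> = sg (n * deg ts) (F ((us @ [tw n (snd t)]) @ elts ts @ vs))"
    by (rule Cons.IH) (use Cons.prems in simp)
  also have "\<dots> = sg (n * deg ts) (F (us @ tw n (snd t) # elts ts @ vs))" by simp
  also have "\<dots> = sg (n * deg (t # ts)) (F (us @ elts (t # ts) @ vs))"
    using Cons.prems by (simp add: tw_homogeneous[of _ "fst t"] madd_sg assms(1) algebra_simps)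
  finally show ?case .
qed simp

text \<open>
  What remains of the degree \<open>d\<close> of a cochain when Koszul signs are written with \<open>tw\<close>: a
  cochain commutes with the parity involution up to the sign given by its degree.
\<close>

definition equivariant :: "int \<Rightarrow> ('a list \<Rightarrow> 'a) \<Rightarrow> bool" where
  "equivariant d D \<longleftrightarrow> (\<forall>n xs. tw n (D xs) = sg (n * d) (D (tws n xs)))"

lemma equivariantD: "equivariant d D \<Longrightarrow> tw n (D xs) = sg (n * d) (D (tws n xs))"
  by (simp add: equivariant_def)

lemma madd_tws: "madd F \<Longrightarrow> madd (\<lambda>xs. F (tws n xs))"
  by (simp add: madd_def)

lemma madd_sg_fun: "madd F \<Longrightarrow> madd (\<lambda>xs. sg n (F xs))"
  by (simp add: madd_def sg_add)

lemma cochains_equivariant: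
  assumes "D \<in> cochains d"
  shows "equivariant d D"
  unfolding equivariant_def
proof (intro allI)
  fix n xs
  have D: "madd D" using assms by (rule cochainsD)
  show "tw n (D xs) = sg (n * d) (D (tws n xs))"
  proof (rule madd_eqI[where F = "\<lambda>xs. tw n (D xs)" and G = "\<lambda>xs. sg (n * d) (D (tws n xs))"])
    show "madd (\<lambda>xs. tw n (D xs))" using D by (simp add: madd_def)
    show "madd (\<lambda>xs. sg (n * d) (D (tws n xs)))" by (intro madd_sg_fun madd_tws D)
    fix ts assume ts: "homogeneous ts"
    have "D (tws n (elts ts)) = sg (n * deg ts) (D (elts ts))"
      using madd_tws_homogeneous[OF D ts, of "[]" n "[]"] by simp
    then show "tw n (D (elts ts)) = sg (n * d) (D (tws n (elts ts)))"
      using cochains_gr[OF assms ts] by (simp add: tw_homogeneous algebra_simps)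
  qed
qed

text \<open>
  A formula on tagged lists that agrees with a multilinear function on homogeneous arguments
  extends to this function, because every argument is the sum of its components.
\<close>

lemma multilinear_extension_eq:
  assumes "mlin scale g" "\<And>ts. homogeneous ts \<Longrightarrow> f ts = g (elts ts)"
  shows "multilinear_extension f = g"
proof
  fix xs
  let ?L = "\<lambda>xs ns. list_all2 (\<lambda>x n. component x n \<noteq> 0) xs ns"
  have *: "(\<Sum>ns | ?L xs ns. g (us @ map2 component xs ns)) = g (us @ xs)" for us
  proof (induction xs arbitrary: us)
    case Nil
    then show ?case by simp
  next
    case (Cons x xs)
    have fin: "finite {ns. ?L xs ns}" for xs
    proof (induction xs)
      case (Cons x xs)
      have "{ns. ?L (x # xs) ns} = (\<lambda>(n, ns). n # ns) ` ({n. component x n \<noteq> 0} \<times> {ns. ?L xs ns})"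
        by (auto simp: list_all2_Cons1 image_iff)
      then show ?case using Cons by (simp add: component_finite)
    qed simp
    have set_eq: "{ns. ?L (x # xs) ns} = (\<lambda>(n, ns). n # ns) ` ({n. component x n \<noteq> 0} \<times> {ns. ?L xs ns})"
      by (auto simp: list_all2_Cons1 image_iff)
    have "(\<Sum>ns | ?L (x # xs) ns. g (us @ map2 component (x # xs) ns)) =
        (\<Sum>n | component x n \<noteq> 0. \<Sum>ns | ?L xs ns. g (us @ component x n # map2 component xs ns))"
      unfolding set_eq
      by (subst sum.reindex) (auto simp: inj_on_def sum.cartesian_product intro!: sum.cong)
    also have "\<dots> = (\<Sum>n | component x n \<noteq> 0. g (us @ component x n # xs))"
      using Cons.IH[of "us @ [component x _]"] by simp
    also have "\<dots> = g (us @ (\<Sum>n | component x n \<noteq> 0. component x n) # xs)"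
      by (rule additive.sum[OF madd_additive[OF mlin_madd[OF assms(1)]], symmetric])
    finally show ?case by (simp add: component_sum)
  qed
  have "multilinear_extension f xs = (\<Sum>ns | ?L xs ns. g (map2 component xs ns))"
    unfolding multilinear_extension_def
  proof (rule sum.cong[OF refl])
    fix ns assume "ns \<in> {ns. ?L xs ns}"
    then have len: "length xs = length ns" by (auto dest: list_all2_lengthD)
    have "homogeneous (zip ns (map2 component xs ns))"
      by (auto simp: homogeneous_def set_zip component_in)
    moreover have "elts (zip ns (map2 component xs ns)) = map2 component xs ns"
      using len by (simp add: map_snd_zip)
    ultimately show "f (zip ns (map2 component xs ns)) = g (map2 component xs ns)"
      by (simp add: assms(2))
  qed
  with *[of "[]"] show "multilinear_extension f xs = g xs" by simp
qed

section \<open>Insertion of cochains\<close>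

abbreviation tdeg :: "(int \<times> ('a list \<Rightarrow> 'a)) list \<Rightarrow> int" where
  "tdeg Es \<equiv> sum_list (map fst Es)"

text \<open>
  The brace \<open>D{E\<^sub>1, \<dots>, E\<^sub>m}\<close>, for a function \<open>D\<close> with values in an arbitrary abelian group.
  The recursion inserts \<open>E\<^sub>1\<close>, with \<open>x\<close> and \<open>y\<close> the intervals \<open>I\<^sub>0\<close> and \<open>K\<^sub>1\<close>, and then
  inserts the other cochains into the remaining arguments of \<open>D\<close>. All the \<open>E\<^sub>j\<close> move across
  \<open>x\<close>, and all but the first one move across \<open>y\<close>; hence the two exponents of \<open>tw\<close>.
\<close>

primrec ins :: "('a list \<Rightarrow> 'v::ab_group_add) \<Rightarrow> (int \<times> ('a list \<Rightarrow> 'a)) list \<Rightarrow> 'a list \<Rightarrow> 'v" where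
  "ins D [] = D"
| "ins D (p # Es) = (\<lambda>xs. cutsum (\<lambda>x r. cutsum (\<lambda>y s.
     ins (\<lambda>zs. D (tws (fst p + tdeg Es) x @ snd p (tws (tdeg Es) y) # zs)) Es s) r) xs)"

lemma ins_zero [simp]: "ins (\<lambda>l. 0) Es xs = 0"
  by (induction Es arbitrary: xs) simp_all

lemma ins_add: "ins (\<lambda>l. F l + G l) Es xs = ins F Es xs + ins G Es xs"
  by (induction Es arbitrary: F G xs) (simp_all add: cutsum_add)

lemma ins_additive:
  assumes "\<And>x y. h (x + y) = h x + h y"
  shows "h (ins F Es xs) = ins (\<lambda>l. h (F l)) Es xs"
proof -
  have "h 0 = 0" using assms[of 0 0] by simp
  then show ?thesis
    by (induction Es arbitrary: F xs) (simp_all add: cutsum_additive[of h] assms)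
qed

lemma ins_sg: "ins (\<lambda>l. sg n (F l)) Es xs = sg n (ins F Es xs)"
  by (rule ins_additive[symmetric]) (rule sg_add)

lemma ins_uminus: "ins (\<lambda>l. - F l) Es xs = - ins F Es xs"
  by (rule ins_additive[symmetric]) simp

lemma ins_cutsum: "ins (\<lambda>l. cutsum (\<lambda>u v. F u v l) ys) Es xs = cutsum (\<lambda>u v. ins (F u v) Es xs) ys"
  by (induction ys arbitrary: F) (simp_all add: ins_add)

lemma ins_swap: "ins (\<lambda>b. ins (\<lambda>c. K b c) S s) Q t = ins (\<lambda>c. ins (\<lambda>b. K b c) Q t) S s"
proof (induction Q arbitrary: K t)
  case (Cons p Q)
  show ?case by (simp add: Cons.IH ins_cutsum)
qed simp

lemma ins_eq_0_if_long:
  assumes "\<And>l. length l \<ge> length Es \<Longrightarrow> F l = 0"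
  shows "ins F Es xs = 0"
  using assms
proof (induction Es arbitrary: F xs)
  case (Cons p Es)
  have "ins (\<lambda>zs. F (x @ v # zs)) Es s = 0" for x v s
    by (rule Cons.IH) (use Cons.prems in auto)
  then show ?case by (simp add: ins.simps(2))
qed simp

lemma madd_cutsum: "madd D \<Longrightarrow> D (P @ cutsum f l # Z) = cutsum (\<lambda>u v. D (P @ f u v # Z)) l"
  by (rule cutsum_additive) (simp_all add: madd_0 madd_add)

lemma madd_ins: "madd D \<Longrightarrow> D (P @ ins G Q l # Z) = ins (\<lambda>b. D (P @ G b # Z)) Q l"
  by (rule ins_additive) (simp add: madd_add)

text \<open>
  Insertion is compatible with deconcatenation: when the result is cut in two, some of the
  cochains were inserted into the left part and the others into the right part. The latter have
  moved across the left part.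
\<close>

lemma ins_cutsum_distrib:
  "ins (cutsum K) Fs s =
   cutsum (\<lambda>Q S. cutsum (\<lambda>s1 s2. ins (\<lambda>b. ins (\<lambda>c. K b c) S s2) Q (tws (tdeg S) s1)) s) Fs"
proof (induction Fs arbitrary: K s)
  case Nil
  then show ?case by simp
next
  case (Cons f Fs)
  let ?T = "tdeg Fs"
  let ?X = "\<lambda>x. tws (fst f + ?T) x" and ?v = "\<lambda>y. snd f (tws ?T y)"
  have "ins (cutsum K) (f # Fs) s =
      cutsum (\<lambda>x r. cutsum (\<lambda>y t. cutsum (\<lambda>a c. ins (\<lambda>zs. K (?X a) (?X c @ ?v y # zs)) Fs t) x) r) s +
      cutsum (\<lambda>x r. cutsum (\<lambda>y t. ins (cutsum (\<lambda>b. K (?X x @ ?v y # b))) Fs t) r) s"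
    by (simp add: cutsum_append_Cons ins_add ins_cutsum cutsum_map cutsum_add)
  also have "cutsum (\<lambda>x r. cutsum (\<lambda>y t. cutsum (\<lambda>a c. ins (\<lambda>zs. K (?X a) (?X c @ ?v y # zs)) Fs t) x) r) s =
      cutsum (\<lambda>a q. ins (K (?X a)) (f # Fs) q) s"
    by (subst cutsum_interchange) simp
  also have "cutsum (\<lambda>x r. cutsum (\<lambda>y t. ins (cutsum (\<lambda>b. K (?X x @ ?v y # b))) Fs t) r) s =
     cutsum (\<lambda>Q S. cutsum (\<lambda>x r. cutsum (\<lambda>y t. cutsum (\<lambda>t1 t2.
        ins (\<lambda>b. ins (K (?X x @ ?v y # b)) S t2) Q (tws (tdeg S) t1)) t) r) s) Fs"
    by (simp add: Cons.IH cutsum_swap[of _ Fs])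
  also have "\<dots> = cutsum (\<lambda>Q S. cutsum (\<lambda>s1 s2.
      ins (\<lambda>b. ins (K b) S s2) (f # Q) (tws (tdeg S) s1)) s) Fs"
  proof (rule cutsum_cong)
    fix Q S assume "Q @ S = Fs"
    then have Fs: "Fs = Q @ S" by simp
    show "cutsum (\<lambda>x r. cutsum (\<lambda>y t. cutsum (\<lambda>t1 t2.
        ins (\<lambda>b. ins (K (?X x @ ?v y # b)) S t2) Q (tws (tdeg S) t1)) t) r) s =
      cutsum (\<lambda>s1 s2. ins (\<lambda>b. ins (K b) S s2) (f # Q) (tws (tdeg S) s1)) s"
      by (simp add: cutsum_map Fs cutsum_assoc add.assoc)
  qed
  finally show ?case by simp
qed

lemma ins_single_append:
  "ins D [(e, E)] (X @ v # Z) =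
   cutsum (\<lambda>a r. cutsum (\<lambda>b c. D (tws e a @ E b # c @ v # Z)) r) X +
   cutsum (\<lambda>a u. cutsum (\<lambda>b c. D (tws e a @ E (u @ v # b) # c)) Z) X +
   ins (\<lambda>ws. D (tws e X @ tw e v # ws)) [(e, E)] Z"
  by (simp add: cutsum_append_Cons cutsum_add)

definition equivariants :: "(int \<times> ('a list \<Rightarrow> 'a)) list \<Rightarrow> bool" where
  "equivariants Es \<longleftrightarrow> (\<forall>p\<in>set Es. equivariant (fst p) (snd p))"

lemma equivariants_simps [simp]:
  "equivariants []" "equivariants (p # Es) \<longleftrightarrow> equivariant (fst p) (snd p) \<and> equivariants Es"
  by (auto simp: equivariants_def)

text \<open>
  The brace identity for \<open>D{E}{F\<^sub>1, \<dots>, F\<^sub>n}\<close>. In a composition some of the \<open>F\<^sub>j\<close> are inserted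
  into \<open>D\<close> to the left of \<open>E\<close>, the following ones into \<open>E\<close>, and the others into \<open>D\<close> to the
  right of \<open>E\<close>; the sign comes from moving \<open>E\<close> across the first group. For the induction on the
  list of the \<open>F\<^sub>j\<close>, the value of \<open>F\<^sub>1\<close> is a marked element of the argument list of \<open>D{E}\<close>: it
  lies behind the arguments of \<open>E\<close>, among them, or before them.
\<close>

theorem brace_single_brace:
  assumes "madd D" "equivariants Fs"
  shows "ins (ins D [(e, E)]) Fs xs =
    cutsum (\<lambda>P R. cutsum (\<lambda>Q S.
      sg (e * tdeg P) (ins D (P @ (e + tdeg Q, ins E Q) # S) xs)) R) Fs"
  using assms
proof (induction Fs arbitrary: D xs)
  case Nil
  then show ?case by simp
next
  case (Cons f Fs)
  let ?T = "tdeg Fs" and ?t = "fst f"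
  let ?X = "\<lambda>x. tws (?t + ?T) x" and ?v = "\<lambda>y. snd f (tws ?T y)"
  have D: "madd D" and f: "equivariant ?t (snd f)" and Fs: "equivariants Fs"
    using Cons.prems by auto
  have "ins (ins D [(e, E)]) (f # Fs) xs =
      cutsum (\<lambda>x r. cutsum (\<lambda>y t. ins (\<lambda>zs. ins D [(e, E)] (?X x @ ?v y # zs)) Fs t) r) xs"
    by simp
  also have "\<dots> =
      cutsum (\<lambda>x r. cutsum (\<lambda>y t. cutsum (\<lambda>a q. cutsum (\<lambda>b c.
         ins (\<lambda>zs. D (tws (e + (?t + ?T)) a @ E (?X b) # ?X c @ ?v y # zs)) Fs t) q) x) r) xs +
      cutsum (\<lambda>x r. cutsum (\<lambda>y t. cutsum (\<lambda>a u.
         ins (cutsum (\<lambda>b c. D (tws (e + (?t + ?T)) a @ E (?X u @ ?v y # b) # c))) Fs t) x) r) xs +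
      cutsum (\<lambda>x r. cutsum (\<lambda>y t.
         ins (\<lambda>zs. ins (\<lambda>ws. D (tws (e + (?t + ?T)) x @ tw e (?v y) # ws)) [(e, E)] zs) Fs t) r) xs"
    (is "_ = ?A + ?B + ?C")
    by (simp only: ins_single_append ins_add ins_cutsum cutsum_map cutsum_add tws_tws)
  also have "?A = ins D ((e, E) # f # Fs) xs"
    by (simp add: cutsum_nest)
  also have "?B = cutsum (\<lambda>Q S. ins D ((e + (?t + tdeg Q), ins E (f # Q)) # S) xs) Fs"
  proof -
    have "?B = cutsum (\<lambda>Q S. cutsum (\<lambda>x r. cutsum (\<lambda>y t. cutsum (\<lambda>a u. cutsum (\<lambda>t1 t2.
         ins (\<lambda>b. ins (\<lambda>c. D (tws (e + (?t + ?T)) a @ E (?X u @ ?v y # b) # c)) S t2) Q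
           (tws (tdeg S) t1)) t) x) r) xs) Fs"
      by (simp only: ins_cutsum_distrib cutsum_swap[of _ Fs])
    also have "\<dots> = cutsum (\<lambda>Q S. ins D ((e + (?t + tdeg Q), ins E (f # Q)) # S) xs) Fs"
    proof (rule cutsum_cong)
      fix Q S assume "Q @ S = Fs"
      then have Fs: "Fs = Q @ S" by simp
      have "ins D ((e + (?t + tdeg Q), ins E (f # Q)) # S) xs =
        cutsum (\<lambda>a r. cutsum (\<lambda>y' s. ins (\<lambda>c. cutsum (\<lambda>u r'. cutsum (\<lambda>y t1.
            ins (\<lambda>b. D (tws (e + (?t + ?T)) a @ E (?X u @ ?v y # b) # c)) Q (tws (tdeg S) t1))
            r') y') S s) r) xs"
        using D by (simp add: cutsum_map Fs madd_cutsum madd_ins add.assoc)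
      also have "\<dots> = cutsum (\<lambda>a r. cutsum (\<lambda>y' s. cutsum (\<lambda>u r'. cutsum (\<lambda>y t1.
            ins (\<lambda>b. ins (\<lambda>c. D (tws (e + (?t + ?T)) a @ E (?X u @ ?v y # b) # c)) S s) Q
              (tws (tdeg S) t1)) r') y') r) xs"
        by (simp only: ins_cutsum ins_swap[of _ Q _ S])
      also have "\<dots> = cutsum (\<lambda>x r. cutsum (\<lambda>y t. cutsum (\<lambda>a u. cutsum (\<lambda>t1 t2.
         ins (\<lambda>b. ins (\<lambda>c. D (tws (e + (?t + ?T)) a @ E (?X u @ ?v y # b) # c)) S t2) Q
           (tws (tdeg S) t1)) t) x) r) xs"
        by (simp only: cutsum_nest)
      finally show "cutsum (\<lambda>x r. cutsum (\<lambda>y t. cutsum (\<lambda>a u. cutsum (\<lambda>t1 t2.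
         ins (\<lambda>b. ins (\<lambda>c. D (tws (e + (?t + ?T)) a @ E (?X u @ ?v y # b) # c)) S t2) Q
           (tws (tdeg S) t1)) t) x) r) xs =
         ins D ((e + (?t + tdeg Q), ins E (f # Q)) # S) xs" by simp
    qed
    finally show ?thesis .
  qed
  also have "?C = cutsum (\<lambda>P R. cutsum (\<lambda>Q S. sg (e * (?t + tdeg P))
      (ins D ((f # P) @ (e + tdeg Q, ins E Q) # S) xs)) R) Fs"
  proof -
    let ?G = "\<lambda>x y ws. sg (e * ?t) (D (tws (e + (?t + ?T)) x @ snd f (tws (e + ?T) y) # ws))"
    have "D (tws (e + (?t + ?T)) x @ tw e (?v y) # ws) = ?G x y ws" for x y ws
      using D by (simp add: equivariantD[OF f] madd_sg)
    then have "?C = cutsum (\<lambda>x r. cutsum (\<lambda>y t. ins (ins (?G x y) [(e, E)]) Fs t) r) xs"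
      by simp
    also have "\<dots> = cutsum (\<lambda>x r. cutsum (\<lambda>y t. cutsum (\<lambda>P R. cutsum (\<lambda>Q S.
      sg (e * tdeg P) (ins (?G x y) (P @ (e + tdeg Q, ins E Q) # S) t)) R) Fs) r) xs"
      by (subst Cons.IH) (simp_all add: Fs D madd_append2 madd_sg_fun)
    also have "\<dots> = cutsum (\<lambda>P R. cutsum (\<lambda>Q S. cutsum (\<lambda>x r. cutsum (\<lambda>y t.
      sg (e * tdeg P) (ins (?G x y) (P @ (e + tdeg Q, ins E Q) # S) t)) r) xs) R) Fs"
      by (rule trans[OF cutsum_outwards], rule cutsum_cong, rule cutsum_outwards)
    also have "\<dots> = cutsum (\<lambda>P R. cutsum (\<lambda>Q S. sg (e * (?t + tdeg P))
      (ins D ((f # P) @ (e + tdeg Q, ins E Q) # S) xs)) R) Fs"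
    proof (rule cutsum_cong, rule cutsum_cong)
      fix P R Q S assume "P @ R = Fs" "Q @ S = R"
      then have "Fs = P @ Q @ S" by simp
      then show "cutsum (\<lambda>x r. cutsum (\<lambda>y t.
          sg (e * tdeg P) (ins (?G x y) (P @ (e + tdeg Q, ins E Q) # S) t)) r) xs =
        sg (e * (?t + tdeg P)) (ins D ((f # P) @ (e + tdeg Q, ins E Q) # S) xs)"
        by (simp add: ins_sg cutsum_sg algebra_simps)
    qed
    finally show ?thesis .
  qed
  finally show ?case by simp
qed

text \<open>
  The brace identity for \<open>D{E\<^sub>1, \<dots>, E\<^sub>n}{G}\<close>: either \<open>G\<close> goes directly into \<open>D\<close>, at one of the
  \<open>n + 1\<close> positions relative to the \<open>E\<^sub>j\<close>, or it goes into one of the \<open>E\<^sub>j\<close>. The sign comes from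
  moving \<open>G\<close> across those \<open>E\<^sub>j\<close> that end up behind it.
\<close>

theorem brace_brace_single:
  assumes "madd D" "\<And>p. p \<in> set Es \<Longrightarrow> madd (snd p)" "equivariant g G"
  shows "ins (ins D Es) [(g, G)] xs =
    cutsum (\<lambda>P S. sg (g * tdeg S) (ins D (P @ (g, G) # S) xs)) Es +
    cutsum (\<lambda>P S. case S of [] \<Rightarrow> 0 | p # S' \<Rightarrow>
      sg (g * tdeg S') (ins D (P @ (fst p + g, ins (snd p) [(g, G)]) # S') xs)) Es"
  using assms(1,2)
proof (induction Es arbitrary: D xs)
  case Nil
  then show ?case by simp
next
  case (Cons p Es)
  let ?T = "tdeg Es" and ?e = "fst p" and ?E = "snd p"
  have D: "madd D" and E: "madd ?E" and Es: "\<And>p. p \<in> set Es \<Longrightarrow> madd (snd p)"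
    using Cons.prems by auto
  have "ins (ins D (p # Es)) [(g, G)] xs =
      cutsum (\<lambda>x r. cutsum (\<lambda>y z. ins D (p # Es) (tws g x @ G y # z)) r) xs" by simp
  also have "\<dots> =
     cutsum (\<lambda>x r. cutsum (\<lambda>y z. cutsum (\<lambda>a q. cutsum (\<lambda>b c.
       ins (\<lambda>zs. D (tws (?e + ?T + g) a @ ?E (tws (?T + g) b) # zs)) Es (tws g c @ G y # z)) q) x) r) xs +
     cutsum (\<lambda>x r. cutsum (\<lambda>y z. cutsum (\<lambda>a u. cutsum (\<lambda>b s.
       ins (\<lambda>zs. D (tws (?e + ?T + g) a @ ?E (tws (?T + g) u @ tw ?T (G y) # tws ?T b) # zs)) Es s) z) x) r) xs +
     cutsum (\<lambda>x r. cutsum (\<lambda>y z. cutsum (\<lambda>a r. cutsum (\<lambda>b s.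
       ins (\<lambda>zs. D (tws (?e + ?T + g) x @ tw (?e + ?T) (G y) # tws (?e + ?T) a @ ?E (tws ?T b) # zs)) Es s) r) z) r) xs"
    (is "_ = ?A + ?B + ?C")
    by (simp add: cutsum_append_Cons cutsum_map cutsum_add)
  also have "?A = cutsum (\<lambda>a q. cutsum (\<lambda>b t.
      ins (ins (\<lambda>zs. D (tws (?e + ?T + g) a @ ?E (tws (?T + g) b) # zs)) Es) [(g, G)] t) q) xs"
    by (simp add: cutsum_nest)
  also have "\<dots> = cutsum (\<lambda>a q. cutsum (\<lambda>b t.
      cutsum (\<lambda>P S. sg (g * tdeg S) (ins (\<lambda>zs. D (tws (?e + ?T + g) a @ ?E (tws (?T + g) b) # zs)) (P @ (g, G) # S) t)) Es +
      cutsum (\<lambda>P S. case S of [] \<Rightarrow> 0 | p # S' \<Rightarrow>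
      sg (g * tdeg S') (ins (\<lambda>zs. D (tws (?e + ?T + g) a @ ?E (tws (?T + g) b) # zs)) (P @ (fst p + g, ins (snd p) [(g, G)]) # S') t)) Es) q) xs"
    by (subst Cons.IH) (simp_all add: madd_append2 D Es)
  also have "\<dots> = cutsum (\<lambda>P S. sg (g * tdeg S) (ins D ((p # P) @ (g, G) # S) xs)) Es +
    cutsum (\<lambda>P S. case S of [] \<Rightarrow> 0 | q # S' \<Rightarrow>
      sg (g * tdeg S') (ins D ((p # P) @ (fst q + g, ins (snd q) [(g, G)]) # S') xs)) Es"
    unfolding cutsum_add cutsum_swap[of _ Es]
  proof (rule arg_cong2[where f = "(+)"]; rule cutsum_cong)
    fix P S assume "P @ S = Es"
    then have Es: "Es = P @ S" by simp
    show "cutsum (\<lambda>a q. cutsum (\<lambda>b t. sg (g * tdeg S) (ins (\<lambda>zs. D (tws (?e + ?T + g) a @ ?E (tws (?T + g) b) # zs)) (P @ (g, G) # S) t)) q) xs =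
      sg (g * tdeg S) (ins D ((p # P) @ (g, G) # S) xs)"
      by (simp add: cutsum_sg Es ac_simps)
    show "cutsum (\<lambda>a q. cutsum (\<lambda>b t. case S of [] \<Rightarrow> 0 | p # S' \<Rightarrow>
      sg (g * tdeg S') (ins (\<lambda>zs. D (tws (?e + ?T + g) a @ ?E (tws (?T + g) b) # zs)) (P @ (fst p + g, ins (snd p) [(g, G)]) # S') t)) q) xs =
      (case S of [] \<Rightarrow> 0 | q # S' \<Rightarrow>
      sg (g * tdeg S') (ins D ((p # P) @ (fst q + g, ins (snd q) [(g, G)]) # S') xs))"
      by (cases S) (simp_all add: cutsum_sg Es ac_simps)
  qed
  also have "?B = sg (g * ?T) (ins D ((?e + g, ins ?E [(g, G)]) # Es) xs)"
  proof -
    have "ins D ((?e + g, ins ?E [(g, G)]) # Es) xs =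
      cutsum (\<lambda>a r. cutsum (\<lambda>t s. cutsum (\<lambda>u q. cutsum (\<lambda>y b.
       ins (\<lambda>zs. D (tws (?e + ?T + g) a @ ?E (tws (?T + g) u @ G (tws ?T y) # tws ?T b) # zs)) Es s) q) t) r) xs"
      using D by (simp add: cutsum_map madd_cutsum ins_cutsum ac_simps)
    also have "\<dots> = cutsum (\<lambda>x r. cutsum (\<lambda>y z. cutsum (\<lambda>a u. cutsum (\<lambda>b s.
       ins (\<lambda>zs. D (tws (?e + ?T + g) a @ ?E (tws (?T + g) u @ G (tws ?T y) # tws ?T b) # zs)) Es s) z) x) r) xs"
      by (simp only: cutsum_nest)
    finally show ?thesis
      using D E by (simp add: equivariantD[OF assms(3)] madd_sg ins_sg cutsum_sg ac_simps)
  qed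
  also have "?C = sg (g * (?e + ?T)) (ins D ((g, G) # p # Es) xs)"
    using D by (simp add: equivariantD[OF assms(3)] madd_sg ins_sg cutsum_sg ac_simps)
  finally show ?case by (simp add: ac_simps)
qed


lemma sg_eq_powi: "(-1) powi n *s v = sg n v"
  by (cases "even n") (simp_all add: sg_def power_int_minus_left)

section \<open>Braces of cochains\<close>

lemma mlin_scale: "mlin s F \<Longrightarrow> F (xs @ (c *s x) # ys) = s c (F (xs @ x # ys))"
  by (simp add: mlin_iff)

lemma mlinI:
  assumes "vector_space s" "\<And>xs x y ys. F (xs @ (x + y) # ys) = F (xs @ x # ys) + F (xs @ y # ys)"
    "\<And>c xs x ys. F (xs @ (c *s x) # ys) = s c (F (xs @ x # ys))"
  shows "mlin s F"
  using assms by (simp add: mlin_iff madd_def)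

lemma mlin_vector_space: "mlin s F \<Longrightarrow> vector_space s"
  by (simp add: mlin_iff)

lemma mlin_context:
  assumes "mlin s F"
  shows "mlin s (\<lambda>x. F (P @ tws n x @ Q))"
  using madd_add[OF mlin_madd[OF assms], of "P @ tws n _" _ _ "tws n _ @ Q"]
    mlin_scale[OF assms, of "P @ tws n _" _ _ "tws n _ @ Q"]
  by (intro mlinI mlin_vector_space[OF assms]) (simp_all add: tw_scale)

lemma mlin_argument:
  assumes "mlin s F" "mlin scale E"
  shows "mlin s (\<lambda>y. F (P @ E (tws n y) # Q))"
  using madd_add[OF mlin_madd[OF assms(2)], of "tws n _" _ _ "tws n _"]
    mlin_scale[OF assms(2), of "tws n _" _ _ "tws n _"]
  by (intro mlinI mlin_vector_space[OF assms(1)])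
    (simp_all add: tw_scale mlin_scale[OF assms(1)] madd_add[OF mlin_madd[OF assms(1)]])

lemma mlin_append2: "mlin s F \<Longrightarrow> mlin s (\<lambda>zs. F (P @ y # zs))"
  using mlin_context[of s F "P @ [y]" 0 "[]"] by simp

lemma mlin_zero: "vector_space s \<Longrightarrow> mlin s (\<lambda>x. 0)"
  by (rule mlinI) (simp_all add: vector_space.vector_space_assms module.scale_zero_right module_iff_vector_space)

lemma mlin_add:
  assumes "mlin s F" "mlin s G"
  shows "mlin s (\<lambda>x. F x + G x)"
proof -
  interpret v: vector_space s using assms(1) by (rule mlin_vector_space)
  show ?thesis using assms
    by (intro mlinI v.vector_space_axioms)
      (simp_all add: mlin_scale[of s] madd_add[OF mlin_madd] v.scale_right_distrib)
qed

lemma mlin_scaled: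
  assumes "mlin s F"
  shows "mlin s (\<lambda>x. s c (F x))"
proof -
  interpret v: vector_space s using assms(1) by (rule mlin_vector_space)
  show ?thesis using assms
    by (intro mlinI v.vector_space_axioms)
      (simp_all add: mlin_scale[of s] madd_add[OF mlin_madd] v.scale_right_distrib mult.commute)
qed

lemma mlin_uminus:
  assumes "mlin s F"
  shows "mlin s (\<lambda>x. - F x)"
proof -
  interpret v: vector_space s using assms(1) by (rule mlin_vector_space)
  show ?thesis using mlin_scaled[OF assms, of "-1"] by simp
qed

lemma mlin_cutsum_parameter:
  assumes "vector_space s" "\<And>u v. mlin s (\<lambda>x. F x u v)"
  shows "mlin s (\<lambda>x. cutsum (F x) l)"
  using assms(2) by (induction l arbitrary: F) (simp_all add: mlin_add)

lemma mlin_cutsum: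
  assumes "vector_space s" "\<And>v. mlin s (\<lambda>u. F u v)" "\<And>u. mlin s (F u)"
  shows "mlin s (cutsum F)"
proof -
  interpret v: vector_space s by fact
  show ?thesis
  proof (rule mlinI)
    fix c xs x y ys
    show "cutsum F (xs @ (x + y) # ys) = cutsum F (xs @ x # ys) + cutsum F (xs @ y # ys)"
      using madd_add[OF mlin_madd[OF assms(2)]] madd_add[OF mlin_madd[OF assms(3)]]
      by (simp add: cutsum_append_Cons cutsum_add)
    show "cutsum F (xs @ (c *s x) # ys) = s c (cutsum F (xs @ x # ys))"
      using mlin_scale[OF assms(2)] mlin_scale[OF assms(3)]
      by (simp add: cutsum_append_Cons v.scale_right_distrib cutsum_additive[of "s c"])
  qed fact
qed

lemma mlin_ins_parameter:
  assumes "vector_space s" "\<And>l. mlin s (\<lambda>x. F x l)"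
  shows "mlin s (\<lambda>x. ins (F x) Es l)"
  using assms(2) by (induction Es arbitrary: F l) (simp_all add: mlin_cutsum_parameter assms(1))

lemma mlin_ins:
  assumes "mlin s D" "\<And>p. p \<in> set Es \<Longrightarrow> mlin scale (snd p)"
  shows "mlin s (ins D Es)"
  using assms
proof (induction Es arbitrary: D)
  case Nil
  then show ?case by simp
next
  case (Cons p Es)
  note s = mlin_vector_space[OF Cons.prems(1)]
  show ?case
    unfolding ins.simps
    using mlin_context[OF Cons.prems(1), of "[]"] Cons.prems mlin_argument[of s D "snd p"]
    by (intro mlin_cutsum mlin_cutsum_parameter mlin_ins_parameter Cons.IH mlin_append2 s) auto
qed

lemma cutsum_in_gr: "(\<And>u v. u @ v = xs \<Longrightarrow> f u v \<in> gr n) \<Longrightarrow> cutsum f xs \<in> gr n"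
proof (induction xs arbitrary: f)
  case (Cons x xs)
  have "cutsum (\<lambda>u. f (x # u)) xs \<in> gr n" by (rule Cons.IH) (use Cons.prems in auto)
  then show ?case using Cons.prems[of "[]"] by (simp add: gr_add)
qed simp

lemma homogeneous_tws:
  assumes "homogeneous ts"
  obtains us where "homogeneous us" "elts us = tws n (elts ts)" "deg us = deg ts"
proof
  let ?us = "map (\<lambda>t. (fst t, tw n (snd t))) ts"
  show "homogeneous ?us" using assms by (induction ts) (auto simp: tw_gr)
  show "elts ?us = tws n (elts ts)" "deg ?us = deg ts" by (simp_all add: comp_def)
qed

lemma ins_in_gr:
  assumes "\<And>ts. homogeneous ts \<Longrightarrow> D (elts ts) \<in> gr (d + deg ts)"
    and "\<And>p ts. p \<in> set Es \<Longrightarrow> homogeneous ts \<Longrightarrow> snd p (elts ts) \<in> gr (fst p + deg ts)"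
    and "homogeneous ts"
  shows "ins D Es (elts ts) \<in> gr (d + tdeg Es + deg ts)"
  using assms
proof (induction Es arbitrary: D d ts)
  case Nil
  then show ?case by simp
next
  case (Cons p Es)
  show ?case
    unfolding ins.simps cutsum_map
  proof (rule cutsum_in_gr, rule cutsum_in_gr)
    fix x r y s assume ts: "x @ r = ts" "y @ s = r"
    with Cons.prems(3) have "homogeneous x" "homogeneous y" and s: "homogeneous s" by auto
    obtain x' where x': "homogeneous x'" "elts x' = tws (fst p + tdeg Es) (elts x)" "deg x' = deg x"
      using homogeneous_tws[OF \<open>homogeneous x\<close>] .
    obtain y' where y': "homogeneous y'" "elts y' = tws (tdeg Es) (elts y)" "deg y' = deg y"
      using homogeneous_tws[OF \<open>homogeneous y\<close>] .
    let ?v = "snd p (elts y')"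
    have v: "?v \<in> gr (fst p + deg y')" using Cons.prems(2)[of p] y'(1) by simp
    have "ins (\<lambda>zs. D (elts x' @ ?v # zs)) Es (elts s) \<in> gr ((d + deg x' + fst p + deg y') + tdeg Es + deg s)"
    proof (rule Cons.IH)
      fix us assume "homogeneous us"
      then show "D (elts x' @ ?v # elts us) \<in> gr (d + deg x' + fst p + deg y' + deg us)"
        using Cons.prems(1)[of "x' @ (fst p + deg y', ?v) # us"] x' v by (simp add: ac_simps)
    qed (use Cons.prems(2) s in auto)
    then show "ins (\<lambda>zs. D (tws (fst p + tdeg Es) (elts x) @ snd p (tws (tdeg Es) (elts y)) # zs)) Es (elts s)
      \<in> gr (d + tdeg (p # Es) + deg ts)"
      using x' y' by (simp add: ts[symmetric] ac_simps)
  qed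
qed

lemma cochains_ins:
  assumes "D \<in> cochains d" "\<And>p. p \<in> set Es \<Longrightarrow> snd p \<in> cochains (fst p)"
  shows "ins D Es \<in> cochains (d + tdeg Es)"
  unfolding cochains_def multilinear_iff_mlin
proof (intro CollectI conjI allI impI)
  show "mlin scale (ins D Es)" by (intro mlin_ins cochainsD(1)[OF assms(1)] cochainsD(1)[OF assms(2)])
  fix ts assume "homogeneous ts"
  then show "ins D Es (elts ts) \<in> gr (d + tdeg Es + deg ts)"
    by (intro ins_in_gr cochains_gr[OF assms(1)] cochains_gr[OF assms(2)])
qed

lemma cochains_add: "D \<in> cochains d \<Longrightarrow> E \<in> cochains d \<Longrightarrow> D + E \<in> cochains d"
  and cochains_scale: "D \<in> cochains d \<Longrightarrow> (\<lambda>xs. c *s D xs) \<in> cochains d"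
  and cochains_uminus: "D \<in> cochains d \<Longrightarrow> - D \<in> cochains d"
  and cochains_0: "0 \<in> cochains d"
  using mlin_zero[OF vector_space_axioms]
  by (auto simp: cochains_def multilinear_iff_mlin plus_fun_def fun_Compl_def zero_fun_def
      gr_add gr_scale gr_uminus mlin_add mlin_scaled mlin_uminus)

lemma cochains_sg: "D \<in> cochains d \<Longrightarrow> sg n D \<in> cochains d"
  by (simp add: sg_def cochains_uminus)

lemma cochains_diff: "D \<in> cochains d \<Longrightarrow> E \<in> cochains d \<Longrightarrow> D - E \<in> cochains d"
  using cochains_add[of D d "- E"] cochains_uminus[of E d] by simp

text \<open>
  On homogeneous arguments the explicit Koszul sign of a decomposition is the product of the
  signs that the operators \<open>tw\<close> in the recursion produce.
\<close>

lemma sum_decompositions_tagged_eq_ins: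
  assumes "madd D" "\<And>p. p \<in> set Es \<Longrightarrow> madd (snd p)" "homogeneous ts"
  shows "(\<Sum>Js | length Js = 2 * length Es + 1 \<and> concat Js = ts.
       sg (\<Sum>j<length Es. fst (Es ! j) * deg (concat (take (2 * j + 1) Js)))
       (D (concat (map (\<lambda>p. if even p then elts (Js ! p) else [snd (Es ! (p div 2)) (elts (Js ! p))])
            [0..<length Js])))) = ins D Es (elts ts)"
  using assms
proof (induction Es arbitrary: D ts)
  case Nil
  have *: "{Js. Js = [] \<and> concat Js = v} = (if v = [] then {[]} else {})" for v :: "(int \<times> 'a) list"
    by auto
  show ?case
    by (simp add: sum_decompositions_Suc *, subst cutsum_only_last) auto
next
  case (Cons p Es)
  let ?n = "length Es" and ?T = "tdeg Es" and ?e = "fst p"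
  have len: "2 * length (p # Es) + 1 = Suc (Suc (2 * ?n + 1))" by simp
  have D: "madd D" and E: "madd (snd p)" using Cons.prems by auto
  let ?w = "\<lambda>Es Js. map (\<lambda>p. if even p then elts (Js ! p) else [snd (Es ! (p div 2)) (elts (Js ! p))])
            [0..<length Js]"
  let ?s = "\<lambda>Es Js. \<Sum>j<length Es. fst (Es ! j) * deg (concat (take (2 * j + 1) Js))"
  have w: "concat (?w (p # Es) (x # y # Js)) = elts x @ snd p (elts y) # concat (?w Es Js)" for x y Js
  proof -
    have "map Suc (map Suc [0..<length Js]) = [2..<length (x # y # Js)]"
      unfolding map_Suc_upt by (simp add: numeral_2_eq_2 del: upt_Suc)
    moreover have "[0..<length (x # y # Js)] = 0 # 1 # [2..<length (x # y # Js)]"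
      by (simp add: upt_conv_Cons numeral_2_eq_2 del: upt_Suc)
    ultimately have upt: "[0..<length (x # y # Js)] = 0 # 1 # map (\<lambda>i. Suc (Suc i)) [0..<length Js]"
      by (simp add: comp_def del: upt_Suc)
    show ?thesis unfolding upt by (simp add: comp_def del: upt_Suc cong: if_cong)
  qed
  have sgn: "?s (p # Es) (x # y # Js) = (?e + ?T) * deg x + ?T * deg y + ?s Es Js" for x y Js
  proof -
    have T: "?T = (\<Sum>j<?n. fst (Es ! j))"
      by (simp add: sum_list_sum_nth atLeast0LessThan)
    have "?s (p # Es) (x # y # Js) = ?e * deg x + (\<Sum>j<?n. fst (Es ! j) * (deg x + deg y + deg (concat (take (2 * j + 1) Js))))"
      by (simp add: sum.lessThan_Suc_shift add.assoc del: sum.lessThan_Suc)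
    then show ?thesis by (simp add: T algebra_simps sum.distrib sum_distrib_left)
  qed
  have "(\<Sum>Js | length Js = 2 * length (p # Es) + 1 \<and> concat Js = ts.
       sg (?s (p # Es) Js) (D (concat (?w (p # Es) Js)))) =
    cutsum (\<lambda>x r. cutsum (\<lambda>y s. \<Sum>Js | length Js = 2 * ?n + 1 \<and> concat Js = s.
       sg (?s (p # Es) (x # y # Js)) (D (concat (?w (p # Es) (x # y # Js))))) r) ts"
    unfolding len sum_decompositions_Suc ..
  also have "\<dots> = cutsum (\<lambda>x r. cutsum (\<lambda>y s.
      ins (\<lambda>zs. D (tws (?e + ?T) (elts x) @ snd p (tws ?T (elts y)) # zs)) Es (elts s)) r) ts"
  proof (rule cutsum_cong, rule cutsum_cong)
    fix x r y s assume ts: "x @ r = ts" "y @ s = r"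
    with Cons.prems(3) have x: "homogeneous x" and y: "homogeneous y" and s: "homogeneous s" by auto
    let ?D = "\<lambda>zs. D (elts x @ snd p (elts y) # zs)" and ?k = "(?e + ?T) * deg x + ?T * deg y"
    have "(\<Sum>Js | length Js = 2 * ?n + 1 \<and> concat Js = s.
       sg (?s (p # Es) (x # y # Js)) (D (concat (?w (p # Es) (x # y # Js))))) =
      sg ?k (\<Sum>Js | length Js = 2 * ?n + 1 \<and> concat Js = s. sg (?s Es Js) (?D (concat (?w Es Js))))"
      unfolding w sgn by (subst additive.sum[of "sg ?k"]) (simp_all add: additive_def sg_add)
    also have "\<dots> = sg ?k (ins ?D Es (elts s))"
      by (subst Cons.IH) (use Cons.prems s in \<open>auto intro: madd_append2\<close>)
    also have "\<dots> = ins (\<lambda>zs. D (tws (?e + ?T) (elts x) @ snd p (tws ?T (elts y)) # zs)) Es (elts s)"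
      using madd_tws_homogeneous[OF D x, of "[]" "?e + ?T"] madd_tws_homogeneous[OF E y, of "[]" ?T "[]"]
      by (simp add: madd_sg[OF D] ins_sg add.commute)
    finally show "(\<Sum>Js | length Js = 2 * ?n + 1 \<and> concat Js = s.
       sg (?s (p # Es) (x # y # Js)) (D (concat (?w (p # Es) (x # y # Js))))) =
       ins (\<lambda>zs. D (tws (?e + ?T) (elts x) @ snd p (tws ?T (elts y)) # zs)) Es (elts s)" .
  qed
  finally show ?case by (simp add: cutsum_map)
qed

theorem brace_eq_ins:
  assumes "mlin scale D" "\<And>p. p \<in> set Es \<Longrightarrow> mlin scale (snd p)"
  shows "brace D Es = ins D Es"
  unfolding brace_def sg_eq_powi
  by (intro multilinear_extension_eq mlin_ins assms sum_decompositions_tagged_eq_ins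
      mlin_madd[OF assms(1)] mlin_madd[OF assms(2)])

lemma ins_plus: "ins (F + G) Es = ins F Es + ins G Es"
  by (simp add: fun_eq_iff plus_fun_def ins_add)

lemma ins_sg_fun: "ins (sg n F) Es = sg n (ins F Es)"
  by (cases "even n") (simp_all add: sg_def fun_eq_iff fun_Compl_def ins_uminus)

lemma ins_minus_fun: "ins (- F) Es = - ins F Es"
  using ins_sg_fun[of 1] by simp

lemma ins_minus: "ins (F - G) Es = ins F Es - ins G Es"
  using ins_plus[of F "- G" Es] by (simp add: ins_minus_fun)

lemma ins_scale: "ins (\<lambda>xs. c *s F xs) Es xs = c *s ins F Es xs"
  by (rule ins_additive[symmetric]) (rule scale_right_distrib)

lemma ins_zero_fun [simp]: "ins 0 Es = 0"
  by (simp add: fun_eq_iff zero_fun_def)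

lemma ins_slot_plus:
  "madd D \<Longrightarrow> ins D (P @ (e, E + E') # S) = ins D (P @ (e, E) # S) + ins D (P @ (e, E') # S)"
proof (induction P arbitrary: D)
  case Nil
  then show ?case by (simp add: fun_eq_iff madd_add ins_add cutsum_add)
next
  case (Cons p P)
  then show ?case by (simp add: fun_eq_iff madd_append2 cutsum_add)
qed

lemma ins_slot_sg:
  assumes "madd D"
  shows "ins D (P @ (e, sg n E) # S) = sg n (ins D (P @ (e, E) # S))"
  by (rule sg_additive[of "\<lambda>E. ins D (P @ (e, E) # S)"]) (rule ins_slot_plus[OF assms])

lemma ins_slot_uminus: "madd D \<Longrightarrow> ins D (P @ (e, - E) # S) = - ins D (P @ (e, E) # S)"
  using ins_slot_sg[of D P e 1] by simp

lemma ins_slot_0: "madd D \<Longrightarrow> ins D (P @ (e, 0) # S) = 0"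
  using ins_slot_plus[of D P e 0 0 S] by simp

lemma ins_slot_minus:
  "madd D \<Longrightarrow> ins D (P @ (e, E - E') # S) = ins D (P @ (e, E) # S) - ins D (P @ (e, E') # S)"
  using ins_slot_plus[of D P e E "- E'"] by (simp add: ins_slot_uminus)

lemma ins_slot_scale:
  "mlin scale D \<Longrightarrow> ins D (P @ (e, \<lambda>xs. c *s E xs) # S) = (\<lambda>xs. c *s ins D (P @ (e, E) # S) xs)"
proof (induction P arbitrary: D)
  case Nil
  then show ?case
    by (simp add: fun_eq_iff mlin_scale ins_scale
        cutsum_additive[of "\<lambda>v. c *s v", symmetric] scale_right_distrib)
next
  case (Cons p P)
  then show ?case
    by (simp add: fun_eq_iff mlin_append2 cutsum_additive[of "\<lambda>v. c *s v", symmetric] scale_right_distrib)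
qed


text \<open>From here on a brace is an atom for the simplifier and is rewritten by the brace identities,
  except where its definition as a sum over cuts is given explicitly.\<close>

declare ins.simps(2) [simp del]

section \<open>The graded Lie algebra of cochains\<close>

text \<open>
  The instances of the two brace identities that enter the proofs below; \<open>brace_n_k\<close> inserts
  \<open>k\<close> cochains into a brace with \<open>n\<close> entries. The difference \<open>D{E}{F} - D{E{F}}\<close> is graded
  symmetric in \<open>E\<close> and \<open>F\<close>, which is the pre-Lie identity.
\<close>

lemma brace_1_1:
  assumes "D \<in> cochains d" "F \<in> cochains f"
  shows "ins (ins D [(e, E)]) [(f, F)] =
    ins D [(e + f, ins E [(f, F)])] + ins D [(e, E), (f, F)] + sg (e * f) (ins D [(f, F), (e, E)])"
  by (rule ext, subst brace_single_brace)
    (use assms in \<open>simp_all add: cochainsD cochains_equivariant\<close>)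

lemma brace_1_2:
  assumes "D \<in> cochains d" "F \<in> cochains f" "G \<in> cochains g"
  shows "ins (ins D [(e, E)]) [(f, F), (g, G)] =
    ins D [(e + f + g, ins E [(f, F), (g, G)])] +
    ins D [(e + f, ins E [(f, F)]), (g, G)] + sg (e * f) (ins D [(f, F), (e + g, ins E [(g, G)])]) +
    ins D [(e, E), (f, F), (g, G)] + sg (e * f) (ins D [(f, F), (e, E), (g, G)]) +
    sg (e * (f + g)) (ins D [(f, F), (g, G), (e, E)])"
  by (rule ext, subst brace_single_brace)
    (use assms in \<open>simp_all add: cochainsD cochains_equivariant algebra_simps\<close>)

lemma brace_1_3:
  assumes "D \<in> cochains d" "F \<in> cochains f" "G \<in> cochains g" "H \<in> cochains h"
  shows "ins (ins D [(e, E)]) [(f, F), (g, G), (h, H)] =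
    ins D [(e + f + g + h, ins E [(f, F), (g, G), (h, H)])] +
    ins D [(e + f + g, ins E [(f, F), (g, G)]), (h, H)] +
    sg (e * f) (ins D [(f, F), (e + g + h, ins E [(g, G), (h, H)])]) +
    ins D [(e + f, ins E [(f, F)]), (g, G), (h, H)] +
    sg (e * f) (ins D [(f, F), (e + g, ins E [(g, G)]), (h, H)]) +
    sg (e * (f + g)) (ins D [(f, F), (g, G), (e + h, ins E [(h, H)])]) +
    ins D [(e, E), (f, F), (g, G), (h, H)] + sg (e * f) (ins D [(f, F), (e, E), (g, G), (h, H)]) +
    sg (e * (f + g)) (ins D [(f, F), (g, G), (e, E), (h, H)]) +
    sg (e * (f + g + h)) (ins D [(f, F), (g, G), (h, H), (e, E)])"
  by (rule ext, subst brace_single_brace)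
    (use assms in \<open>simp_all add: cochainsD cochains_equivariant algebra_simps\<close>)

lemma brace_2_1:
  assumes "D \<in> cochains d" "E \<in> cochains e" "F \<in> cochains f" "G \<in> cochains g"
  shows "ins (ins D [(e, E), (f, F)]) [(g, G)] =
    ins D [(e, E), (f + g, ins F [(g, G)])] + sg (g * f) (ins D [(e + g, ins E [(g, G)]), (f, F)]) +
    ins D [(e, E), (f, F), (g, G)] + sg (g * f) (ins D [(e, E), (g, G), (f, F)]) +
    sg (g * (e + f)) (ins D [(g, G), (e, E), (f, F)])"
  by (rule ext, subst brace_brace_single)
    (use assms in \<open>auto simp: cochainsD cochains_equivariant algebra_simps\<close>)

lemma brace_3_1:
  assumes "D \<in> cochains d" "E \<in> cochains e" "F \<in> cochains f" "G \<in> cochains g" "H \<in> cochains h"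
  shows "ins (ins D [(e, E), (f, F), (g, G)]) [(h, H)] =
    ins D [(e, E), (f, F), (g + h, ins G [(h, H)])] +
    sg (h * g) (ins D [(e, E), (f + h, ins F [(h, H)]), (g, G)]) +
    sg (h * (f + g)) (ins D [(e + h, ins E [(h, H)]), (f, F), (g, G)]) +
    ins D [(e, E), (f, F), (g, G), (h, H)] + sg (h * g) (ins D [(e, E), (f, F), (h, H), (g, G)]) +
    sg (h * (f + g)) (ins D [(e, E), (h, H), (f, F), (g, G)]) +
    sg (h * (e + f + g)) (ins D [(h, H), (e, E), (f, F), (g, G)])"
  by (rule ext, subst brace_brace_single)
    (use assms in \<open>auto simp: cochainsD cochains_equivariant algebra_simps\<close>)

lemmas ins_slots =
  ins_slot_plus[where P = "[]", unfolded append_Nil]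
  ins_slot_plus[where P = "[p]" for p, unfolded append_Cons append_Nil]
  ins_slot_minus[where P = "[]", unfolded append_Nil]
  ins_slot_minus[where P = "[p]" for p, unfolded append_Cons append_Nil]
  ins_slot_uminus[where P = "[]", unfolded append_Nil]
  ins_slot_uminus[where P = "[p]" for p, unfolded append_Cons append_Nil]
  ins_slot_0[where P = "[]", unfolded append_Nil]
  ins_slot_0[where P = "[p]" for p, unfolded append_Cons append_Nil]

lemma bracket_eq:
  assumes "D \<in> cochains d" "E \<in> cochains e"
  shows "bracket d e D E = ins D [(e, E)] - sg (d * e) (ins E [(d, D)])"
  unfolding bracket_def
  by (subst (1 2) brace_eq_ins)
    (use assms in \<open>auto simp: cochainsD fun_eq_iff sg_eq_powi\<close>)

lemma cochains_ins1: "D \<in> cochains d \<Longrightarrow> E \<in> cochains e \<Longrightarrow> ins D [(e, E)] \<in> cochains (d + e)"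
  using cochains_ins[of D d "[(e, E)]"] by simp

lemma cochains_bracket:
  assumes "D \<in> cochains d" "E \<in> cochains e"
  shows "bracket d e D E \<in> cochains (d + e)"
  using cochains_ins1[of D d E e] cochains_ins1[of E e D d] assms
  by (simp add: bracket_eq[OF assms] cochains_diff cochains_sg add.commute)

text \<open>
  The bracket is the commutator of a pre-Lie product. The terms \<open>X{Y,Z}\<close> cancel by the symmetry
  of the pre-Lie identity.
\<close>

lemma bracket_jacobi_cochains:
  assumes D: "D \<in> cochains d" and E: "E \<in> cochains e" and F: "F \<in> cochains f"
  shows "bracket d (e + f) D (bracket e f E F) =
    bracket (d + e) f (bracket d e D E) F + sg (d * e) (bracket e (d + f) E (bracket d f D F))"
proof -
  note * = brace_1_1[OF D E, of f F] brace_1_1[OF D F, of e E] brace_1_1[OF E D, of f F]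
    brace_1_1[OF E F, of d D] brace_1_1[OF F D, of e E] brace_1_1[OF F E, of d D]
  show ?thesis
    unfolding bracket_eq[OF D cochains_bracket[OF E F]] bracket_eq[OF cochains_bracket[OF D E] F]
      bracket_eq[OF E cochains_bracket[OF D F]]
    unfolding bracket_eq[OF D E] bracket_eq[OF D F] bracket_eq[OF E F]
    by (cases "even d"; cases "even e"; cases "even f")
      (simp_all add: ins_slots cochainsD(2)[OF D] cochainsD(2)[OF E] cochainsD(2)[OF F]
        ins_minus ins_plus ins_minus_fun * sg_def algebra_simps)
qed

end

context A_infinity_algebra
begin

section \<open>The Hochschild complex\<close>

lemma m_mlin: "mlin scale m" and m_madd: "madd m" and m_equivariant: "equivariant 1 m"
  using m_cochain by (auto intro: cochainsD cochains_equivariant)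

lemma m_brace_m: "ins m [(1, m)] = 0"
  using m_m m_mlin by (subst brace_eq_ins[symmetric]) auto

lemma hochschild_diff_eq:
  assumes "D \<in> cochains d"
  shows "hochschild_diff d D = ins m [(d, D)] - sg d (ins D [(1, m)])"
  unfolding hochschild_diff_def
  by (subst (1 2) brace_eq_ins)
    (use assms in \<open>auto simp: cochainsD m_mlin fun_eq_iff sg_eq_powi\<close>)

lemma hochschild_diff_eq_bracket: "D \<in> cochains d \<Longrightarrow> hochschild_diff d D = bracket 1 d m D"
  by (simp add: hochschild_diff_eq bracket_eq m_cochain)

lemma cochains_hochschild_diff: "D \<in> cochains d \<Longrightarrow> hochschild_diff d D \<in> cochains (d + 1)"
  using cochains_bracket[OF m_cochain, of D d] by (simp add: hochschild_diff_eq_bracket add.commute)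

lemma cup_eq:
  assumes "D \<in> cochains d" "E \<in> cochains e"
  shows "cup d e D E = ins m [(d, D), (e, E)]"
  unfolding cup_def by (rule brace_eq_ins) (use assms in \<open>auto simp: cochainsD m_mlin\<close>)

lemma cochains_ins2:
  assumes "D \<in> cochains d" "E \<in> cochains e" "F \<in> cochains f"
  shows "ins D [(e, E), (f, F)] \<in> cochains (d + e + f)"
proof -
  have "ins D [(e, E), (f, F)] \<in> cochains (d + tdeg [(e, E), (f, F)])"
    by (rule cochains_ins) (use assms in auto)
  then show ?thesis by (simp add: add.assoc)
qed

lemma cochains_ins3:
  assumes "D \<in> cochains d" "E \<in> cochains e" "F \<in> cochains f" "G \<in> cochains g"
  shows "ins D [(e, E), (f, F), (g, G)] \<in> cochains (d + e + f + g)"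
proof -
  have "ins D [(e, E), (f, F), (g, G)] \<in> cochains (d + tdeg [(e, E), (f, F), (g, G)])"
    by (rule cochains_ins) (use assms in auto)
  then show ?thesis by (simp add: add.assoc)
qed

lemma cochains_cup: "D \<in> cochains d \<Longrightarrow> E \<in> cochains e \<Longrightarrow> cup d e D E \<in> cochains (d + e + 1)"
  using cochains_ins2[OF m_cochain, of D d E e] by (simp add: cup_eq ac_simps)

lemma brace_m_m:
  assumes "D \<in> cochains d"
  shows "ins (ins D [(1, m)]) [(1, m)] = 0"
  using brace_1_1[OF assms m_cochain, of 1 m]
  by (simp add: m_brace_m ins_slots cochainsD(2)[OF assms])

lemma m_brace_brace:
  assumes D: "D \<in> cochains d"
  shows "ins m [(d + 1, ins m [(d, D)])] = - ins m [(1, m), (d, D)] - sg d (ins m [(d, D), (1, m)])"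
  using brace_1_1[OF m_cochain D, of 1 m]
  by (simp add: m_brace_m algebra_simps eq_neg_iff_add_eq_0)

text \<open>
  The usual argument \<open>2 [m,[m,D]] = [[m,m],D]\<close> is not available in characteristic \<open>2\<close>; instead
  \<open>m{m}{D} = 0\<close> and \<open>D{m}{m} = D{m{m}} = 0\<close> are used separately.
\<close>

theorem hochschild_diff_squared:
  assumes D: "D \<in> cochains d"
  shows "hochschild_diff (d + 1) (hochschild_diff d D) = 0"
proof -
  have "hochschild_diff (d + 1) (hochschild_diff d D) =
    ins m [(d + 1, ins m [(d, D)] - sg d (ins D [(1, m)]))] -
    sg (d + 1) (ins (ins m [(d, D)] - sg d (ins D [(1, m)])) [(1, m)])"
    using D by (subst hochschild_diff_eq[OF cochains_hochschild_diff[OF D]]) (simp add: hochschild_diff_eq)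
  also have "\<dots> = 0"
    by (cases "even d")
      (simp_all add: sg_def ins_slots m_madd
        ins_minus ins_plus ins_minus_fun brace_m_m[OF D] m_brace_brace[OF D]
        brace_1_1[OF m_cochain m_cochain, of d D])
  finally show ?thesis .
qed

text \<open>
  As \<open>\<delta>\<close> is the bracket with \<open>m\<close>, this is the Jacobi identity.
\<close>

theorem hochschild_diff_bracket:
  assumes D: "D \<in> cochains d" and E: "E \<in> cochains e"
  shows "hochschild_diff (d + e) (bracket d e D E) =
    bracket (d + 1) e (hochschild_diff d D) E + sg d (bracket d (e + 1) D (hochschild_diff e E))"
  using bracket_jacobi_cochains[OF m_cochain D E]
  by (simp add: hochschild_diff_eq_bracket[OF D] hochschild_diff_eq_bracket[OF E]
      hochschild_diff_eq_bracket[OF cochains_bracket[OF D E]] add.commute)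

text \<open>
  Expand \<open>m{m}{D,E} = 0\<close> and \<open>m{D,E}{m}\<close>. The terms in which the inner \<open>m\<close> goes next to \<open>D\<close>
  and \<open>E\<close> cancel.
\<close>

theorem hochschild_diff_cup:
  assumes D: "D \<in> cochains d" and E: "E \<in> cochains e"
  shows "hochschild_diff (d + e + 1) (cup d e D E) =
    - cup (d + 1) e (hochschild_diff d D) E - sg d (cup d (e + 1) D (hochschild_diff e E))"
proof -
  have 1: "ins m [(d + e + 1, ins m [(d, D), (e, E)])] = - (
    ins m [(d + 1, ins m [(d, D)]), (e, E)] + sg d (ins m [(d, D), (e + 1, ins m [(e, E)])]) +
    ins m [(1, m), (d, D), (e, E)] + sg d (ins m [(d, D), (1, m), (e, E)]) +
    sg (d + e) (ins m [(d, D), (e, E), (1, m)]))"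
    unfolding eq_neg_iff_add_eq_0
    using brace_1_2[OF m_cochain D E, of 1 m]
    by (simp add: m_brace_m ac_simps)
  note 2 = brace_2_1[OF m_cochain D E m_cochain]
  have lhs: "hochschild_diff (d + e + 1) (cup d e D E) =
    ins m [(d + e + 1, ins m [(d, D), (e, E)])] - sg (d + e + 1) (ins (ins m [(d, D), (e, E)]) [(1, m)])"
    using cup_eq[OF D E] hochschild_diff_eq[OF cochains_cup[OF D E]] by simp
  show ?thesis
    unfolding lhs 1 2 cup_eq[OF cochains_hochschild_diff[OF D] E] cup_eq[OF D cochains_hochschild_diff[OF E]]
    unfolding hochschild_diff_eq[OF D] hochschild_diff_eq[OF E]
    by (cases "even d"; cases "even e")
      (simp_all add: sg_def m_madd ins_slots algebra_simps)
qed

section \<open>Homotopies for the Gerstenhaber identities\<close>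

text \<open>
  For a cocycle, inserting \<open>m\<close> into \<open>D\<close> can be traded for inserting \<open>D\<close> into \<open>m\<close>. In the
  following homotopies this eliminates all the terms in which \<open>m\<close> is inserted into one of the
  given cocycles.
\<close>

lemma brace_m_of_cocycle:
  assumes "D \<in> cochains d" "hochschild_diff d D = 0"
  shows "ins D [(1, m)] = sg d (ins m [(d, D)])"
  using assms(2) unfolding hochschild_diff_eq[OF assms(1)]
  by (cases "even d") (simp_all add: sg_def add_eq_0_iff2)

text \<open>
  The failure of the pre-Lie product to be a chain map is the graded commutator of the cup
  product: in \<open>m{D}{E} = m{D{E}} + m{D,E} \<plusminus> m{E,D}\<close> the left-hand side is \<open>D{E}{m}\<close> up to sign,
  when \<open>D\<close> and \<open>E\<close> are cocycles.
\<close>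

theorem cup_commute_homotopy:
  assumes D: "D \<in> cochains d" and E: "E \<in> cochains e"
    and dD: "hochschild_diff d D = 0" and dE: "hochschild_diff e E = 0"
  shows "cup d e D E + sg (d * e) (cup e d E D) = - hochschild_diff (d + e) (ins D [(e, E)])"
proof -
  note 1 = brace_1_1[OF D E, of 1 m]
  have 2: "ins D [(1 + e, ins m [(e, E)])] =
      sg d (ins (ins m [(d, D)]) [(e, E)]) - ins D [(1, m), (e, E)] - sg e (ins D [(e, E), (1, m)])"
    using 1 by (simp add: brace_m_of_cocycle[OF D dD] ins_sg_fun algebra_simps)
  show ?thesis
    unfolding cup_eq[OF D E] cup_eq[OF E D] hochschild_diff_eq[OF cochains_ins1[OF D E]]
      brace_1_1[OF D m_cochain] brace_m_of_cocycle[OF E dE]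
    by (cases "even d"; cases "even e")
      (simp_all add: sg_def ins_slots cochainsD(2)[OF D] 2 brace_1_1[OF m_cochain E] algebra_simps)
qed

text \<open>
  The associativity defect appears in \<open>m{m}{D,E,F} = 0\<close>; all other terms of this identity
  belong to the differential of \<open>m{D,E,F}\<close>.
\<close>

theorem cup_assoc_homotopy:
  assumes D: "D \<in> cochains d" and E: "E \<in> cochains e" and F: "F \<in> cochains f"
    and dD: "hochschild_diff d D = 0" and dE: "hochschild_diff e E = 0" and dF: "hochschild_diff f F = 0"
  shows "cup (d + e + 1) f (cup d e D E) F + sg d (cup d (e + f + 1) D (cup e f E F)) =
    - hochschild_diff (d + e + f + 1) (ins m [(d, D), (e, E), (f, F)])"
proof -
  have h: "ins m [(d, D), (e, E), (f, F)] \<in> cochains (d + e + f + 1)"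
    using cochains_ins3[OF m_cochain D E F] by (simp add: ac_simps)
  note 1 = brace_1_3[OF m_cochain D E F, of 1 m, unfolded m_brace_m ins_zero_fun]
  note 2 = brace_3_1[OF m_cochain D E F m_cochain, unfolded brace_m_of_cocycle[OF D dD]
    brace_m_of_cocycle[OF E dE] brace_m_of_cocycle[OF F dF]]
  have slot3: "ins m [(d, D), (e, E), (k, sg n G)] = sg n (ins m [(d, D), (e, E), (k, G)])" for k n G
    using ins_slot_sg[OF m_madd, of "[(d, D), (e, E)]" k n G "[]"] by simp
  have slot2: "ins m [(d, D), (k, sg n G), (f, F)] = sg n (ins m [(d, D), (k, G), (f, F)])" for k n G
    using ins_slot_sg[OF m_madd, of "[(d, D)]" k n G "[(f, F)]"] by simp
  have slot1: "ins m [(k, sg n G), (e, E), (f, F)] = sg n (ins m [(k, G), (e, E), (f, F)])" for k n G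
    using ins_slot_sg[OF m_madd, of "[]" k n G "[(e, E), (f, F)]"] by simp
  have 3: "ins m [(1 + d + e + f, ins m [(d, D), (e, E), (f, F)])] = - (
    ins m [(1 + d + e, ins m [(d, D), (e, E)]), (f, F)] +
    sg d (ins m [(d, D), (1 + e + f, ins m [(e, E), (f, F)])]) +
    sg (d + e + f) (ins (ins m [(d, D), (e, E), (f, F)]) [(1, m)]))"
    unfolding eq_neg_iff_add_eq_0 2 slot1 slot2 slot3
    using 1 by (cases "even d"; cases "even e"; cases "even f") (simp_all add: sg_def algebra_simps)
  show ?thesis
    unfolding cup_eq[OF cochains_cup[OF D E] F] cup_eq[OF D cochains_cup[OF E F]] hochschild_diff_eq[OF h]
    unfolding cup_eq[OF D E] cup_eq[OF E F]
    using 3 by (cases "even d"; cases "even e"; cases "even f") (simp_all add: sg_def algebra_simps)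
qed

text \<open>
  Besides the two derivation terms, the expansion of \<open>(E \<smile> F){D} = m{E,F}{D}\<close> has the terms
  \<open>m{E,F,D}\<close>, \<open>m{E,D,F}\<close> and \<open>m{D,E,F}\<close>. The same three terms occur in \<open>m{D}{E,F}\<close>, which the
  differential of \<open>D{E,F}\<close> relates to \<open>D{E \<smile> F}\<close>.
\<close>

theorem bracket_cup_homotopy:
  assumes D: "D \<in> cochains d" and E: "E \<in> cochains e" and F: "F \<in> cochains f"
    and dD: "hochschild_diff d D = 0" and dE: "hochschild_diff e E = 0" and dF: "hochschild_diff f F = 0"
  shows "bracket d (e + f + 1) D (cup e f E F) =
    sg d (cup (d + e) f (bracket d e D E) F) + sg (d + d * e) (cup e (d + f) E (bracket d f D F)) +
    sg d (hochschild_diff (d + e + f) (ins D [(e, E), (f, F)]))"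
proof -
  note 1 = brace_1_2[OF D E F, of 1 m, unfolded brace_m_of_cocycle[OF D dD] ins_sg_fun]
  note 2 = brace_2_1[OF D E F m_cochain, unfolded brace_m_of_cocycle[OF E dE] brace_m_of_cocycle[OF F dF]]
  note 3 = brace_1_2[OF m_cochain E F, of d D] and 4 = brace_2_1[OF m_cochain E F D]
  have slot2: "ins D [(e, E), (k, sg n G)] = sg n (ins D [(e, E), (k, G)])" for k n G
    using ins_slot_sg[OF cochainsD(2)[OF D], of "[(e, E)]" k n G "[]"] by simp
  have slot1: "ins D [(k, sg n G), (f, F)] = sg n (ins D [(k, G), (f, F)])" for k n G
    using ins_slot_sg[OF cochainsD(2)[OF D], of "[]" k n G "[(f, F)]"] by simp
  have 5: "ins D [(1 + e + f, ins m [(e, E), (f, F)])] =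
     sg d (ins (ins m [(d, D)]) [(e, E), (f, F)]) - sg (e + f) (ins (ins D [(e, E), (f, F)]) [(1, m)])"
    unfolding 2 slot1 slot2
    using 1 by (cases "even e"; cases "even f") (simp_all add: sg_def algebra_simps)
  show ?thesis
    unfolding bracket_eq[OF D cochains_cup[OF E F]] cup_eq[OF cochains_bracket[OF D E] F]
      cup_eq[OF E cochains_bracket[OF D F]] hochschild_diff_eq[OF cochains_ins2[OF D E F]]
    unfolding bracket_eq[OF D E] bracket_eq[OF D F] cup_eq[OF E F] 4
    using 5 by (cases "even d"; cases "even e"; cases "even f")
      (simp_all add: sg_def ins_slots m_madd 3 algebra_simps)
qed

end

context unital_A_infinity_algebra
begin

section \<open>Normalized cochains\<close>

lemma tw_one: "tw n \<one> = sg n \<one>"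
  using tw_homogeneous[OF one_degree, of n] by (simp add: sg_def)

text \<open>
  The operator \<open>tw\<close> changes the unit by a sign only, so a function that vanishes on lists with a
  unit also vanishes after the twists that braces introduce.
\<close>

lemma madd_tws_one:
  assumes "madd F" "\<one> \<in> set x" "\<And>l. \<one> \<in> set l \<Longrightarrow> length l = length (P @ x @ Q) \<Longrightarrow> F l = 0"
  shows "F (P @ tws n x @ Q) = 0"
proof -
  obtain a b where x: "x = a @ \<one> # b" using assms(2) by (meson split_list)
  have "F (P @ tws n x @ Q) = sg n (F ((P @ tws n a) @ \<one> # tws n b @ Q))"
    using madd_sg[OF assms(1), of "P @ tws n a"] by (simp add: x tw_one)
  also have "F ((P @ tws n a) @ \<one> # tws n b @ Q) = 0"
    by (rule assms(3)) (simp_all add: x)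
  finally show ?thesis by simp
qed

text \<open>
  The length condition is what makes this apply to \<open>m\<close>, which vanishes on units in all arities
  but two: with at least two cochains inserted, a unit that is passed to \<open>m\<close> is a third argument.
\<close>

lemma ins_eq_0_if_one:
  assumes "madd D" "\<And>l. \<one> \<in> set l \<Longrightarrow> length l > length Es \<Longrightarrow> D l = 0"
    and "\<And>p. p \<in> set Es \<Longrightarrow> madd (snd p)" "\<And>p l. p \<in> set Es \<Longrightarrow> \<one> \<in> set l \<Longrightarrow> snd p l = 0"
    and "\<one> \<in> set xs"
  shows "ins D Es xs = 0"
  using assms
proof (induction Es arbitrary: D xs)
  case Nil
  then show ?case by (cases xs) auto
next
  case (Cons p Es)
  let ?X = "\<lambda>x. tws (fst p + tdeg Es) x" and ?v = "\<lambda>y. snd p (tws (tdeg Es) y)"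
  note D = Cons.prems(1)
  show ?case
    unfolding ins.simps(2)
  proof (rule cutsum_zero, rule cutsum_zero)
    fix x r y s assume "x @ r = xs" "y @ s = r"
    then consider "\<one> \<in> set x" | "\<one> \<in> set y" | "\<one> \<in> set s" using Cons.prems(5) by auto
    then show "ins (\<lambda>zs. D (?X x @ ?v y # zs)) Es s = 0"
    proof cases
      case 1
      then obtain h x' where x: "x = h # x'" by (cases x) auto
      have "D ([] @ ?X x @ ?v y # zs) = 0" if "length zs \<ge> length Es" for zs
        by (rule madd_tws_one[OF D 1]) (use that Cons.prems(2) in \<open>auto simp: x\<close>)
      then show ?thesis by (intro ins_eq_0_if_long) simp
    next
      case 2
      have "snd p ([] @ tws (tdeg Es) y @ []) = 0"
        by (rule madd_tws_one[OF _ 2]) (use Cons.prems(3,4)[of p] in auto)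
      then show ?thesis by (simp add: madd_0[OF D])
    next
      case 3
      then show ?thesis
        by (intro Cons.IH madd_append2 D) (use Cons.prems(2-4) in auto)
    qed
  qed
qed

lemma normalizedD:
  assumes "D \<in> normalized_cochains p"
  shows "D \<in> cochains p" "\<one> \<in> set xs \<Longrightarrow> D xs = 0" "madd D"
  using assms by (auto simp: normalized_cochains_def cochainsD)

lemma normalized_0: "0 \<in> normalized_cochains p"
  and normalized_add: "D \<in> normalized_cochains p \<Longrightarrow> E \<in> normalized_cochains p \<Longrightarrow> D + E \<in> normalized_cochains p"
  and normalized_scale: "D \<in> normalized_cochains p \<Longrightarrow> (\<lambda>xs. c *s D xs) \<in> normalized_cochains p"
  and normalized_uminus: "D \<in> normalized_cochains p \<Longrightarrow> - D \<in> normalized_cochains p"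
  and normalized_diff: "D \<in> normalized_cochains p \<Longrightarrow> E \<in> normalized_cochains p \<Longrightarrow> D - E \<in> normalized_cochains p"
  by (auto simp: normalized_cochains_def cochains_0 cochains_add cochains_scale cochains_uminus cochains_diff)

lemma normalized_sg: "D \<in> normalized_cochains p \<Longrightarrow> sg n D \<in> normalized_cochains p"
  by (simp add: sg_def normalized_uminus)

lemma normalized_ins:
  assumes "D \<in> normalized_cochains d" "\<And>p. p \<in> set Es \<Longrightarrow> snd p \<in> normalized_cochains (fst p)"
  shows "ins D Es \<in> normalized_cochains (d + tdeg Es)"
  unfolding normalized_cochains_def
proof (intro CollectI conjI allI impI)
  show "ins D Es \<in> cochains (d + tdeg Es)"
    by (intro cochains_ins normalizedD(1)[OF assms(1)] normalizedD(1)[OF assms(2)])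
  show "ins D Es xs = 0" if "\<one> \<in> set xs" for xs
    by (rule ins_eq_0_if_one)
      (auto intro: normalizedD(2,3)[OF assms(1)] normalizedD(2,3)[OF assms(2)] that)
qed

lemma normalized_ins_m:
  assumes "length Es \<ge> 2" "\<And>p. p \<in> set Es \<Longrightarrow> snd p \<in> normalized_cochains (fst p)"
  shows "ins m Es \<in> normalized_cochains (1 + tdeg Es)"
  unfolding normalized_cochains_def
proof (intro CollectI conjI allI impI)
  show "ins m Es \<in> cochains (1 + tdeg Es)"
    by (intro cochains_ins m_cochain normalizedD(1)[OF assms(2)])
  show "ins m Es xs = 0" if "\<one> \<in> set xs" for xs
    by (rule ins_eq_0_if_one)
      (use assms(1) in \<open>auto intro: m_madd m_one_other normalizedD(2,3)[OF assms(2)] that\<close>)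
qed

lemma normalized_ins1:
  "D \<in> normalized_cochains d \<Longrightarrow> E \<in> normalized_cochains e \<Longrightarrow> ins D [(e, E)] \<in> normalized_cochains (d + e)"
  using normalized_ins[of D d "[(e, E)]"] by simp

lemma normalized_ins2:
  assumes "D \<in> normalized_cochains d" "E \<in> normalized_cochains e" "F \<in> normalized_cochains f"
  shows "ins D [(e, E), (f, F)] \<in> normalized_cochains (d + e + f)"
proof -
  have "ins D [(e, E), (f, F)] \<in> normalized_cochains (d + tdeg [(e, E), (f, F)])"
    by (rule normalized_ins) (use assms in auto)
  then show ?thesis by (simp add: add.assoc)
qed

lemma normalized_m3:
  assumes "D \<in> normalized_cochains d" "E \<in> normalized_cochains e" "F \<in> normalized_cochains f"
  shows "ins m [(d, D), (e, E), (f, F)] \<in> normalized_cochains (d + e + f + 1)"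
proof -
  have "ins m [(d, D), (e, E), (f, F)] \<in> normalized_cochains (1 + tdeg [(d, D), (e, E), (f, F)])"
    by (rule normalized_ins_m) (use assms in auto)
  then show ?thesis by (simp add: ac_simps)
qed

lemma normalized_cup:
  assumes "D \<in> normalized_cochains d" "E \<in> normalized_cochains e"
  shows "cup d e D E \<in> normalized_cochains (d + e + 1)"
proof -
  have "ins m [(d, D), (e, E)] \<in> normalized_cochains (1 + tdeg [(d, D), (e, E)])"
    by (rule normalized_ins_m) (use assms in auto)
  then show ?thesis
    by (simp add: cup_eq[OF normalizedD(1)[OF assms(1)] normalizedD(1)[OF assms(2)]] ac_simps)
qed

lemma normalized_bracket:
  assumes "D \<in> normalized_cochains d" "E \<in> normalized_cochains e"
  shows "bracket d e D E \<in> normalized_cochains (d + e)"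
  using normalized_ins1[OF assms] normalized_ins1[OF assms(2,1)]
  by (simp add: bracket_eq[OF normalizedD(1)[OF assms(1)] normalizedD(1)[OF assms(2)]]
      normalized_diff normalized_sg add.commute)

lemma m_one_left': "m [\<one>, a] = a"
proof (induction a rule: homogeneous_induct)
  case (add a b)
  then show ?case using madd_add[OF m_madd, of "[\<one>]" a b "[]"] by simp
qed (rule m_one_left)

lemma m_one_right': "m [a, \<one>] = - tw 1 a"
proof (induction a rule: homogeneous_induct)
  case (homogeneous n a)
  then show ?case
    using m_one_right[OF homogeneous]
    by (auto simp: sg_eq_powi tw_homogeneous sg_def dest: arg_cong[where f = uminus] split: if_splits)
next
  case (add a b)
  then show ?case using madd_add[OF m_madd, of "[]" a b "[\<one>]"] by simp
qed

text \<open>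
  Among the terms of \<open>m{D}\<close> on a list with a unit, only \<open>m\<^sub>2(D(p), \<one>)\<close> and \<open>m\<^sub>2(\<one>, D(q))\<close>
  survive.
\<close>

lemma m_brace_one:
  assumes "D \<in> normalized_cochains d"
  shows "ins m [(d, D)] (p @ \<one> # q) =
    (if q = [] then - tw 1 (D p) else 0) + (if p = [] then sg d (D q) else 0)"
proof -
  note D = normalizedD[OF assms]
  have 1: "cutsum (\<lambda>a r. cutsum (\<lambda>b c. m (tws d a @ D b # c @ \<one> # q)) r) p =
      (if q = [] then - tw 1 (D p) else 0)"
  proof (cases "q = []")
    case True
    have "cutsum (\<lambda>a r. cutsum (\<lambda>b c. m (tws d a @ D b # c @ \<one> # q)) r) p =
        cutsum (\<lambda>b c. m (D b # c @ [\<one>])) p"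
      by (subst cutsum_only_first) (use True in \<open>auto intro!: cutsum_zero m_one_other\<close>)
    also have "\<dots> = - tw 1 (D p)"
      by (subst cutsum_only_last) (auto intro!: m_one_other simp: m_one_right')
    finally show ?thesis using True by simp
  next
    case False
    then show ?thesis by (auto intro!: cutsum_zero m_one_other)
  qed
  have 2: "cutsum (\<lambda>a u. cutsum (\<lambda>b c. m (tws d a @ D (u @ \<one> # b) # c)) q) p = 0"
    using D(2) by (auto intro!: cutsum_zero simp: madd_0[OF m_madd])
  have 3: "ins (\<lambda>ws. m (tws d p @ tw d \<one> # ws)) [(d, D)] q = (if p = [] then sg d (D q) else 0)"
  proof -
    have "ins (\<lambda>ws. m (tws d p @ tw d \<one> # ws)) [(d, D)] q = sg d (ins (\<lambda>ws. m (tws d p @ \<one> # ws)) [(d, D)] q)"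
      by (simp add: tw_one madd_sg[OF m_madd] ins_sg)
    also have "ins (\<lambda>ws. m (tws d p @ \<one> # ws)) [(d, D)] q = (if p = [] then D q else 0)"
    proof (cases "p = []")
      case True
      have "ins (\<lambda>ws. m (tws d p @ \<one> # ws)) [(d, D)] q = cutsum (\<lambda>b c. m (\<one> # D b # c)) q"
        unfolding ins.simps
        by (subst cutsum_only_first) (use True in \<open>auto intro!: cutsum_zero m_one_other\<close>)
      also have "\<dots> = D q"
        by (subst cutsum_only_last) (auto intro!: m_one_other simp: m_one_left')
      finally show ?thesis using True by simp
    next
      case False
      then show ?thesis by (auto simp: ins.simps intro!: cutsum_zero m_one_other)
    qed
    finally show ?thesis by simp
  qed
  show ?thesis unfolding ins_single_append 1 2 3 by simp
qed

text \<open>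
  Only the two terms survive in which \<open>m\<^sub>2\<close> multiplies the unit with its right or with its left
  neighbour. They cancel, except at the ends of the list.
\<close>

lemma brace_m_one:
  assumes "D \<in> normalized_cochains d"
  shows "ins D [(1, m)] (p @ \<one> # q) =
    (if q = [] then 0 else D (tws 1 p @ q)) - (if p = [] then 0 else D (tws 1 p @ q))"
proof -
  note D = normalizedD[OF assms]
  have 1: "cutsum (\<lambda>a r. cutsum (\<lambda>b c. D (tws 1 a @ m b # c @ \<one> # q)) r) p = 0"
    by (auto intro!: cutsum_zero D(2))
  have 3: "ins (\<lambda>ws. D (tws 1 p @ tw 1 \<one> # ws)) [(1, m)] q = 0"
    by (simp add: tw_one madd_minus[OF D(3)] ins_uminus) (auto intro!: cutsum_zero D(2) simp: ins.simps)
  have *: "cutsum (\<lambda>b c. D (tws 1 a @ m (t @ \<one> # b) # c)) q =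
    (if t = [] then if q = [] then 0 else D (tws 1 a @ q)
     else if length t = 1 then - D (tws 1 (a @ t) @ q) else 0)" for a t
  proof -
    have z: "D (tws 1 a @ m (t @ \<one> # b) # c) = 0" if "length (t @ b) \<noteq> 1" for b c
      using that by (simp add: m_one_other madd_0[OF D(3)])
    consider "t = []" | x where "t = [x]" | "length t \<ge> 2"
      by (metis One_nat_def Suc_1 Suc_leI length_0_conv length_Suc_conv length_greater_0_conv less_antisym not_less)
    then show ?thesis
    proof cases
      case 1
      show ?thesis
      proof (cases q)
        case Nil
        then show ?thesis using z[of "[]" "[]"] 1 by simp
      next
        case (Cons h q')
        have "cutsum (\<lambda>b c. D (tws 1 a @ m (t @ \<one> # b) # c)) q =
            cutsum (\<lambda>b c. D (tws 1 a @ m (\<one> # h # b) # c)) q'"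
          using z[of "[]" q] Cons 1 by simp
        also have "\<dots> = D (tws 1 a @ h # q')"
          by (subst cutsum_only_first) (use z[of "h # _"] 1 in \<open>auto simp: m_one_left'\<close>)
        finally show ?thesis using 1 Cons by simp
      qed
    next
      case (2 x)
      have "cutsum (\<lambda>b c. D (tws 1 a @ m (t @ \<one> # b) # c)) q = D (tws 1 a @ m [x, \<one>] # q)"
        by (subst cutsum_only_first) (use z 2 in auto)
      then show ?thesis using 2 by (simp add: m_one_right' madd_minus[OF D(3)])
    next
      case 3
      then have "cutsum (\<lambda>b c. D (tws 1 a @ m (t @ \<one> # b) # c)) q = 0" by (intro cutsum_zero z) simp
      then show ?thesis using 3 by auto
    qed
  qed
  have 2: "cutsum (\<lambda>a u. cutsum (\<lambda>b c. D (tws 1 a @ m (u @ \<one> # b) # c)) q) p =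
    (if q = [] then 0 else D (tws 1 p @ q)) - (if p = [] then 0 else D (tws 1 p @ q))"
  proof (cases p rule: rev_cases)
    case Nil
    then show ?thesis unfolding * by simp
  next
    case (snoc p' x)
    show ?thesis
      unfolding * snoc
      by (simp add: cutsum_append_Cons, subst cutsum_only_last) auto
  qed
  show ?thesis unfolding ins_single_append 1 2 3 by simp
qed

text \<open>
  The products with the unit at the ends of the list that are left in \<open>m{D}\<close> and in \<open>D{m}\<close>
  cancel each other.
\<close>

lemma normalized_hochschild_diff:
  assumes "D \<in> normalized_cochains d"
  shows "hochschild_diff d D \<in> normalized_cochains (d + 1)"
  unfolding normalized_cochains_def
proof (intro CollectI conjI allI impI)
  note D = normalizedD[OF assms]
  show "hochschild_diff d D \<in> cochains (d + 1)" by (rule cochains_hochschild_diff[OF D(1)])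
  fix xs assume "\<one> \<in> set xs"
  then obtain p q where xs: "xs = p @ \<one> # q" by (meson split_list)
  have "tw 1 (D p) = sg d (D (tws 1 p))" for p
    using equivariantD[OF cochains_equivariant[OF D(1)], of 1] by simp
  then show "hochschild_diff d D xs = 0"
    by (auto simp: hochschild_diff_eq[OF D(1)] xs m_brace_one[OF assms] brace_m_one[OF assms] sg_def)
qed

section \<open>The Gerstenhaber algebra structure on cohomology\<close>

lemma hochschild_diff_add:
  "D \<in> cochains d \<Longrightarrow> E \<in> cochains d \<Longrightarrow> hochschild_diff d (D + E) = hochschild_diff d D + hochschild_diff d E"
  by (simp add: hochschild_diff_eq cochains_add ins_slots m_madd ins_plus sg_add)

lemma hochschild_diff_uminus:
  "D \<in> cochains d \<Longrightarrow> hochschild_diff d (- D) = - hochschild_diff d D"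
  by (simp add: hochschild_diff_eq cochains_uminus ins_slots m_madd ins_minus_fun)

lemma hochschild_diff_0: "hochschild_diff d 0 = 0"
  by (simp add: hochschild_diff_eq cochains_0 ins_slots m_madd)

lemma ins1_slot_scale: "mlin scale D \<Longrightarrow> ins D ((e, \<lambda>xs. c *s E xs) # S) = (\<lambda>xs. c *s ins D ((e, E) # S) xs)"
  using ins_slot_scale[of D "[]"] by simp

lemma ins2_slot_scale:
  "mlin scale D \<Longrightarrow> ins D (p # (e, \<lambda>xs. c *s E xs) # S) = (\<lambda>xs. c *s ins D (p # (e, E) # S) xs)"
  using ins_slot_scale[of D "[p]"] by simp

lemma hochschild_diff_scale:
  assumes "D \<in> cochains d"
  shows "hochschild_diff d (\<lambda>xs. c *s D xs) = (\<lambda>xs. c *s hochschild_diff d D xs)"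
  unfolding hochschild_diff_eq[OF assms] hochschild_diff_eq[OF cochains_scale[OF assms]]
  by (simp add: fun_eq_iff ins1_slot_scale m_mlin ins_scale scale_right_diff_distrib scale_sg)

lemma cocyclesD:
  assumes "D \<in> cocycles p"
  shows "D \<in> normalized_cochains p" "hochschild_diff p D = 0" "D \<in> cochains p"
  using assms by (auto simp: cocycles_def normalized_cochains_def)

lemma cocycles_0: "0 \<in> cocycles p"
  and cocycles_add: "D \<in> cocycles p \<Longrightarrow> E \<in> cocycles p \<Longrightarrow> D + E \<in> cocycles p"
  and cocycles_uminus: "D \<in> cocycles p \<Longrightarrow> - D \<in> cocycles p"
  and cocycles_scale: "D \<in> cocycles p \<Longrightarrow> (\<lambda>xs. c *s D xs) \<in> cocycles p"
  by (auto simp: cocycles_def normalized_0 normalized_add normalized_uminus normalized_scale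
      hochschild_diff_0 hochschild_diff_add hochschild_diff_uminus hochschild_diff_scale normalizedD(1) fun_eq_iff)

lemma coboundariesI: "X \<in> normalized_cochains p \<Longrightarrow> hochschild_diff p X \<in> coboundaries (p + 1)"
  by (simp add: coboundaries_def)

lemma coboundariesE:
  assumes "D \<in> coboundaries p"
  obtains X where "X \<in> normalized_cochains (p - 1)" "D = hochschild_diff (p - 1) X"
  using assms by (auto simp: coboundaries_def)

lemma coboundaries_0: "0 \<in> coboundaries p"
  using coboundariesI[OF normalized_0, of "p - 1"] by (simp add: hochschild_diff_0)

lemma coboundaries_add: "D \<in> coboundaries p \<Longrightarrow> E \<in> coboundaries p \<Longrightarrow> D + E \<in> coboundaries p"
  by (elim coboundariesE)
    (use coboundariesI[OF normalized_add, of _ "p - 1"] in \<open>simp add: hochschild_diff_add normalizedD(1)\<close>)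

lemma coboundaries_uminus: "D \<in> coboundaries p \<Longrightarrow> - D \<in> coboundaries p"
  by (elim coboundariesE)
    (use coboundariesI[OF normalized_uminus, of _ "p - 1"] in \<open>simp add: hochschild_diff_uminus normalizedD(1)\<close>)

lemma coboundaries_diff: "D \<in> coboundaries p \<Longrightarrow> E \<in> coboundaries p \<Longrightarrow> D - E \<in> coboundaries p"
  using coboundaries_add[of D p "- E"] coboundaries_uminus[of E p] by simp

lemma coboundaries_sg: "D \<in> coboundaries p \<Longrightarrow> sg n D \<in> coboundaries p"
  by (simp add: sg_def coboundaries_uminus)

lemma coboundaries_scale: "D \<in> coboundaries p \<Longrightarrow> (\<lambda>xs. c *s D xs) \<in> coboundaries p"
  by (elim coboundariesE)
    (use coboundariesI[OF normalized_scale, of _ "p - 1" c] in \<open>simp add: hochschild_diff_scale normalizedD(1)\<close>)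

lemma coboundaries_cocycles: "D \<in> coboundaries p \<Longrightarrow> D \<in> cocycles p"
proof (elim coboundariesE)
  fix X assume X: "X \<in> normalized_cochains (p - 1)" and D: "D = hochschild_diff (p - 1) X"
  show "D \<in> cocycles p"
    using normalized_hochschild_diff[OF X] hochschild_diff_squared[OF normalizedD(1)[OF X]]
    by (simp add: D cocycles_def)
qed

lemma coset_eqI: "D - E \<in> coboundaries p \<Longrightarrow> coset p D = coset p E"
proof -
  assume *: "D - E \<in> coboundaries p"
  have "coset p E \<subseteq> coset p D" if "D - E \<in> coboundaries p" for D E
  proof
    fix F assume "F \<in> coset p E"
    then obtain G where G: "G \<in> coboundaries p" "F = E + G" by (auto simp: coset_def)
    then have "F = D + (G - (D - E))" by simp
    moreover have "G - (D - E) \<in> coboundaries p" using G(1) that by (rule coboundaries_diff)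
    ultimately show "F \<in> coset p D" unfolding coset_def by blast
  qed
  from this[OF *] this[of E D] coboundaries_uminus[OF *] show ?thesis by auto
qed

lemma HH_E:
  assumes "X \<in> HH p"
  obtains D where "D \<in> cocycles p" "X = coset p D"
  using assms by (auto simp: HH_def)

lemma HH_I: "D \<in> cocycles p \<Longrightarrow> coset p D \<in> HH p"
  by (simp add: HH_def)

lemma in_coset: "D \<in> coset p D"
  using coboundaries_0[of p] by (auto simp: coset_def image_iff)

text \<open>
  An operation on cosets that is a union over representatives gives a single coset as soon as
  its class does not depend on them.
\<close>

lemma UN_coset:
  assumes "\<And>X. X \<in> coboundaries p \<Longrightarrow> f (D + X) - f D \<in> coboundaries q"
  shows "(\<Union>D'\<in>coset p D. coset q (f D')) = coset q (f D)"
proof -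
  have "coset q (f D') = coset q (f D)" if "D' \<in> coset p D" for D'
  proof -
    obtain X where "X \<in> coboundaries p" "D' = D + X" using \<open>D' \<in> coset p D\<close> by (auto simp: coset_def)
    then show ?thesis by (simp add: assms coset_eqI)
  qed
  then show ?thesis using in_coset[of D p] by blast
qed

lemma UN_UN_coset:
  assumes "\<And>X Y. X \<in> coboundaries p \<Longrightarrow> Y \<in> coboundaries q \<Longrightarrow> f (D + X) (E + Y) - f D E \<in> coboundaries r"
  shows "(\<Union>D'\<in>coset p D. \<Union>E'\<in>coset q E. coset r (f D' E')) = coset r (f D E)"
proof -
  have "coset r (f D' E') = coset r (f D E)" if D': "D' \<in> coset p D" and E': "E' \<in> coset q E" for D' E'
  proof -
    obtain X Y where "X \<in> coboundaries p" "D' = D + X" "Y \<in> coboundaries q" "E' = E + Y"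
      using D' E' by (auto simp: coset_def)
    then show ?thesis by (simp add: assms coset_eqI)
  qed
  then show ?thesis using in_coset[of D p] in_coset[of E q] by blast
qed

lemma HH_add_coset: "HH_add p (coset p D) (coset p E) = coset p (D + E)"
  unfolding HH_add_def by (rule UN_UN_coset) (simp add: coboundaries_add)

lemma HH_smult_coset: "HH_smult p c (coset p D) = coset p (\<lambda>xs. c *s D xs)"
  unfolding HH_smult_def
proof (rule UN_coset)
  fix X assume "X \<in> coboundaries p"
  moreover have "(\<lambda>xs. c *s (D + X) xs) - (\<lambda>xs. c *s D xs) = (\<lambda>xs. c *s X xs)"
    by (simp add: fun_eq_iff scale_right_distrib)
  ultimately show "(\<lambda>xs. c *s (D + X) xs) - (\<lambda>xs. c *s D xs) \<in> coboundaries p"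
    by (simp add: coboundaries_scale)
qed

lemma HH_smult_sign: "HH_smult p ((-1) powi n) (coset p D) = coset p (sg n D)"
  "HH_smult p (- ((-1) powi n)) (coset p D) = coset p (- sg n D)"
proof -
  have "(\<lambda>xs. - ((-1) powi n) *s D xs) = - sg n D" "(\<lambda>xs. (-1) powi n *s D xs) = sg n D"
    by (simp_all add: fun_eq_iff sg_eq_powi)
  then show "HH_smult p ((-1) powi n) (coset p D) = coset p (sg n D)"
    "HH_smult p (- ((-1) powi n)) (coset p D) = coset p (- sg n D)"
    by (simp_all only: HH_smult_coset)
qed

lemma cup_add_left: "\<lbrakk>D \<in> cochains d; D' \<in> cochains d; E \<in> cochains e\<rbrakk> \<Longrightarrow> cup d e (D + D') E = cup d e D E + cup d e D' E"
  and cup_add_right: "\<lbrakk>D \<in> cochains d; E \<in> cochains e; E' \<in> cochains e\<rbrakk> \<Longrightarrow> cup d e D (E + E') = cup d e D E + cup d e D E'"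
  and bracket_add_left: "\<lbrakk>D \<in> cochains d; D' \<in> cochains d; E \<in> cochains e\<rbrakk> \<Longrightarrow>
    bracket d e (D + D') E = bracket d e D E + bracket d e D' E"
  and bracket_add_right: "\<lbrakk>D \<in> cochains d; E \<in> cochains e; E' \<in> cochains e\<rbrakk> \<Longrightarrow>
    bracket d e D (E + E') = bracket d e D E + bracket d e D E'"
  by (simp_all add: cup_eq bracket_eq cochains_add cochainsD(2) m_madd ins_slots ins_plus sg_add)

lemma cup_scale_left: "\<lbrakk>D \<in> cochains d; E \<in> cochains e\<rbrakk> \<Longrightarrow> cup d e (\<lambda>xs. c *s D xs) E = (\<lambda>xs. c *s cup d e D E xs)"
  and cup_scale_right: "\<lbrakk>D \<in> cochains d; E \<in> cochains e\<rbrakk> \<Longrightarrow> cup d e D (\<lambda>xs. c *s E xs) = (\<lambda>xs. c *s cup d e D E xs)"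
  and bracket_scale_left: "\<lbrakk>D \<in> cochains d; E \<in> cochains e\<rbrakk> \<Longrightarrow>
    bracket d e (\<lambda>xs. c *s D xs) E = (\<lambda>xs. c *s bracket d e D E xs)"
  and bracket_scale_right: "\<lbrakk>D \<in> cochains d; E \<in> cochains e\<rbrakk> \<Longrightarrow>
    bracket d e D (\<lambda>xs. c *s E xs) = (\<lambda>xs. c *s bracket d e D E xs)"
  by (simp_all add: cup_eq bracket_eq cochains_scale cochainsD(1) m_mlin ins1_slot_scale ins2_slot_scale
      fun_eq_iff ins_scale scale_sg scale_right_diff_distrib)

lemma cup_0: "E \<in> cochains e \<Longrightarrow> cup d e 0 E = 0" "D \<in> cochains d \<Longrightarrow> cup d e D 0 = 0"
  and bracket_0: "E \<in> cochains e \<Longrightarrow> bracket d e 0 E = 0" "D \<in> cochains d \<Longrightarrow> bracket d e D 0 = 0"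
  by (simp_all add: cup_eq bracket_eq cochains_0 ins_slots m_madd cochainsD(2))

lemma cocycles_cup: "D \<in> cocycles d \<Longrightarrow> E \<in> cocycles e \<Longrightarrow> cup d e D E \<in> cocycles (d + e + 1)"
  and cocycles_bracket: "D \<in> cocycles d \<Longrightarrow> E \<in> cocycles e \<Longrightarrow> bracket d e D E \<in> cocycles (d + e)"
  by (auto simp: cocycles_def normalized_cup normalized_bracket hochschild_diff_cup hochschild_diff_bracket
      normalizedD(1) cup_0 bracket_0)

lemma cup_coboundary_left:
  assumes "X \<in> coboundaries d" "E \<in> cocycles e"
  shows "cup d e X E \<in> coboundaries (d + e + 1)"
proof -
  obtain Y where Y: "Y \<in> normalized_cochains (d - 1)" "X = hochschild_diff (d - 1) Y"
    using assms(1) by (rule coboundariesE)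
  note E = cocyclesD[OF assms(2)]
  have "cup d e X E = - hochschild_diff (d + e) (cup (d - 1) e Y E)"
    using hochschild_diff_cup[OF normalizedD(1)[OF Y(1)] E(3)]
    by (simp add: Y(2) E(2) cup_0 normalizedD(1)[OF Y(1)])
  moreover have "cup (d - 1) e Y E \<in> normalized_cochains (d + e)"
    using normalized_cup[OF Y(1) E(1)] by simp
  ultimately show ?thesis
    using coboundaries_uminus[OF coboundariesI, of "cup (d - 1) e Y E" "d + e"] by simp
qed

lemma cup_coboundary_right:
  assumes "D \<in> cocycles d" "X \<in> coboundaries e"
  shows "cup d e D X \<in> coboundaries (d + e + 1)"
proof -
  obtain Y where Y: "Y \<in> normalized_cochains (e - 1)" "X = hochschild_diff (e - 1) Y"
    using assms(2) by (rule coboundariesE)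
  note D = cocyclesD[OF assms(1)]
  have "hochschild_diff (d + e) (cup d (e - 1) D Y) = - sg d (cup d e D X)"
    using hochschild_diff_cup[OF D(3) normalizedD(1)[OF Y(1)]]
    by (simp add: Y(2) D(2) cup_0 normalizedD(1)[OF Y(1)])
  then have "cup d e D X = - sg d (hochschild_diff (d + e) (cup d (e - 1) D Y))"
    by (simp add: sg_def)
  moreover have "cup d (e - 1) D Y \<in> normalized_cochains (d + e)"
    using normalized_cup[OF D(1) Y(1)] by simp
  ultimately show ?thesis
    using coboundaries_uminus[OF coboundaries_sg[OF coboundariesI], of "cup d (e - 1) D Y" "d + e"] by simp
qed

lemma bracket_antisym_cochains:
  "D \<in> cochains d \<Longrightarrow> E \<in> cochains e \<Longrightarrow> bracket d e D E = - sg (d * e) (bracket e d E D)"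
  by (simp add: bracket_eq sg_def mult.commute)

lemma bracket_coboundary_left:
  assumes "X \<in> coboundaries d" "E \<in> cocycles e"
  shows "bracket d e X E \<in> coboundaries (d + e)"
proof -
  obtain Y where Y: "Y \<in> normalized_cochains (d - 1)" "X = hochschild_diff (d - 1) Y"
    using assms(1) by (rule coboundariesE)
  note E = cocyclesD[OF assms(2)]
  have "bracket d e X E = hochschild_diff (d - 1 + e) (bracket (d - 1) e Y E)"
    using hochschild_diff_bracket[OF normalizedD(1)[OF Y(1)] E(3)]
    by (simp add: Y(2) E(2) bracket_0 normalizedD(1)[OF Y(1)])
  then show ?thesis
    using coboundariesI[OF normalized_bracket[OF Y(1) E(1)]] by (simp add: algebra_simps)
qed

lemma bracket_coboundary_right:
  assumes "D \<in> cocycles d" "X \<in> coboundaries e"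
  shows "bracket d e D X \<in> coboundaries (d + e)"
  using bracket_antisym_cochains[OF cocyclesD(3)[OF assms(1)] cocyclesD(3)[OF coboundaries_cocycles[OF assms(2)]]]
    bracket_coboundary_left[OF assms(2,1)]
  by (simp add: coboundaries_uminus coboundaries_sg add.commute)

lemma HH_cup_coset:
  assumes D: "D \<in> cocycles d" and E: "E \<in> cocycles e"
  shows "HH_cup d e (coset d D) (coset e E) = coset (d + e + 1) (cup d e D E)"
  unfolding HH_cup_def
proof (rule UN_UN_coset)
  fix X Y assume X: "X \<in> coboundaries d" and Y: "Y \<in> coboundaries e"
  note XY = coboundaries_cocycles[OF X] coboundaries_cocycles[OF Y]
  have "cup d e (D + X) (E + Y) - cup d e D E = cup d e X (E + Y) + cup d e D Y"
    by (simp add: cup_add_left cup_add_right cocyclesD(3) D E XY cochains_add)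
  also have "\<dots> \<in> coboundaries (d + e + 1)"
    by (intro coboundaries_add cup_coboundary_left cup_coboundary_right cocycles_add D E X Y XY)
  finally show "cup d e (D + X) (E + Y) - cup d e D E \<in> coboundaries (d + e + 1)" .
qed

lemma HH_bracket_coset:
  assumes D: "D \<in> cocycles d" and E: "E \<in> cocycles e"
  shows "HH_bracket d e (coset d D) (coset e E) = coset (d + e) (bracket d e D E)"
  unfolding HH_bracket_def
proof (rule UN_UN_coset)
  fix X Y assume X: "X \<in> coboundaries d" and Y: "Y \<in> coboundaries e"
  note XY = coboundaries_cocycles[OF X] coboundaries_cocycles[OF Y]
  have "bracket d e (D + X) (E + Y) - bracket d e D E = bracket d e X (E + Y) + bracket d e D Y"
    by (simp add: bracket_add_left bracket_add_right cocyclesD(3) D E XY cochains_add)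
  also have "\<dots> \<in> coboundaries (d + e)"
    by (intro coboundaries_add bracket_coboundary_left bracket_coboundary_right cocycles_add D E X Y XY)
  finally show "bracket d e (D + X) (E + Y) - bracket d e D E \<in> coboundaries (d + e)" .
qed

lemma cup_commute_coset:
  assumes D: "D \<in> cocycles d" and E: "E \<in> cocycles e"
  shows "coset (d + e + 1) (cup d e D E) = coset (d + e + 1) (sg (d * e + 1) (cup e d E D))"
proof (rule coset_eqI)
  note D' = cocyclesD[OF D] and E' = cocyclesD[OF E]
  have "cup d e D E - sg (d * e + 1) (cup e d E D) = - hochschild_diff (d + e) (ins D [(e, E)])"
    using cup_commute_homotopy[OF D'(3) E'(3) D'(2) E'(2)]
    by (cases "even d"; cases "even e") (simp_all add: sg_def)
  then show "cup d e D E - sg (d * e + 1) (cup e d E D) \<in> coboundaries (d + e + 1)"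
    using coboundaries_uminus[OF coboundariesI[OF normalized_ins1[OF D'(1) E'(1)]]] by simp
qed

lemma cup_assoc_coset:
  assumes D: "D \<in> cocycles d" and E: "E \<in> cocycles e" and F: "F \<in> cocycles f"
  shows "coset (d + e + f + 2) (cup (d + e + 1) f (cup d e D E) F) =
    coset (d + e + f + 2) (sg (d + 1) (cup d (e + f + 1) D (cup e f E F)))"
proof (rule coset_eqI)
  note D' = cocyclesD[OF D] and E' = cocyclesD[OF E] and F' = cocyclesD[OF F]
  have "cup (d + e + 1) f (cup d e D E) F - sg (d + 1) (cup d (e + f + 1) D (cup e f E F)) =
    - hochschild_diff (d + e + f + 1) (ins m [(d, D), (e, E), (f, F)])"
    using cup_assoc_homotopy[OF D'(3) E'(3) F'(3) D'(2) E'(2) F'(2)]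
    by (cases "even d") (simp_all add: sg_def)
  then show "cup (d + e + 1) f (cup d e D E) F - sg (d + 1) (cup d (e + f + 1) D (cup e f E F))
    \<in> coboundaries (d + e + f + 2)"
    using coboundaries_uminus[OF coboundariesI[OF normalized_m3[OF D'(1) E'(1) F'(1)]]]
    by (simp add: add.assoc)
qed

lemma bracket_cup_coset:
  assumes D: "D \<in> cocycles d" and E: "E \<in> cocycles e" and F: "F \<in> cocycles f"
  shows "coset (d + e + f + 1) (bracket d (e + f + 1) D (cup e f E F)) =
    coset (d + e + f + 1) (sg d (cup (d + e) f (bracket d e D E) F) +
      sg (d + d * e) (cup e (d + f) E (bracket d f D F)))"
proof (rule coset_eqI)
  note D' = cocyclesD[OF D] and E' = cocyclesD[OF E] and F' = cocyclesD[OF F]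
  show "bracket d (e + f + 1) D (cup e f E F) - (sg d (cup (d + e) f (bracket d e D E) F) +
      sg (d + d * e) (cup e (d + f) E (bracket d f D F))) \<in> coboundaries (d + e + f + 1)"
    using bracket_cup_homotopy[OF D'(3) E'(3) F'(3) D'(2) E'(2) F'(2)]
      coboundaries_sg[OF coboundariesI[OF normalized_ins2[OF D'(1) E'(1) F'(1)]]]
    by simp
qed

theorem gerstenhaber_algebra_HH:
  "gerstenhaber_algebra HH HH_add HH_zero HH_smult HH_cup HH_bracket"
proof
  note simps = HH_add_coset HH_smult_coset HH_cup_coset HH_bracket_coset HH_smult_sign HH_zero_def
  note closed = HH_I cocycles_add cocycles_scale cocycles_cup cocycles_bracket cocycles_0
  fix p q r :: int and x y z x' y' and c d :: 'k
  show "HH_zero p \<in> HH p" by (simp add: simps closed)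
  {
    assume "x \<in> HH p"
    then obtain D where D: "D \<in> cocycles p" "x = coset p D" by (rule HH_E)
    show "HH_smult p c x \<in> HH p" by (simp add: D simps closed)
    show "HH_add p x (HH_zero p) = x" by (simp add: D simps)
    show "\<exists>y\<in>HH p. HH_add p x y = HH_zero p"
      by (rule bexI[of _ "coset p (- D)"]) (simp_all add: D simps HH_I cocycles_uminus)
    show "HH_smult p (c + d) x = HH_add p (HH_smult p c x) (HH_smult p d x)"
      by (simp add: D simps scale_left_distrib plus_fun_def)
    show "HH_smult p c (HH_smult p d x) = HH_smult p (c * d) x" by (simp add: D simps)
    show "HH_smult p 1 x = x" by (simp add: D simps)
  }
  {
    assume "x \<in> HH p" "y \<in> HH p"
    then obtain D E where D: "D \<in> cocycles p" "x = coset p D" and E: "E \<in> cocycles p" "y = coset p E"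
      by (meson HH_E)
    show "HH_add p x y \<in> HH p" by (simp add: D E simps closed)
    show "HH_add p x y = HH_add p y x" by (simp add: D E simps add.commute)
    show "HH_smult p c (HH_add p x y) = HH_add p (HH_smult p c x) (HH_smult p c y)"
      by (simp add: D E simps scale_right_distrib plus_fun_def)
  }
  {
    assume "x \<in> HH p" "y \<in> HH p" "z \<in> HH p"
    then show "HH_add p (HH_add p x y) z = HH_add p x (HH_add p y z)"
      by (elim HH_E) (simp add: simps add.assoc)
  }
  {
    assume "x \<in> HH p" "y \<in> HH q"
    then obtain D E where D: "D \<in> cocycles p" "x = coset p D" and E: "E \<in> cocycles q" "y = coset q E"
      by (meson HH_E)
    note DE = D E cocyclesD(3)[OF D(1)] cocyclesD(3)[OF E(1)]
    show "HH_cup p q x y \<in> HH (p + q + 1)" by (simp add: D E simps closed)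
    show "HH_bracket p q x y \<in> HH (p + q)" by (simp add: D E simps closed)
    show "HH_cup p q (HH_smult p c x) y = HH_smult (p + q + 1) c (HH_cup p q x y)"
      by (simp add: DE simps closed cup_scale_left)
    show "HH_cup p q x (HH_smult q c y) = HH_smult (p + q + 1) c (HH_cup p q x y)"
      by (simp add: DE simps closed cup_scale_right)
    show "HH_bracket p q (HH_smult p c x) y = HH_smult (p + q) c (HH_bracket p q x y)"
      by (simp add: DE simps closed bracket_scale_left)
    show "HH_bracket p q x (HH_smult q c y) = HH_smult (p + q) c (HH_bracket p q x y)"
      by (simp add: DE simps closed bracket_scale_right)
    show "HH_cup p q x y = HH_smult (p + q + 1) ((-1) powi (p * q + 1)) (HH_cup q p y x)"
      using cup_commute_coset[OF D(1) E(1)] HH_cup_coset[OF E(1) D(1)]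
      by (simp only: D(2) E(2) HH_cup_coset[OF D(1) E(1)] HH_smult_sign add.commute[of q p])
    show "HH_bracket p q x y = HH_smult (p + q) (- ((-1) powi (p * q))) (HH_bracket q p y x)"
      using bracket_antisym_cochains[OF DE(5,6)] HH_bracket_coset[OF E(1) D(1)]
      by (simp only: D(2) E(2) HH_bracket_coset[OF D(1) E(1)] HH_smult_sign add.commute[of q p])
  }
  {
    assume "x \<in> HH p" "x' \<in> HH p" "y \<in> HH q"
    then obtain D D' E where D: "D \<in> cocycles p" "x = coset p D" and D': "D' \<in> cocycles p" "x' = coset p D'"
      and E: "E \<in> cocycles q" "y = coset q E"
      by (meson HH_E)
    show "HH_cup p q (HH_add p x x') y = HH_add (p + q + 1) (HH_cup p q x y) (HH_cup p q x' y)"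
      by (simp add: D D' E simps closed cup_add_left cocyclesD(3))
    show "HH_bracket p q (HH_add p x x') y = HH_add (p + q) (HH_bracket p q x y) (HH_bracket p q x' y)"
      by (simp add: D D' E simps closed bracket_add_left cocyclesD(3))
  }
  {
    assume "x \<in> HH p" "y \<in> HH q" "y' \<in> HH q"
    then obtain D E E' where D: "D \<in> cocycles p" "x = coset p D" and E: "E \<in> cocycles q" "y = coset q E"
      and E': "E' \<in> cocycles q" "y' = coset q E'"
      by (meson HH_E)
    show "HH_cup p q x (HH_add q y y') = HH_add (p + q + 1) (HH_cup p q x y) (HH_cup p q x y')"
      by (simp add: D E E' simps closed cup_add_right cocyclesD(3))
    show "HH_bracket p q x (HH_add q y y') = HH_add (p + q) (HH_bracket p q x y) (HH_bracket p q x y')"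
      by (simp add: D E E' simps closed bracket_add_right cocyclesD(3))
  }
  {
    assume "x \<in> HH p" "y \<in> HH q" "z \<in> HH r"
    then obtain D E F where D: "D \<in> cocycles p" "x = coset p D" and E: "E \<in> cocycles q" "y = coset q E"
      and F: "F \<in> cocycles r" "z = coset r F"
      by (meson HH_E)
    note DEF = cocyclesD(3)[OF D(1)] cocyclesD(3)[OF E(1)] cocyclesD(3)[OF F(1)]
    have idx: "p + q + r + 1 + 1 = p + q + r + 2" "p + q + 1 + r + 1 = p + q + r + 2" "p + (q + r + 1) + 1 = p + q + r + 2"
      "p + (q + r) = p + q + r" "q + (p + r) = p + q + r" "p + (q + r + 1) = p + q + r + 1"
      "q + (p + r) + 1 = p + q + r + 1"
      by simp_all
    have "HH_cup (p + q + 1) r (HH_cup p q x y) z = coset (p + q + r + 2) (cup (p + q + 1) r (cup p q D E) F)"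
      using HH_cup_coset[OF cocycles_cup[OF D(1) E(1)] F(1)] by (simp only: D E F HH_cup_coset idx)
    moreover have "HH_cup p (q + r + 1) x (HH_cup q r y z) = coset (p + q + r + 2) (cup p (q + r + 1) D (cup q r E F))"
      using HH_cup_coset[OF D(1) cocycles_cup[OF E(1) F(1)]] by (simp only: D E F HH_cup_coset idx)
    ultimately show "HH_cup (p + q + 1) r (HH_cup p q x y) z =
       HH_smult (p + q + r + 2) ((-1) powi (p + 1)) (HH_cup p (q + r + 1) x (HH_cup q r y z))"
      using cup_assoc_coset[OF D(1) E(1) F(1)] by (simp only: HH_smult_sign)
    have "HH_bracket p (q + r) x (HH_bracket q r y z) = coset (p + q + r) (bracket p (q + r) D (bracket q r E F))"
      using HH_bracket_coset[OF D(1) cocycles_bracket[OF E(1) F(1)]] by (simp only: D E F HH_bracket_coset idx)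
    moreover have "HH_bracket (p + q) r (HH_bracket p q x y) z = coset (p + q + r) (bracket (p + q) r (bracket p q D E) F)"
      using HH_bracket_coset[OF cocycles_bracket[OF D(1) E(1)] F(1)] by (simp only: D E F HH_bracket_coset idx)
    moreover have "HH_bracket q (p + r) y (HH_bracket p r x z) = coset (p + q + r) (bracket q (p + r) E (bracket p r D F))"
      using HH_bracket_coset[OF E(1) cocycles_bracket[OF D(1) F(1)]] by (simp only: D E F HH_bracket_coset idx)
    ultimately show "HH_bracket p (q + r) x (HH_bracket q r y z) =
       HH_add (p + q + r) (HH_bracket (p + q) r (HH_bracket p q x y) z)
        (HH_smult (p + q + r) ((-1) powi (p * q)) (HH_bracket q (p + r) y (HH_bracket p r x z)))"
      using bracket_jacobi_cochains[OF DEF] by (simp only: HH_smult_sign HH_add_coset)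
    have "HH_bracket p (q + r + 1) x (HH_cup q r y z) = coset (p + q + r + 1) (bracket p (q + r + 1) D (cup q r E F))"
      using HH_bracket_coset[OF D(1) cocycles_cup[OF E(1) F(1)]] by (simp only: D E F HH_cup_coset idx)
    moreover have "HH_cup (p + q) r (HH_bracket p q x y) z = coset (p + q + r + 1) (cup (p + q) r (bracket p q D E) F)"
      using HH_cup_coset[OF cocycles_bracket[OF D(1) E(1)] F(1)] by (simp only: D E F HH_bracket_coset idx)
    moreover have "HH_cup q (p + r) y (HH_bracket p r x z) = coset (p + q + r + 1) (cup q (p + r) E (bracket p r D F))"
      using HH_cup_coset[OF E(1) cocycles_bracket[OF D(1) F(1)]] by (simp only: D E F HH_bracket_coset idx)
    ultimately show "HH_bracket p (q + r + 1) x (HH_cup q r y z) =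
       HH_add (p + q + r + 1)
        (HH_smult (p + q + r + 1) ((-1) powi p) (HH_cup (p + q) r (HH_bracket p q x y) z))
        (HH_smult (p + q + r + 1) ((-1) powi (p + p * q)) (HH_cup q (p + r) y (HH_bracket p r x z)))"
      using bracket_cup_coset[OF D(1) E(1) F(1)] by (simp only: HH_smult_sign HH_add_coset)
  }
qed

end

context cyclic_unital_A_infinity_algebra
begin

section \<open>The symplectic form\<close>

lemma om_add_left: "\<omega> (a + a') b = \<omega> a b + \<omega> a' b"
  and om_scale_left: "\<omega> (c *s a) b = c * \<omega> a b"
  and om_add_right: "\<omega> a (b + b') = \<omega> a b + \<omega> a b'"
  and om_scale_right: "\<omega> a (c *s b) = c * \<omega> a b"
  and vector_space_field: "vector_space ((*) :: 'k \<Rightarrow> 'k \<Rightarrow> 'k)"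
  using omega_linear_left[of b] omega_linear_right[of a] unfolding linear_iff by blast+

lemma om_0_left [simp]: "\<omega> 0 b = 0" and om_0_right [simp]: "\<omega> a 0 = 0"
  using om_scale_left[of 0 0 b] om_scale_right[of a 0 0] by simp_all

lemma om_sg_left: "\<omega> (sg n a) b = sg n (\<omega> a b)" and om_sg_right: "\<omega> a (sg n b) = sg n (\<omega> a b)"
  by (rule sg_additive, rule om_add_left, rule sg_additive, rule om_add_right)

lemma om_uminus_left: "\<omega> (- a) b = - \<omega> a b"
  using om_sg_left[of 1 a b] by simp

lemma om_diff_left: "\<omega> (a - a') b = \<omega> a b - \<omega> a' b"
  using om_add_left[of a "- a'" b] by (simp add: om_uminus_left)

lemma om_cutsum_left: "\<omega> (cutsum f xs) b = cutsum (\<lambda>u v. \<omega> (f u v) b) xs"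
  by (rule cutsum_additive[of "\<lambda>a. \<omega> a b"]) (simp_all add: om_add_left)

lemma om_ins_left: "\<omega> (ins F Es xs) b = ins (\<lambda>l. \<omega> (F l) b) Es xs"
  by (rule ins_additive[of "\<lambda>a. \<omega> a b"]) (rule om_add_left)

text \<open>
  The form vanishes unless \<open>|a| + |b| = - |\<omega>|\<close>. Modulo \<open>2\<close> this determines the parity of one
  argument by that of the other one, so the signs in the axioms of \<open>\<omega>\<close> can also be written with
  \<open>tw\<close>.
\<close>

lemma om_tw: "\<omega> (tw n a) b = sg (n * w) (\<omega> a (tw n b))"
proof (induction a rule: homogeneous_induct)
  case a: (homogeneous i a)
  show ?case
  proof (induction b rule: homogeneous_induct)
    case b: (homogeneous j b)
    show ?case
    proof (cases "i + j + w = 0")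
      case True
      then have i: "i = - j - w" by simp
      show ?thesis using a b
        by (simp add: tw_homogeneous om_sg_left om_sg_right) (rule sg_cong, simp add: i algebra_simps)
    qed (use a b in \<open>simp add: tw_homogeneous om_sg_left om_sg_right omega_degree\<close>)
  qed (simp add: om_add_right sg_add)
qed (simp add: om_add_left sg_add)

lemma om_swap: "\<omega> a b = - \<omega> b (tw (1 + w) a)"
proof (induction a rule: homogeneous_induct)
  case a: (homogeneous i a)
  show ?case
  proof (induction b rule: homogeneous_induct)
    case b: (homogeneous j b)
    show ?case
    proof (cases "i + j + w = 0")
      case True
      then have j: "j = - i - w" by simp
      have "\<omega> a b = sg (i * j + 1) (\<omega> b a)"
        using omega_symmetry[OF a b] by (simp add: sg_eq_powi_mult)
      also have "\<dots> = sg ((1 + w) * i + 1) (\<omega> b a)"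
        by (rule sg_cong) (simp add: j algebra_simps)
      finally show ?thesis using a
        by (simp add: tw_homogeneous om_sg_right) (simp add: sg_def)
    qed (use a b in \<open>simp add: tw_homogeneous om_sg_right omega_degree add.commute\<close>)
  qed (simp add: om_add_right om_add_left)
qed (simp add: om_add_left om_add_right)

lemma om_cyclic: "\<omega> (m (ts @ [t])) a = \<omega> (m (tw w a # ts)) t"
proof (induction a rule: homogeneous_induct)
  case a: (homogeneous i a)
  show ?case
  proof (induction t rule: homogeneous_induct)
    case t: (homogeneous j t)
    show ?case
    proof (rule madd_eqI[where F = "\<lambda>ts. \<omega> (m (ts @ [t])) a" and G = "\<lambda>ts. \<omega> (m (tw w a # ts)) t"])
      show "madd (\<lambda>ts. \<omega> (m (ts @ [t])) a)" "madd (\<lambda>ts. \<omega> (m (tw w a # ts)) t)"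
        using madd_context[OF m_madd, of "[]" "[t]"] madd_context[OF m_madd, of "[tw w a]" "[]"]
        by (simp_all add: madd_def om_add_left)
      fix ts assume ts: "homogeneous ts"
      have hom: "homogeneous ((i, a) # ts @ [(j, t)])" using a t ts by simp
      have *: "\<omega> (m (elts ts @ [t])) a = sg (i * (deg ts + j)) (\<omega> (m (a # elts ts)) t)"
        using omega_cyclic[OF hom] by (simp add: sg_eq_powi_mult)
      show "\<omega> (m (elts ts @ [t])) a = \<omega> (m (tw w a # elts ts)) t"
      proof (cases "deg ts + i + 1 + j + w = 0")
        case True
        then have "deg ts + j = - i - 1 - w" by simp
        then show ?thesis
          using madd_sg[OF m_madd, of "[]"] a
          by (simp add: * tw_homogeneous om_sg_left) (rule sg_cong, simp add: algebra_simps)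
      next
        case False
        have "m (a # elts ts) \<in> gr (1 + (i + deg ts))"
          using cochains_gr[OF m_cochain, of "(i, a) # ts"] a ts by simp
        then have "\<omega> (m (a # elts ts)) t = 0" by (rule omega_degree[OF _ t]) (use False in simp)
        then show ?thesis
          using madd_sg[OF m_madd, of "[]"] a by (simp add: * tw_homogeneous om_sg_left)
      qed
    qed
  next
    case (add a b)
    then show ?case using madd_add[OF m_madd, of ts _ _ "[]"] by (simp add: om_add_right om_add_left)
  qed
next
  case (add a b)
  then show ?case using madd_add[OF m_madd, of "[]"] by (simp add: om_add_right om_add_left)
qed

lemma om_rotate: "\<omega> (m (p @ b # r)) a = \<omega> (m (tws w r @ tw w a # p)) b"
proof (induction r arbitrary: p a rule: rev_induct)
  case Nil
  then show ?case using om_cyclic[of p b a] by simp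
next
  case (snoc t r)
  show ?case using om_cyclic[of "p @ b # r" t a] snoc[of "tw w a # p" t] by simp
qed

text \<open>
  Cyclicity brings any argument of \<open>m\<close> into the first slot of the form. This is how the operations
  that are defined by duality, such as \<open>\<Delta>\<close>, are evaluated inside \<open>m\<close>.
\<close>

lemma om_extract: "\<omega> (m (p @ X # r)) a = sg w (\<omega> X (m (tws 1 r @ tw 1 a # tws (1 + w) p)))"
proof -
  have odd: "tw (1 + w + w) = tw 1" by (rule tw_odd) simp
  have "\<omega> (m (p @ X # r)) a = - \<omega> X (tw (1 + w) (m (tws w r @ tw w a # p)))"
    by (rule trans[OF om_rotate om_swap])
  also have "tw (1 + w) (m (tws w r @ tw w a # p)) = sg (1 + w) (m (tws 1 r @ tw 1 a # tws (1 + w) p))"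
    unfolding equivariantD[OF m_equivariant] by (simp only: map_append list.map tws_tws tw_tw odd mult_1_right)
  finally show ?thesis unfolding om_sg_right by (simp add: sg_def)
qed

text \<open>
  By cyclicity \<open>\<omega>(m(L), \<one>)\<close> is the value of \<open>m\<close> on a list with a unit, so only the product
  \<open>m\<^sub>2\<close> contributes. All simplifications in the BV part come from this formula.
\<close>

lemma om_m_one: "\<omega> (m L) \<one> = (if length L = 2 then sg w (\<omega> (L ! 0) (L ! 1)) else 0)"
proof (cases L rule: rev_cases)
  case Nil
  then show ?thesis by (simp add: m_Nil)
next
  case (snoc L' t)
  have "\<omega> (m L) \<one> = sg w (\<omega> (m (\<one> # L')) t)"
    using madd_sg[OF m_madd, of "[]" w \<one> L'] unfolding snoc om_cyclic tw_one
    by (simp add: om_sg_left)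
  also have "\<dots> = (if length L = 2 then sg w (\<omega> (L ! 0) (L ! 1)) else 0)"
  proof (cases "length L' = 1")
    case True
    then obtain b where "L' = [b]" by (auto simp: length_Suc_conv)
    then show ?thesis by (simp add: snoc m_one_left')
  next
    case False
    then have "m (\<one> # L') = 0" by (intro m_one_other) auto
    then show ?thesis using False by (simp add: snoc)
  qed
  finally show ?thesis .
qed

lemma om_inject:
  assumes "\<And>j a. a \<in> gr j \<Longrightarrow> \<omega> b a = \<omega> b' a"
  shows "b = b'"
proof -
  have "\<omega> b a = \<omega> b' a" for a
    by (induction a rule: homogeneous_induct) (simp_all add: assms om_add_right)
  then have 1: "\<forall>a. \<omega> (b - b') a = 0" by (simp add: om_diff_left)
  have "Vector_Spaces.linear scale (*) (\<lambda>a::'a. 0::'k)"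
    using vector_space_field by (simp add: linear_iff)
  then have "\<exists>!b. \<forall>a. \<omega> b a = 0" by (rule omega_nondegenerate) simp
  then show ?thesis using 1 by (metis om_0_left eq_iff_diff_eq_0)
qed

text \<open>
  Non-degeneracy represents functionals that live in a single degree. For homogeneous \<open>xs\<close> the
  degree condition provides this, and every list reduces to homogeneous ones by additivity.
\<close>

lemma cochain_of_form:
  fixes \<Phi> :: "'a list \<Rightarrow> 'a \<Rightarrow> 'k"
  assumes mlin: "\<And>a. mlin (*) (\<lambda>xs. \<Phi> xs a)"
    and linear: "\<And>xs. Vector_Spaces.linear scale (*) (\<Phi> xs)"
    and degree: "\<And>ts j a. homogeneous ts \<Longrightarrow> a \<in> gr j \<Longrightarrow> deg ts + j + c \<noteq> 0 \<Longrightarrow> \<Phi> (elts ts) a = 0"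
  shows "\<exists>X\<in>cochains (c - w). \<forall>xs a. \<omega> (X xs) a = \<Phi> xs a"
proof -
  have "\<exists>b. \<forall>a. \<omega> b a = \<Phi> xs a" for xs
  proof (induction xs rule: list_homogeneous_induct)
    case (homogeneous ts)
    have "\<exists>!b. \<forall>a. \<omega> b a = \<Phi> (elts ts) a"
      by (rule omega_nondegenerate[OF linear, of "- deg ts - c"]) (rule degree[OF homogeneous], auto)
    then show ?case by blast
  next
    case (add xs a b ys)
    then obtain x y where "\<forall>c. \<omega> x c = \<Phi> (xs @ a # ys) c" "\<forall>c. \<omega> y c = \<Phi> (xs @ b # ys) c" by blast
    then have "\<forall>c. \<omega> (x + y) c = \<Phi> (xs @ (a + b) # ys) c"
      by (simp add: om_add_left madd_add[OF mlin_madd[OF mlin]])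
    then show ?case by blast
  qed
  then obtain X where X: "\<And>xs a. \<omega> (X xs) a = \<Phi> xs a" by metis
  have "X \<in> cochains (c - w)"
    unfolding cochains_def multilinear_iff_mlin
  proof (intro CollectI conjI allI impI)
    show "mlin scale X"
      by (rule mlinI[OF vector_space_axioms]; rule om_inject)
        (simp_all add: X om_add_left om_scale_left madd_add[OF mlin_madd[OF mlin]] mlin_scale[OF mlin])
    fix ts assume ts: "homogeneous ts"
    let ?b = "X (elts ts)" and ?i = "c - w + deg ts"
    have comp: "\<omega> ?b a = \<omega> (component ?b (- j - w)) a" if a: "a \<in> gr j" for a j
    proof -
      have "\<omega> ?b a = \<omega> (\<Sum>n | component ?b n \<noteq> 0. component ?b n) a" by (simp add: component_sum)
      also have "\<dots> = (\<Sum>n | component ?b n \<noteq> 0. \<omega> (component ?b n) a)"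
        by (rule additive.sum) (simp add: additive_def om_add_left)
      also have "\<dots> = (\<Sum>n | component ?b n \<noteq> 0. if n = - j - w then \<omega> (component ?b n) a else 0)"
        by (rule sum.cong) (auto intro!: omega_degree[OF component_in a])
      also have "\<dots> = \<omega> (component ?b (- j - w)) a"
        by (simp add: component_finite)
      finally show ?thesis .
    qed
    have "component ?b i = 0" if "i \<noteq> ?i" for i
    proof (rule om_inject)
      fix j a assume a: "a \<in> gr j"
      show "\<omega> (component ?b i) a = \<omega> 0 a"
      proof (cases "i + j + w = 0")
        case True
        then have i: "i = - j - w" by simp
        then have "\<omega> (component ?b i) a = \<Phi> (elts ts) a" using comp[OF a] X by simp
        also have "\<dots> = 0" by (rule degree[OF ts a]) (use that i in auto)
        finally show ?thesis by simp
      qed (use omega_degree[OF component_in a] in simp)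
    qed
    then have "{n. component ?b n \<noteq> 0} \<subseteq> {?i}" by blast
    from component_sum_superset[OF _ this] have "?b = component ?b ?i" by simp
    then show "?b \<in> gr ?i" using component_in[of ?b ?i] by simp
  qed
  then show ?thesis using X by blast
qed

lemma mlin_form:
  assumes "D \<in> cochains d"
  shows "mlin (*) (\<lambda>xs. \<omega> (D xs) b)"
  using madd_add[OF cochainsD(2)[OF assms]] mlin_scale[OF cochainsD(1)[OF assms]]
  by (intro mlinI vector_space_field) (simp_all add: om_add_left om_scale_left)

section \<open>The BV operator\<close>

text \<open>
  The pairing with the unit turns \<open>D\<close> into a functional on lists of parity \<open>d + |\<omega>| + 1\<close>.
\<close>

lemma form_one_tws:
  assumes "D \<in> cochains d"
  shows "\<omega> (D (tws n l)) \<one> = sg (n * (d + w + 1)) (\<omega> (D l) \<one>)"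
proof -
  have "\<omega> (D (tws n l)) \<one> = sg (n * d) (\<omega> (tw n (D l)) \<one>)"
    unfolding equivariantD[OF cochains_equivariant[OF assms]] by (simp add: om_sg_left)
  then show ?thesis by (simp add: om_tw tw_one om_sg_right algebra_simps)
qed

lemma form_one_degree:
  assumes "D \<in> cochains d" "homogeneous ts" "deg ts + (d + w - 1) \<noteq> 0"
  shows "\<omega> (D (elts ts)) \<one> = 0"
  by (rule omega_degree[OF cochains_gr[OF assms(1,2)] one_degree]) (use assms(3) in simp)

text \<open>
  A rotation moves the block \<open>u\<close> across the rest of the cyclic word. The degrees of all arguments
  add up to \<open>1 - d - |\<omega>|\<close> whenever the term is non-zero, so the Koszul sign of the rotation
  depends on \<open>u\<close> only and is produced by applying \<open>tw (d + |\<omega>|)\<close> to \<open>u\<close>.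
\<close>

lemma Delta_spec:
  assumes D: "D \<in> cochains d"
  shows "Delta D \<in> cochains (d - 1)"
    and "\<omega> (Delta D xs) a = cutsum (\<lambda>u v. \<omega> (D (v @ a # tws (d + w) u)) \<one>) xs"
proof -
  let ?\<Psi> = "\<lambda>l. \<omega> (D l) \<one>"
  let ?\<Phi> = "\<lambda>xs a. cutsum (\<lambda>u v. ?\<Psi> (v @ a # tws (d + w) u)) xs"
  have \<Psi>: "mlin (*) ?\<Psi>" by (rule mlin_form[OF D])
  have "mlin (*) (\<lambda>xs. ?\<Phi> xs a)" for a
    using mlin_context[OF \<Psi>, of "_ @ [a]" "d + w" "[]"] mlin_context[OF \<Psi>, of "[]" 0 "a # _"]
    by (intro mlin_cutsum vector_space_field) simp_all
  moreover have "Vector_Spaces.linear scale (*) (?\<Phi> xs)" for xs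
    unfolding linear_iff
    using madd_add[OF mlin_madd[OF \<Psi>]] mlin_scale[OF \<Psi>]
    by (simp add: vector_space_field cutsum_add cutsum_additive[of "\<lambda>x. _ * x"] distrib_left)
  moreover have "?\<Phi> (elts ts) a = 0"
    if "homogeneous ts" "a \<in> gr j" "deg ts + j + (d + w - 1) \<noteq> 0" for ts a j
    unfolding cutsum_map
  proof (rule cutsum_zero)
    fix u v assume uv: "u @ v = ts"
    then have "homogeneous u" using that(1) by auto
    then obtain u' where u': "homogeneous u'" "elts u' = tws (d + w) (elts u)" "deg u' = deg u"
      by (rule homogeneous_tws)
    have "?\<Psi> (elts (v @ (j, a) # u')) = 0"
      by (rule form_one_degree[OF D]) (use uv u' that in auto)
    then show "?\<Psi> (elts v @ a # tws (d + w) (elts u)) = 0" using u' by simp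
  qed
  ultimately have "\<exists>X\<in>cochains (d + w - 1 - w). \<forall>xs a. \<omega> (X xs) a = ?\<Phi> xs a"
    by (rule cochain_of_form)
  then obtain X where X: "X \<in> cochains (d + w - 1 - w)" "\<And>xs a. \<omega> (X xs) a = ?\<Phi> xs a"
    by blast
  have form: "(\<Sum>i\<le>length ts. (-1) powi (deg (take i ts) * deg (drop i ts @ [t])) *
           \<omega> (D (elts (drop i ts @ [t] @ take i ts))) \<one>) = ?\<Phi> (elts ts) (snd t)"
    if hom: "homogeneous (ts @ [t])" for ts t
    unfolding sg_eq_powi_mult cutsum_map cutsum_eq_sum[of "\<lambda>u v. sg (deg u * deg (v @ [t])) (\<omega> (D (elts (v @ [t] @ u))) \<one>)", symmetric]
  proof (rule cutsum_cong)
    fix u v assume uv: "u @ v = ts"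
    then have u: "homogeneous u" and v: "homogeneous (v @ t # u)" using hom by auto
    have "?\<Psi> (elts v @ snd t # tws (d + w) (elts u)) = sg ((d + w) * deg u) (?\<Psi> (elts v @ snd t # elts u))"
      using madd_tws_homogeneous[OF mlin_madd[OF \<Psi>] u, of "elts v @ [snd t]" "d + w" "[]"] by simp
    also have "\<dots> = sg (deg u * deg (v @ [t])) (?\<Psi> (elts v @ snd t # elts u))"
    proof (cases "deg v + fst t + deg u + (d + w - 1) = 0")
      case True
      then have v: "deg (v @ [t]) = 1 - (d + w) - deg u" by simp
      show ?thesis unfolding v by (intro sg_cong) (simp add: algebra_simps)
    next
      case False
      then show ?thesis using form_one_degree[OF D v] by simp
    qed
    finally show "sg (deg u * deg (v @ [t])) (\<omega> (D (elts (v @ [t] @ u))) \<one>) =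
      ?\<Psi> (elts v @ snd t # tws (d + w) (elts u))" by simp
  qed
  have "Delta D = X"
    unfolding Delta_def
  proof (rule the_equality)
    show "multilinear X \<and> (\<forall>ts t\<^sub>0. homogeneous (ts @ [t\<^sub>0]) \<longrightarrow> \<omega> (X (elts ts)) (snd t\<^sub>0) =
        (\<Sum>i\<le>length ts. (-1) powi (deg (take i ts) * deg (drop i ts @ [t\<^sub>0])) *
           \<omega> (D (elts (drop i ts @ [t\<^sub>0] @ take i ts))) \<one>))"
      using X(1) form by (simp add: X(2) multilinear_iff_mlin cochainsD(1))
    fix Y assume Y: "multilinear Y \<and> (\<forall>ts t\<^sub>0. homogeneous (ts @ [t\<^sub>0]) \<longrightarrow> \<omega> (Y (elts ts)) (snd t\<^sub>0) =
        (\<Sum>i\<le>length ts. (-1) powi (deg (take i ts) * deg (drop i ts @ [t\<^sub>0])) *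
           \<omega> (D (elts (drop i ts @ [t\<^sub>0] @ take i ts))) \<one>))"
    show "Y = X"
    proof
      fix xs
      show "Y xs = X xs"
      proof (rule madd_eqI)
        show "madd Y" using conjunct1[OF Y] unfolding multilinear_iff_mlin by (rule mlin_madd)
        show "madd X" using X(1) by (rule cochainsD(2))
        fix ts assume ts: "homogeneous ts"
        show "Y (elts ts) = X (elts ts)"
        proof (rule om_inject)
          fix j a assume "a \<in> gr j"
          then have "homogeneous (ts @ [(j, a)])" using ts by simp
          from conjunct2[OF Y, rule_format, OF this] form[OF this]
          show "\<omega> (Y (elts ts)) a = \<omega> (X (elts ts)) a" by (simp add: X(2))
        qed
      qed
    qed
  qed
  then show "Delta D \<in> cochains (d - 1)"
    "\<omega> (Delta D xs) a = cutsum (\<lambda>u v. \<omega> (D (v @ a # tws (d + w) u)) \<one>) xs"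
    using X by simp_all
qed

lemma eq_if_forms_eq: "(\<And>xs a. \<omega> (X xs) a = \<omega> (Y xs) a) \<Longrightarrow> X = Y"
  by (rule ext, rule om_inject)

lemma Delta_add:
  assumes "D \<in> cochains d" "E \<in> cochains d"
  shows "Delta (D + E) = Delta D + Delta E"
  by (rule eq_if_forms_eq)
    (simp add: Delta_spec(2)[OF assms(1)] Delta_spec(2)[OF assms(2)] Delta_spec(2)[OF cochains_add[OF assms]]
      om_add_left cutsum_add)

lemma Delta_scale:
  assumes "D \<in> cochains d"
  shows "Delta (\<lambda>xs. c *s D xs) = (\<lambda>xs. c *s Delta D xs)"
  by (rule eq_if_forms_eq)
    (simp add: Delta_spec(2)[OF assms(1)] Delta_spec(2)[OF cochains_scale[OF assms]]
      om_scale_left cutsum_additive[of "\<lambda>x. c * x"] distrib_left)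

lemma normalized_Delta:
  assumes "D \<in> normalized_cochains d"
  shows "Delta D \<in> normalized_cochains (d - 1)"
  unfolding normalized_cochains_def
proof (intro CollectI conjI allI impI)
  note D = normalizedD[OF assms]
  show "Delta D \<in> cochains (d - 1)" by (rule Delta_spec(1)[OF D(1)])
  fix xs assume xs: "\<one> \<in> set xs"
  show "Delta D xs = 0"
  proof (rule om_inject)
    fix j a
    have "cutsum (\<lambda>u v. \<omega> (D (v @ a # tws (d + w) u)) \<one>) xs = 0"
    proof (rule cutsum_zero)
      fix u v assume uv: "u @ v = xs"
      show "\<omega> (D (v @ a # tws (d + w) u)) \<one> = 0"
      proof (cases "\<one> \<in> set v")
        case False
        with xs uv have "\<one> \<in> set u" by auto
        from madd_tws_one[OF D(3) this D(2), where P = "v @ [a]" and n = "d + w" and Q = "[]"] show ?thesis by simp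
      qed (simp add: D(2))
    qed
    then show "\<omega> (Delta D xs) a = \<omega> 0 a" by (simp add: Delta_spec(2)[OF D(1)])
  qed
qed

text \<open>
  In every term of \<open>\<Delta>\<^sup>2 D\<close> a unit is an argument of \<open>D\<close>.
\<close>

theorem Delta_Delta_eq_0:
  assumes "D \<in> normalized_cochains d"
  shows "Delta (Delta D) = 0"
proof (rule eq_if_forms_eq)
  fix xs a
  note D = normalizedD[OF assms]
  show "\<omega> (Delta (Delta D) xs) a = \<omega> (0 xs) a"
    unfolding Delta_spec(2)[OF Delta_spec(1)[OF D(1)]] Delta_spec(2)[OF D(1)]
    by (simp add: D(2))
qed

text \<open>
  Paired with the unit, \<open>m{D}\<close> only retains the terms in which \<open>m\<^sub>2\<close> multiplies the value of \<open>D\<close>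
  with the last or with the first argument.
\<close>

lemma form_brace_m:
  assumes D: "D \<in> cochains d" and l: "l \<noteq> []"
  shows "\<omega> (ins m [(d, D)] l) \<one> =
    sg w (\<omega> (D (butlast l)) (last l) - \<omega> (D (tl l)) (tw (d + w + 1) (hd l)))"
proof -
  let ?g = "\<lambda>x y z. \<omega> (m (tws d x @ D y # z)) \<one>"
  have g0: "?g x y z = 0" if "length x + length z \<noteq> 1" for x y z
    using that by (simp add: om_m_one)
  obtain b l1 where b: "l = b # l1" using l by (cases l) auto
  obtain l' c where c: "l = l' @ [c]" using l by (cases l rule: rev_cases) auto
  have "\<omega> (ins m [(d, D)] l) \<one> = cutsum (\<lambda>x t. cutsum (\<lambda>y z. ?g x y z) t) l"
    by (simp add: om_cutsum_left ins.simps(2))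
  also have "\<dots> = cutsum (?g []) l + cutsum (\<lambda>x t. cutsum (?g (b # x)) t) l1"
    by (simp add: b)
  also have "cutsum (\<lambda>x t. cutsum (?g (b # x)) t) l1 = cutsum (?g [b]) l1"
    by (rule trans[OF cutsum_only_first]) (use g0[of "b # _"] in \<open>auto intro!: cutsum_zero\<close>)
  also have "\<dots> = ?g [b] l1 []"
    by (rule cutsum_only_last) (use g0[of "[b]"] in auto)
  also have "\<dots> = - sg w (\<omega> (D l1) (tw (d + w + 1) b))"
    using om_swap[of "tw d b" "D l1"] by (simp add: om_m_one ac_simps)
  also have "cutsum (?g []) l = cutsum (\<lambda>u v. ?g [] u (v @ [c])) l' + ?g [] l []"
    by (simp add: c cutsum_append_Cons)
  also have "cutsum (\<lambda>u v. ?g [] u (v @ [c])) l' = ?g [] l' [c]"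
    by (rule trans[OF cutsum_only_last]) (use g0[of "[]" "_ @ [c]"] in auto)
  also have "\<dots> = sg w (\<omega> (D l') c)" by (simp add: om_m_one)
  also have "?g [] l [] = 0" by (rule g0) simp
  finally have "\<omega> (ins m [(d, D)] l) \<one> = sg w (\<omega> (D l') c) - sg w (\<omega> (D l1) (tw (d + w + 1) b))"
    by simp
  moreover have "butlast l = l'" "last l = c" using c by simp_all
  moreover have "tl l = l1" "hd l = b" using b by simp_all
  ultimately show ?thesis by (simp add: sg_diff)
qed

text \<open>
  When the cyclic word is rotated, the last argument of one word becomes the first argument of the
  next one. So the boundary terms of \<open>form_brace_m\<close> cancel in pairs, up to the two ends of the range
  of rotations. The block \<open>R\<close> sits between the rotated list and \<open>a\<close> and does not move.
\<close>

lemma rotation_boundary: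
  fixes D e k a R
  defines "B \<equiv> \<lambda>l. \<omega> (D (butlast l)) (last l) - \<omega> (D (tl l)) (tw k (hd l))"
  shows "cutsum (\<lambda>u v. B (tws e v @ R @ a # tws (e + k) u)) p =
    \<omega> (D (tws e p @ R)) a - \<omega> (D (tl (R @ a # tws (e + k) p))) (tw k (hd (R @ a # tws (e + k) p)))"
proof -
  let ?L = "\<lambda>u v. tws e v @ R @ a # tws (e + k) u"
  let ?A = "\<lambda>u v. \<omega> (D (butlast (?L u v))) (last (?L u v))" and
    ?B = "\<lambda>u v. \<omega> (D (tl (?L u v))) (tw k (hd (?L u v)))"
  have "cutsum (\<lambda>u v. B (?L u v)) p = cutsum ?A p - cutsum ?B p"
    using cutsum_add[of ?A "\<lambda>u v. - ?B u v" p] by (simp add: B_def cutsum_uminus)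
  moreover have "?A (u @ [b]) v = ?B u (b # v)" for u b v
    by (simp add: butlast_append add.commute)
  then have "cutsum ?A p - ?A [] p = cutsum ?B p - ?B p []" by (rule cutsum_shift)
  then have "cutsum ?A p - cutsum ?B p = ?A [] p - ?B p []" by algebra
  ultimately show ?thesis by (simp add: butlast_append)
qed

text \<open>
  Both sides are sums over the insertions of \<open>m\<close> into the rotations of \<open>D\<close>. On the right-hand side
  \<open>m{D}\<close> does not contribute: a full rotation leaves no boundary terms. The sum for \<open>D{m}\<close> is split
  according to the place of the last argument \<open>a\<close>: in \<open>?T1\<close> it stands behind \<open>m\<close> and in \<open>?T3\<close>
  before \<open>m\<close>, which gives \<open>(\<Delta> D){m}\<close>, and in \<open>?T2\<close> it is an argument of \<open>m\<close>, which gives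
  \<open>m{\<Delta> D}\<close> by cyclicity.
\<close>

theorem hochschild_diff_Delta:
  assumes D: "D \<in> cochains d"
  shows "hochschild_diff (d - 1) (Delta D) = - Delta (hochschild_diff d D)"
proof (rule eq_if_forms_eq)
  fix xs a
  let ?\<Psi> = "\<lambda>l. \<omega> (D l) \<one>" and ?n = "d + w + 1"
  have \<Psi>: "madd ?\<Psi>" by (rule mlin_madd[OF mlin_form[OF D]])
  let ?T = "cutsum (\<lambda>u v. ins ?\<Psi> [(1, m)] (v @ a # tws ?n u)) xs"
  let ?T1 = "cutsum (\<lambda>u r. cutsum (\<lambda>p s. cutsum (\<lambda>b c. ?\<Psi> (tws 1 p @ m b # c @ a # tws ?n u)) s) r) xs"
  let ?T2 = "cutsum (\<lambda>b r. cutsum (\<lambda>c s. cutsum (\<lambda>p t. ?\<Psi> (tws 1 p @ m (t @ a # tws ?n b) # tws ?n c)) s) r) xs"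
  let ?T3 = "cutsum (\<lambda>b r. cutsum (\<lambda>c s. cutsum (\<lambda>z v.
    ?\<Psi> (tws 1 v @ tw 1 a # tws (1 + ?n) b @ m (tws ?n c) # tws ?n z)) s) r) xs"
  have T: "?T = ?T1 + ?T2 + ?T3"
    unfolding ins_single_append
    by (simp add: ins.simps(2) cutsum_map cutsum_add cutsum_nest')
  \<comment> \<open>the exponents of the two sides agree after the involution is applied to the whole word\<close>
  have leaf3: "?\<Psi> (v @ a # tws (d + w + 1) x @ tw (d + w) (m y) # tws (d + w) z) =
      ?\<Psi> (tws 1 v @ tw 1 a # tws (1 + ?n) x @ m (tws ?n y) # tws ?n z)" for v x y z
  proof -
    have "?\<Psi> (v @ a # tws (d + w + 1) x @ tw (d + w) (m y) # tws (d + w) z) =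
      sg ?n (?\<Psi> (tws 1 (v @ a # tws (d + w + 1) x @ tw (d + w) (m y) # tws (d + w) z)))"
      unfolding form_one_tws[OF D] by simp
    also have "tws 1 (v @ a # tws (d + w + 1) x @ tw (d + w) (m y) # tws (d + w) z) =
      (tws 1 v @ tw 1 a # tws (1 + ?n) x) @ tw ?n (m y) # tws ?n z"
      by (simp add: ac_simps)
    also have "tw ?n (m y) = sg ?n (m (tws ?n y))"
      by (simp only: equivariantD[OF m_equivariant] mult_1_right)
    finally show ?thesis unfolding madd_sg[OF \<Psi>] by simp
  qed
  have Delta_m: "\<omega> (ins (Delta D) [(1, m)] xs) a = ?T1 + ?T3"
    unfolding leaf3[symmetric]
    by (simp add: om_cutsum_left ins.simps(2) Delta_spec(2)[OF D] cutsum_append_Cons cutsum_map cutsum_add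
        cutsum_nest')
  have leaf2: "sg w (?\<Psi> (v @ m (tws 1 z @ tw 1 a # tws (d + w) x) # tws (d + w) u)) =
      sg d (?\<Psi> (tws 1 v @ m (z @ a # tws ?n x) # tws ?n u))" for x z u v
  proof -
    have "?\<Psi> (v @ m (tws 1 z @ tw 1 a # tws (d + w) x) # tws (d + w) u) =
      sg ?n (?\<Psi> (tws 1 (v @ m (tws 1 z @ tw 1 a # tws (d + w) x) # tws (d + w) u)))"
      unfolding form_one_tws[OF D] by simp
    also have "\<dots> = sg ?n (?\<Psi> (tws 1 v @ sg 1 (m (z @ a # tws ?n x)) # tws ?n u))"
      using equivariantD[OF m_equivariant, of 1 "tws 1 z @ tw 1 a # tws (d + w) x"] by (simp add: ac_simps)
    finally show ?thesis unfolding madd_sg[OF \<Psi>] by (auto simp: sg_def)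
  qed
  have m_Delta: "\<omega> (ins m [(d - 1, Delta D)] xs) a = sg d ?T2"
  proof -
    have "\<omega> (ins m [(d - 1, Delta D)] xs) a = cutsum (\<lambda>x t. cutsum (\<lambda>y z. cutsum (\<lambda>u v.
        sg w (?\<Psi> (v @ m (tws 1 z @ tw 1 a # tws (d + w) x) # tws (d + w) u))) y) t) xs"
      by (simp add: om_cutsum_left ins.simps(2) om_extract Delta_spec(2)[OF D] cutsum_sg ac_simps)
    then show ?thesis unfolding leaf2 by (simp add: cutsum_sg cutsum_nest')
  qed
  have "\<omega> (hochschild_diff (d - 1) (Delta D) xs) a = sg d ?T2 - sg (d - 1) (?T1 + ?T3)"
    unfolding hochschild_diff_eq[OF Delta_spec(1)[OF D]] using m_Delta Delta_m
    by (simp add: om_diff_left om_sg_left)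
  also have "\<dots> = sg d ?T" unfolding T by (cases "even d") (simp_all add: sg_def)
  finally have lhs: "\<omega> (hochschild_diff (d - 1) (Delta D) xs) a = sg d ?T" .
  have "cutsum (\<lambda>u v. \<omega> (ins m [(d, D)] (v @ a # tws ?n u)) \<one>) xs = 0"
  proof -
    have "\<omega> (D (tws ?n xs)) (tw ?n a) = \<omega> (D xs) a"
    proof -
      have "D (tws ?n xs) = sg (?n * d) (tw ?n (D xs))"
        by (simp add: equivariantD[OF cochains_equivariant[OF D]])
      then have "\<omega> (D (tws ?n xs)) (tw ?n a) = sg (?n * d + ?n * w) (\<omega> (D xs) (tw (?n + ?n) a))"
        by (simp only: om_sg_left om_tw tw_tw sg_simps)
      moreover have "even (?n * d + ?n * w)" "even (?n + ?n)" by auto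
      ultimately show ?thesis by (simp only: sg_even tw_even)
    qed
    then show ?thesis
      using rotation_boundary[where e = 0 and k = ?n and R = "[]" and D = D and a = a and p = xs]
      by (simp add: form_brace_m[OF D] cutsum_sg)
  qed
  then have "\<omega> (Delta (hochschild_diff d D) xs) a = - sg d ?T"
    using cutsum_add[of "\<lambda>u v. \<omega> (ins m [(d, D)] (v @ a # tws ?n u)) \<one>"
      "\<lambda>u v. - sg d (ins ?\<Psi> [(1, m)] (v @ a # tws ?n u))" xs]
    unfolding Delta_spec(2)[OF cochains_hochschild_diff[OF D]] unfolding hochschild_diff_eq[OF D]
    by (simp add: om_diff_left om_sg_left om_ins_left[of D] cutsum_uminus cutsum_sg ac_simps)
  then show "\<omega> (hochschild_diff (d - 1) (Delta D) xs) a = \<omega> ((- Delta (hochschild_diff d D)) xs) a"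
    using lhs by (simp add: om_uminus_left)
qed

section \<open>The BV relation\<close>

text \<open>
  The homotopy for the BV relation: the part of the cyclic sum for \<open>\<Delta>(D{E})\<close> in which \<open>E\<close> stands
  before the last argument \<open>a\<close> and does not contain it. It is normalized, because units are passed
  to \<open>D\<close> or to \<open>E\<close>.
\<close>

lemma BV_homotopy_exists:
  assumes D': "D \<in> normalized_cochains d" and E': "E \<in> normalized_cochains e"
  shows "\<exists>h\<in>normalized_cochains (d + e - 1). \<forall>xs a. \<omega> (h xs) a =
    cutsum (\<lambda>u r. cutsum (\<lambda>x s. cutsum (\<lambda>y z.
      \<omega> (D (tws e x @ E y # z @ a # tws (d + e + w) u)) \<one>) s) r) xs"
proof -
  note D = normalizedD[OF D'] and E = normalizedD[OF E']
  let ?\<Psi> = "\<lambda>l. \<omega> (D l) \<one>" and ?N = "d + e + w"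
  let ?L = "\<lambda>u x y z a. tws e x @ E y # z @ a # tws ?N u"
  let ?\<Phi> = "\<lambda>xs a. cutsum (\<lambda>u r. cutsum (\<lambda>x s. cutsum (\<lambda>y z. ?\<Psi> (?L u x y z a)) s) r) xs"
  have \<Psi>: "mlin (*) ?\<Psi>" by (rule mlin_form[OF D(1)])
  have "mlin (*) (\<lambda>xs. ?\<Phi> xs a)" for a
    using mlin_context[OF \<Psi>, of "tws e _ @ E _ # _ @ [a]" ?N "[]"]
      mlin_context[OF \<Psi>, of "[]" e "E _ # _ @ a # tws ?N _"]
      mlin_context[OF \<Psi>, of "tws e _ @ [E _]" 0 "a # tws ?N _"]
      mlin_argument[OF \<Psi> cochainsD(1)[OF E(1)], of "tws e _" 0 "_ @ a # tws ?N _"]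
    by (intro mlin_cutsum mlin_cutsum_parameter vector_space_field) simp_all
  moreover have "Vector_Spaces.linear scale (*) (?\<Phi> xs)" for xs
    unfolding linear_iff
    using madd_add[OF mlin_madd[OF \<Psi>], of "tws e _ @ E _ # _"] mlin_scale[OF \<Psi>, of "tws e _ @ E _ # _"]
    by (simp add: vector_space_field cutsum_add[THEN ext] cutsum_additive[of "\<lambda>x. _ * x"] distrib_left)
  moreover have "?\<Phi> (elts ts) a = 0"
    if "homogeneous ts" "a \<in> gr j" "deg ts + j + (d + e + w - 1) \<noteq> 0" for ts a j
    unfolding cutsum_map
  proof (rule cutsum_zero, rule cutsum_zero, rule cutsum_zero)
    fix u r x s y z assume ts: "u @ r = ts" "x @ s = r" "y @ z = s"
    then have hom: "homogeneous u" "homogeneous x" "homogeneous y" "homogeneous z" using that(1) by auto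
    obtain u' where u': "homogeneous u'" "elts u' = tws ?N (elts u)" "deg u' = deg u"
      using homogeneous_tws[OF hom(1)] .
    obtain x' where x': "homogeneous x'" "elts x' = tws e (elts x)" "deg x' = deg x"
      using homogeneous_tws[OF hom(2)] .
    have "?\<Psi> (elts (x' @ (e + deg y, E (elts y)) # z @ (j, a) # u')) = 0"
      by (rule form_one_degree[OF D(1)])
        (use ts u' x' hom that cochains_gr[OF E(1) hom(3)] in auto)
    then show "?\<Psi> (?L (elts u) (elts x) (elts y) (elts z) a) = 0" using u' x' by simp
  qed
  ultimately have "\<exists>X\<in>cochains (d + e + w - 1 - w). \<forall>xs a. \<omega> (X xs) a = ?\<Phi> xs a"
    by (rule cochain_of_form)
  moreover have idx: "d + e + w - 1 - w = d + e - 1" by simp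
  ultimately obtain h where h: "h \<in> cochains (d + e - 1)" "\<And>xs a. \<omega> (h xs) a = ?\<Phi> xs a"
    unfolding idx by blast
  have "h xs = 0" if xs: "\<one> \<in> set xs" for xs
  proof (rule om_inject)
    fix j a
    have "?\<Phi> xs a = 0"
    proof (rule cutsum_zero, rule cutsum_zero, rule cutsum_zero)
      fix u r x s y z assume "u @ r = xs" "x @ s = r" "y @ z = s"
      then consider "\<one> \<in> set u" | "\<one> \<in> set x" | "\<one> \<in> set y" | "\<one> \<in> set z" using xs by auto
      then have "D (?L u x y z a) = 0"
      proof cases
        case 1
        from madd_tws_one[OF D(3) this D(2), where P = "tws e x @ E y # z @ [a]" and n = ?N and Q = "[]"]
        show ?thesis by simp
      next
        case 2
        from madd_tws_one[OF D(3) this D(2), where P = "[]" and n = e and Q = "E y # z @ a # tws ?N u"]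
        show ?thesis by simp
      qed (simp_all add: E(2) D(2) madd_0[OF D(3)])
      then show "?\<Psi> (?L u x y z a) = 0" by simp
    qed
    then show "\<omega> (h xs) a = \<omega> 0 a" by (simp add: h(2))
  qed
  then show ?thesis using h by (auto simp: normalized_cochains_def)
qed

text \<open>
  In \<open>\<omega>(m(\<dots>, D(\<dots>), \<dots>, E(\<dots>), \<dots>), \<one>)\<close> the arguments of \<open>m\<close> can only be the values of
  \<open>D\<close> and \<open>E\<close>.
\<close>

lemma form_one_cup:
  assumes D: "D \<in> cochains d" and E: "E \<in> cochains e"
  shows "\<omega> (cup d e D E l) \<one> = sg w (cutsum (\<lambda>x y. \<omega> (D (tws e x)) (E y)) l)"
proof -
  let ?g = "\<lambda>x y z u v. \<omega> (m (tws (d + e) x @ D (tws e y) # tws e z @ E u # v)) \<one>"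
  have g0: "?g x y z u v = 0" if "x \<noteq> [] \<or> z \<noteq> [] \<or> v \<noteq> []" for x y z u v
    using that by (auto simp: om_m_one)
  have "\<omega> (cup d e D E l) \<one> =
      cutsum (\<lambda>x t. cutsum (\<lambda>y s. cutsum (\<lambda>z q. cutsum (\<lambda>u v. ?g x y z u v) q) s) t) l"
    by (simp add: cup_eq[OF D E] om_cutsum_left ins.simps(2))
  also have "\<dots> = cutsum (\<lambda>y s. cutsum (\<lambda>z q. cutsum (\<lambda>u v. ?g [] y z u v) q) s) l"
    by (rule cutsum_only_first) (auto intro!: cutsum_zero g0)
  also have "\<dots> = cutsum (\<lambda>y s. cutsum (\<lambda>u v. ?g [] y [] u v) s) l"
    by (rule cutsum_cong, rule trans[OF cutsum_only_first])
      (use g0[of "[]"] in \<open>auto intro!: cutsum_zero\<close>)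
  also have "\<dots> = cutsum (\<lambda>y s. ?g [] y [] s []) l"
    by (rule cutsum_cong, rule trans[OF cutsum_only_last]) (auto simp: om_m_one)
  also have "\<dots> = sg w (cutsum (\<lambda>x y. \<omega> (D (tws e x)) (E y)) l)"
    by (simp add: om_m_one cutsum_sg)
  finally show ?thesis .
qed

text \<open>
  The part of the cyclic sum for \<open>\<Delta>(D \<smile> E)\<close> in which the last argument \<open>a\<close> is an argument of
  \<open>D\<close>. By \<open>form_one_cup\<close> this sum runs over the ways to cut the cyclic word into an interval for
  \<open>D\<close> and an interval for \<open>E\<close>; the symmetry of \<open>\<omega>\<close> identifies the other part with the one for
  exchanged cochains.
\<close>

definition half_Delta_cup ::
  "int \<Rightarrow> int \<Rightarrow> ('a list \<Rightarrow> 'a) \<Rightarrow> ('a list \<Rightarrow> 'a) \<Rightarrow> 'a list \<Rightarrow> 'a \<Rightarrow> 'k" where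
  "half_Delta_cup d e D E xs a = cutsum (\<lambda>u r. cutsum (\<lambda>y z.
     \<omega> (D (z @ a # tws (d + e + w + 1) u)) (tw (d + w + 1) (E y))) r) xs"

lemma form_Delta_cup:
  assumes D: "D \<in> cochains d" and E: "E \<in> cochains e"
  shows "\<omega> (Delta (cup d e D E) xs) a =
    sg w (half_Delta_cup d e D E xs a - sg (d * e) (half_Delta_cup e d E D xs a))"
proof -
  let ?M = "d + e + w + 1"
  note eD = equivariantD[OF cochains_equivariant[OF D]] and eE = equivariantD[OF cochains_equivariant[OF E]]
  have 1: "\<omega> (D (tws e v @ tw e a # tws (e + ?M) u)) (E (tws ?M y)) =
      \<omega> (D (v @ a # tws ?M u)) (tw (d + w + 1) (E y))" for u v y
  proof -
    have "D (tws e v @ tw e a # tws (e + ?M) u) = sg (e * d) (tw e (D (v @ a # tws ?M u)))"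
      by (simp add: eD)
    then have "\<omega> (D (tws e v @ tw e a # tws (e + ?M) u)) (E (tws ?M y)) =
        sg (e * d + e * w) (\<omega> (D (v @ a # tws ?M u)) (tw e (E (tws ?M y))))"
      by (simp only: om_sg_left om_tw sg_simps)
    also have "tw e (E (tws ?M y)) = sg (?M * e) (tw (d + w + 1) (E y))"
    proof -
      have E': "E (tws ?M y) = sg (?M * e) (tw ?M (E y))" by (simp add: eE)
      show ?thesis unfolding E' tw_sg tw_tw by (rule arg_cong[OF fun_cong[OF tw_cong]]) simp
    qed
    also have "sg (e * d + e * w) (\<omega> (D (v @ a # tws ?M u)) (sg (?M * e) (tw (d + w + 1) (E y)))) =
      \<omega> (D (v @ a # tws ?M u)) (tw (d + w + 1) (E y))"
      by (simp only: om_sg_right sg_simps) (rule sg_even, auto)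
    finally show ?thesis .
  qed
  have 2: "\<omega> (D (tws e x)) (E L) = - sg (d * e) (\<omega> (E L) (tw (e + w + 1) (D x)))" for x L
  proof -
    have eq: "D (tws e x) = sg (e * d) (tw e (D x))" by (simp add: eD)
    have "tw (1 + w) (D (tws e x)) = sg (d * e) (tw (e + w + 1) (D x))"
      unfolding eq tw_sg tw_tw by (simp add: ac_simps)
    then show ?thesis using om_swap[of "D (tws e x)" "E L"] by (simp add: om_sg_right)
  qed
  have "\<omega> (Delta (cup d e D E) xs) a =
     cutsum (\<lambda>u v. sg w (cutsum (\<lambda>x y. \<omega> (D (tws e x)) (E y)) (v @ a # tws ?M u))) xs"
    unfolding Delta_spec(2)[OF cochains_cup[OF D E]] form_one_cup[OF D E] by (simp add: ac_simps)
  also have "\<dots> = sg w (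
    cutsum (\<lambda>u v. cutsum (\<lambda>x y. \<omega> (D (tws e x)) (E (y @ a # tws ?M u))) v) xs +
    cutsum (\<lambda>u v. cutsum (\<lambda>u' y. \<omega> (D (tws e v @ tw e a # tws (e + ?M) u')) (E (tws ?M y))) u) xs)"
    by (simp add: cutsum_sg cutsum_append_Cons cutsum_map cutsum_add)
  also have "cutsum (\<lambda>u v. cutsum (\<lambda>x y. \<omega> (D (tws e x)) (E (y @ a # tws ?M u))) v) xs =
    - sg (d * e) (half_Delta_cup e d E D xs a)"
    unfolding 2 half_Delta_cup_def by (simp add: cutsum_uminus cutsum_sg ac_simps)
  also have "cutsum (\<lambda>u v. cutsum (\<lambda>u' y. \<omega> (D (tws e v @ tw e a # tws (e + ?M) u')) (E (tws ?M y))) u) xs =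
    half_Delta_cup d e D E xs a"
    unfolding 1 half_Delta_cup_def by (simp only: cutsum_nest)
  finally show ?thesis by (simp add: algebra_simps)
qed

text \<open>
  One half of the BV relation: up to the differential of the homotopy \<open>h\<close>, the brace \<open>D{E}\<close> is the
  sum of \<open>\<Delta> D \<smile> E\<close> and of one half of \<open>\<Delta>(D \<smile> E)\<close>, with signs. The sum \<open>?S\<close>, which inserts
  \<open>m\<close> into all the words that define \<open>h\<close>, is evaluated in two ways.

  The first way keeps track of the place of \<open>m\<close>. If \<open>m\<close> contains neither the value of \<open>E\<close> nor \<open>a\<close>
  (\<open>?I1\<close>, \<open>?I3a\<close>, \<open>?I3c\<close>), the term belongs to \<open>h{m}\<close>. If it contains the value of \<open>E\<close> only
  (\<open>?I2a\<close>), it belongs to \<open>h{m}\<close> as well, since \<open>E\<close> is a cocycle. If it contains \<open>a\<close> only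
  (\<open>?I3b\<close>), it belongs to \<open>m{h}\<close>, and if it contains both (\<open>?I2b\<close>), it belongs to
  \<open>\<Delta> D \<smile> E\<close>; these two use cyclicity.

  The second way uses that \<open>D\<close> is a cocycle, so that \<open>D{m}\<close> becomes \<open>m{D}\<close>, and paired with the
  unit this has boundary terms only. They telescope; the last argument \<open>a\<close> at one end gives
  \<open>D{E}\<close>, and the value of \<open>E\<close> as first argument at the other end gives the half of
  \<open>\<Delta>(D \<smile> E)\<close>.
\<close>

theorem brace_BV_homotopy:
  assumes D: "D \<in> cochains d" and E: "E \<in> cochains e" and h: "h \<in> cochains (d + e - 1)"
    and dD: "hochschild_diff d D = 0" and dE: "hochschild_diff e E = 0"
    and h_form: "\<And>xs a. \<omega> (h xs) a =
      cutsum (\<lambda>u r. cutsum (\<lambda>x s. cutsum (\<lambda>y z.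
        \<omega> (D (tws e x @ E y # z @ a # tws (d + e + w) u)) \<one>) s) r) xs"
  shows "sg w (\<omega> (ins D [(e, E)] xs) a - half_Delta_cup d e D E xs a) =
    \<omega> (hochschild_diff (d + e - 1) h xs) a + \<omega> (cup (d - 1) e (Delta D) E xs) a"
proof -
  let ?\<Psi> = "\<lambda>l. \<omega> (D l) \<one>" and ?N = "d + e + w" and ?M = "d + e + w + 1" and ?n = "d + w + 1"
  have \<Psi>: "madd ?\<Psi>" by (rule mlin_madd[OF mlin_form[OF D]])
  note eE = equivariantD[OF cochains_equivariant[OF E]]
  note em = equivariantD[OF m_equivariant, unfolded mult_1_right]
  have shift: "?\<Psi> l = sg ?n (?\<Psi> (tws 1 l))" for l
    unfolding form_one_tws[OF D] by simp
  have shift': "?\<Psi> l = sg (?n + k) (?\<Psi> (A @ X # B))" if "tws 1 l = A @ sg k X # B" for l A k X B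
    by (subst shift) (simp add: that madd_sg[OF \<Psi>])
  let ?S = "cutsum (\<lambda>u r. cutsum (\<lambda>x s. cutsum (\<lambda>y z.
    ins ?\<Psi> [(1, m)] (tws e x @ E y # z @ a # tws ?M u)) s) r) xs"
  let ?I1 = "cutsum (\<lambda>u r. cutsum (\<lambda>p r. cutsum (\<lambda>b r. cutsum (\<lambda>c r. cutsum (\<lambda>y z.
    ?\<Psi> (tws (1 + e) p @ m (tws e b) # tws e c @ E y # z @ a # tws ?M u)) r) r) r) r) xs"
  let ?I2a = "cutsum (\<lambda>u r. cutsum (\<lambda>p r. cutsum (\<lambda>t r. cutsum (\<lambda>y r. cutsum (\<lambda>b c.
    ?\<Psi> (tws (1 + e) p @ m (tws e t @ E y # b) # c @ a # tws ?M u)) r) r) r) r) xs"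
  let ?I2b = "cutsum (\<lambda>b r. cutsum (\<lambda>c r. cutsum (\<lambda>p r. cutsum (\<lambda>t r. cutsum (\<lambda>y z.
    ?\<Psi> (tws (1 + e) p @ m (tws e t @ E y # z @ a # tws ?M b) # tws ?M c)) r) r) r) r) xs"
  let ?I3a = "cutsum (\<lambda>u r. cutsum (\<lambda>x r. cutsum (\<lambda>y r. cutsum (\<lambda>p r. cutsum (\<lambda>b c.
    ?\<Psi> (tws (1 + e) x @ tw 1 (E y) # tws 1 p @ m b # c @ a # tws ?M u)) r) r) r) r) xs"
  let ?I3b = "cutsum (\<lambda>b r. cutsum (\<lambda>c r. cutsum (\<lambda>x r. cutsum (\<lambda>y r. cutsum (\<lambda>p t.
    ?\<Psi> (tws (1 + e) x @ tw 1 (E y) # tws 1 p @ m (t @ a # tws ?M b) # tws ?M c)) r) r) r) r) xs"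
  let ?I3c = "cutsum (\<lambda>p r. cutsum (\<lambda>b r. cutsum (\<lambda>c r. cutsum (\<lambda>x r. cutsum (\<lambda>y z.
    ?\<Psi> (tws (1 + e) x @ tw 1 (E y) # tws 1 z @ tw 1 a # tws (1 + ?M) p @ m (tws ?M b) # tws ?M c)) r) r) r) r) xs"
  have S: "?S = ?I1 + ?I2a + ?I2b + ?I3a + ?I3b + ?I3c"
    unfolding ins_single_append
    by (simp add: ins.simps(2) cutsum_append_Cons cutsum_map cutsum_add[THEN ext] cutsum_nest' ac_simps)

  \<comment> \<open>The terms of \<open>h{m}\<close>, with \<open>m\<close> in the block \<open>x\<close>, among the arguments of \<open>E\<close>, in the
    block \<open>z\<close> or in the rotated block \<open>u\<close>.\<close>
  let ?H1 = "cutsum (\<lambda>u r. cutsum (\<lambda>p r. cutsum (\<lambda>b r. cutsum (\<lambda>c r. cutsum (\<lambda>y z.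
    ?\<Psi> (tws (1 + e) p @ tw e (m b) # tws e c @ E y # z @ a # tws ?M u)) r) r) r) r) xs"
  let ?H2 = "cutsum (\<lambda>u r. cutsum (\<lambda>x r. cutsum (\<lambda>y z.
    ?\<Psi> (tws (1 + e) x @ ins E [(1, m)] y # z @ a # tws ?M u)) r) r) xs"
  let ?H3 = "cutsum (\<lambda>u r. cutsum (\<lambda>x r. cutsum (\<lambda>y r. cutsum (\<lambda>p r. cutsum (\<lambda>b c.
    ?\<Psi> (tws (1 + e) x @ E (tws 1 y) # tws 1 p @ m b # c @ a # tws ?M u)) r) r) r) r) xs"
  let ?H4 = "cutsum (\<lambda>p r. cutsum (\<lambda>b r. cutsum (\<lambda>c r. cutsum (\<lambda>x r. cutsum (\<lambda>y z.
    ?\<Psi> (tws e x @ E y # z @ a # tws ?M p @ tw ?N (m b) # tws ?N c)) r) r) r) r) xs"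
  have h_m: "\<omega> (ins h [(1, m)] xs) a = ?H1 + ?H2 + ?H3 + ?H4"
    by (simp add: om_cutsum_left ins.simps(2) h_form cutsum_append_Cons cutsum_map cutsum_add[THEN ext]
        madd_cutsum[OF \<Psi>] cutsum_nest' ac_simps)
  have H1: "?H1 = sg e ?I1"
    unfolding em madd_sg[OF \<Psi>] by (simp add: cutsum_sg)
  have H2: "?H2 = sg e ?I2a"
    unfolding brace_m_of_cocycle[OF E dE] sg_fun madd_sg[OF \<Psi>]
    by (simp add: ins.simps(2) madd_cutsum[OF \<Psi>] cutsum_sg cutsum_nest')
  have H3: "?H3 = sg e ?I3a"
    unfolding eE mult_1_left madd_sg[OF \<Psi>] by (simp add: cutsum_sg)
  have leaf4: "?\<Psi> (tws e x @ E y # z @ a # tws ?M p @ tw ?N (m b) # tws ?N c) =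
    sg e (?\<Psi> (tws (1 + e) x @ tw 1 (E y) # tws 1 z @ tw 1 a # tws (1 + ?M) p @ m (tws ?M b) # tws ?M c))"
    for x y z p b c
  proof -
    have "tws 1 (tws e x @ E y # z @ a # tws ?M p @ tw ?N (m b) # tws ?N c) =
      (tws (1 + e) x @ tw 1 (E y) # tws 1 z @ tw 1 a # tws (1 + ?M) p) @ tw ?M (m b) # tws ?M c"
      by (simp add: ac_simps)
    then have "?\<Psi> (tws e x @ E y # z @ a # tws ?M p @ tw ?N (m b) # tws ?N c) = sg (?n + ?M)
      (?\<Psi> ((tws (1 + e) x @ tw 1 (E y) # tws 1 z @ tw 1 a # tws (1 + ?M) p) @ m (tws ?M b) # tws ?M c))"
      unfolding em by (rule shift')
    also have "\<dots> = sg e (?\<Psi> ((tws (1 + e) x @ tw 1 (E y) # tws 1 z @ tw 1 a # tws (1 + ?M) p) @ m (tws ?M b) # tws ?M c))"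
      by (rule sg_cong) simp
    finally show ?thesis by simp
  qed
  have H4: "?H4 = sg e ?I3c"
    unfolding leaf4 by (simp add: cutsum_sg)

  have leaf_m: "sg w (?\<Psi> (tws e x @ E y # p @ m (tws 1 t @ tw 1 a # tws ?N b) # tws ?N c)) =
    sg d (?\<Psi> (tws (1 + e) x @ tw 1 (E y) # tws 1 p @ m (t @ a # tws ?M b) # tws ?M c))" for x y p t b c
  proof -
    have m1: "tw 1 (m (tws 1 t @ tw 1 a # tws ?N b)) = - m (t @ a # tws ?M b)"
      using em[of 1 "tws 1 t @ tw 1 a # tws ?N b"] by (simp add: ac_simps)
    have "tws 1 (tws e x @ E y # p @ m (tws 1 t @ tw 1 a # tws ?N b) # tws ?N c) =
      (tws (1 + e) x @ tw 1 (E y) # tws 1 p) @ (- m (t @ a # tws ?M b)) # tws ?M c"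
      unfolding map_append list.map m1 by (simp add: ac_simps)
    then have "?\<Psi> (tws e x @ E y # p @ m (tws 1 t @ tw 1 a # tws ?N b) # tws ?N c) = sg (?n + 1)
      (?\<Psi> ((tws (1 + e) x @ tw 1 (E y) # tws 1 p) @ m (t @ a # tws ?M b) # tws ?M c))"
      by (intro shift') (simp only: sg_simps)
    then show ?thesis by (auto simp: sg_def)
  qed
  have m_h: "\<omega> (ins m [(d + e - 1, h)] xs) a = sg d ?I3b"
  proof -
    have "\<omega> (ins m [(d + e - 1, h)] xs) a =
      cutsum (\<lambda>b r. cutsum (\<lambda>c r. cutsum (\<lambda>x r. cutsum (\<lambda>y r. cutsum (\<lambda>p t.
        sg w (?\<Psi> (tws e x @ E y # p @ m (tws 1 t @ tw 1 a # tws ?N b) # tws ?N c))) r) r) r) r) xs"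
      by (simp add: om_cutsum_left ins.simps(2) om_extract h_form cutsum_sg cutsum_nest' ac_simps)
    then show ?thesis unfolding leaf_m by (simp add: cutsum_sg)
  qed
  have delta_h: "\<omega> (hochschild_diff (d + e - 1) h xs) a = sg d (?I1 + ?I2a + ?I3a + ?I3b + ?I3c)"
    unfolding hochschild_diff_eq[OF h] fun_diff_def om_diff_left sg_fun om_sg_left h_m m_h H1 H2 H3 H4
    by (cases "even d"; cases "even e") (simp_all add: sg_def)

  have leaf_cup: "sg w (?\<Psi> (q @ m (tws (1 + e) t @ tw 1 (E y) # tws 1 z @ tw 1 a # tws ?N b) # tws (d + w) c)) =
    sg d (?\<Psi> (tws 1 q @ m (tws e t @ E y # z @ a # tws ?M b) # tws ?n c))" for q t y z b c
  proof -
    have m1: "tw 1 (m (tws (1 + e) t @ tw 1 (E y) # tws 1 z @ tw 1 a # tws ?N b)) =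
      - m (tws e t @ E y # z @ a # tws ?M b)"
    proof -
      have "tw (1 + (1 + e)) = tw e" by (rule tw_cong) simp
      then have "tws 1 (tws (1 + e) t @ tw 1 (E y) # tws 1 z @ tw 1 a # tws ?N b) =
          tws e t @ E y # z @ a # tws ?M b"
        unfolding map_append list.map tws_tws tw_tw by (simp add: ac_simps)
      then show ?thesis by (simp only: em sg_simps)
    qed
    have "tws 1 (q @ m (tws (1 + e) t @ tw 1 (E y) # tws 1 z @ tw 1 a # tws ?N b) # tws (d + w) c) =
      tws 1 q @ (- m (tws e t @ E y # z @ a # tws ?M b)) # tws ?n c"
      unfolding map_append list.map m1 by (simp add: ac_simps)
    then have "?\<Psi> (q @ m (tws (1 + e) t @ tw 1 (E y) # tws 1 z @ tw 1 a # tws ?N b) # tws (d + w) c) =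
      sg (?n + 1) (?\<Psi> (tws 1 q @ m (tws e t @ E y # z @ a # tws ?M b) # tws ?n c))"
      by (intro shift') (simp only: sg_simps)
    then show ?thesis by (auto simp: sg_def)
  qed
  have cup_form: "\<omega> (cup (d - 1) e (Delta D) E xs) a = sg d ?I2b"
  proof -
    have "\<omega> (cup (d - 1) e (Delta D) E xs) a =
      cutsum (\<lambda>b r. cutsum (\<lambda>c r. cutsum (\<lambda>p r. cutsum (\<lambda>t r. cutsum (\<lambda>y z.
        sg w (?\<Psi> (tws e p @ m (tws (1 + e) t @ tw 1 (E y) # tws 1 z @ tw 1 a # tws ?N b) #
          tws (d + w) (tws e c)))) r) r) r) r) xs"
      by (simp add: cup_eq[OF Delta_spec(1)[OF D] E] om_cutsum_left ins.simps(2) om_extract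
          Delta_spec(2)[OF D] cutsum_sg cutsum_map cutsum_nest' ac_simps)
    then show ?thesis unfolding leaf_cup by (simp add: cutsum_sg ac_simps)
  qed
  have boundary: "?S = sg (d + w) (\<omega> (ins D [(e, E)] xs) a - half_Delta_cup d e D E xs a)"
  proof -
    let ?B = "\<lambda>l. \<omega> (D (butlast l)) (last l) - \<omega> (D (tl l)) (tw ?n (hd l))"
    have Me: "?M = e + ?n" by simp
    have B: "ins ?\<Psi> [(1, m)] (tws e x @ E y # z @ a # tws ?M u) =
      sg (d + w) (?B (tws e x @ (E y # z) @ a # tws (e + ?n) u))" for x y z u
      unfolding om_ins_left[symmetric] brace_m_of_cocycle[OF D dD] sg_fun om_sg_left Me
      by (simp add: form_brace_m[OF D])
    have "?S = cutsum (\<lambda>p s. cutsum (\<lambda>y z. cutsum (\<lambda>u x.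
        sg (d + w) (?B (tws e x @ (E y # z) @ a # tws (e + ?n) u))) p) s) xs"
      unfolding B by (simp only: cutsum_nest)
    also have "\<dots> = sg (d + w) (cutsum (\<lambda>p s. cutsum (\<lambda>y z.
        \<omega> (D (tws e p @ E y # z)) a - \<omega> (D (z @ a # tws ?M p)) (tw ?n (E y))) s) xs)"
      unfolding cutsum_sg rotation_boundary Me by simp
    also have "cutsum (\<lambda>p s. cutsum (\<lambda>y z.
        \<omega> (D (tws e p @ E y # z)) a - \<omega> (D (z @ a # tws ?M p)) (tw ?n (E y))) s) xs =
      \<omega> (ins D [(e, E)] xs) a - half_Delta_cup d e D E xs a"
      by (simp add: half_Delta_cup_def cutsum_diff[THEN ext] om_cutsum_left ins.simps(2))
    finally show ?thesis .
  qed
  have "\<omega> (hochschild_diff (d + e - 1) h xs) a + \<omega> (cup (d - 1) e (Delta D) E xs) a = sg d ?S"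
    unfolding delta_h cup_form S sg_add[symmetric] by (simp only: ac_simps)
  also have "\<dots> = sg (d + (d + w)) (\<omega> (ins D [(e, E)] xs) a - half_Delta_cup d e D E xs a)"
    unfolding boundary by (rule sg_simps)
  also have "\<dots> = sg w (\<omega> (ins D [(e, E)] xs) a - half_Delta_cup d e D E xs a)"
    by (rule sg_cong) simp
  finally show ?thesis by (rule sym)
qed

lemma Delta_uminus: "D \<in> cochains d \<Longrightarrow> Delta (- D) = - Delta D"
  using Delta_scale[of D d "-1"] by (simp add: fun_Compl_def)

lemma Delta_coboundaries:
  assumes "X \<in> coboundaries p"
  shows "Delta X \<in> coboundaries (p - 1)"
proof -
  obtain Y where Y: "Y \<in> normalized_cochains (p - 1)" "X = hochschild_diff (p - 1) Y"
    using assms by (rule coboundariesE)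
  have "Delta X = - hochschild_diff (p - 2) (Delta Y)"
    using hochschild_diff_Delta[OF normalizedD(1)[OF Y(1)]] by (simp add: Y(2))
  then show ?thesis
    using coboundaries_uminus[OF coboundariesI[OF normalized_Delta[OF Y(1)]]] by simp
qed

lemma cocycles_Delta:
  assumes "D \<in> cocycles p"
  shows "Delta D \<in> cocycles (p - 1)"
proof -
  note D = cocyclesD[OF assms]
  have "Delta (0 :: 'a list \<Rightarrow> 'a) = 0" using Delta_scale[OF D(3), of 0] by (simp add: zero_fun_def)
  then show ?thesis
    using hochschild_diff_Delta[OF D(3)] by (simp add: cocycles_def normalized_Delta[OF D(1)] D(2))
qed

lemma HH_BV_operator_coset:
  assumes D: "D \<in> cocycles p"
  shows "HH_BV_operator p (coset p D) = coset (p - 1) (sg w (Delta D))"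
proof -
  have "HH_Delta p (coset p D) = coset (p - 1) (Delta D)"
    unfolding HH_Delta_def
  proof (rule UN_coset)
    fix X assume X: "X \<in> coboundaries p"
    then show "Delta (D + X) - Delta D \<in> coboundaries (p - 1)"
      using Delta_add[OF cocyclesD(3)[OF D] cocyclesD(3)[OF coboundaries_cocycles[OF X]]] Delta_coboundaries[OF X]
      by simp
  qed
  then show ?thesis by (simp add: HH_BV_operator_def HH_smult_sign)
qed

lemma Delta_sg: "D \<in> cochains d \<Longrightarrow> Delta (sg n D) = sg n (Delta D)"
  by (simp add: sg_def Delta_uminus)

lemma cocycles_sg: "D \<in> cocycles p \<Longrightarrow> sg n D \<in> cocycles p"
  by (simp add: sg_def cocycles_uminus)

lemma cup_sg_left: "\<lbrakk>D \<in> cochains d; E \<in> cochains e\<rbrakk> \<Longrightarrow> cup d e (sg n D) E = sg n (cup d e D E)"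
  by (simp add: cup_eq cochains_sg ins_slot_sg[where P = "[]", unfolded append_Nil] m_madd)

text \<open>
  Antisymmetrization of the previous theorem. The two halves of \<open>\<Delta>(D \<smile> E)\<close> combine to the whole.
  The sign \<open>(-1)\<^bsup>|\<omega>|\<^esup>\<close> in front of \<open>\<Delta>\<close> has its origin in \<open>om_m_one\<close>, where the unit is moved
  across the form.
\<close>

theorem bracket_BV_homotopy:
  assumes D: "D \<in> cocycles d" and E: "E \<in> cocycles e"
  shows "bracket d e D E - (Delta (sg w (cup d e D E)) + cup (d - 1) e (sg w (Delta D)) E
    - sg (d * e) (cup (e - 1) d (sg w (Delta E)) D)) \<in> coboundaries (d + e)"
proof -
  note D' = cocyclesD[OF D] and E' = cocyclesD[OF E]
  obtain h where h: "h \<in> normalized_cochains (d + e - 1)"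
    "\<And>xs a. \<omega> (h xs) a = cutsum (\<lambda>u r. cutsum (\<lambda>x s. cutsum (\<lambda>y z.
      \<omega> (D (tws e x @ E y # z @ a # tws (d + e + w) u)) \<one>) s) r) xs"
    using BV_homotopy_exists[OF D'(1) E'(1)] by blast
  obtain k where k: "k \<in> normalized_cochains (e + d - 1)"
    "\<And>xs a. \<omega> (k xs) a = cutsum (\<lambda>u r. cutsum (\<lambda>x s. cutsum (\<lambda>y z.
      \<omega> (E (tws d x @ D y # z @ a # tws (e + d + w) u)) \<one>) s) r) xs"
    using BV_homotopy_exists[OF E'(1) D'(1)] by blast
  have "bracket d e D E - (Delta (sg w (cup d e D E)) + cup (d - 1) e (sg w (Delta D)) E
    - sg (d * e) (cup (e - 1) d (sg w (Delta E)) D)) =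
    sg w (hochschild_diff (d + e - 1) h) - sg (d * e + w) (hochschild_diff (e + d - 1) k)" (is "?L = ?R")
  proof (rule eq_if_forms_eq)
    fix xs a
    note 1 = brace_BV_homotopy[OF D'(3) E'(3) normalizedD(1)[OF h(1)] D'(2) E'(2) h(2), of xs a]
    note 2 = brace_BV_homotopy[OF E'(3) D'(3) normalizedD(1)[OF k(1)] E'(2) D'(2) k(2), of xs a]
    note 3 = form_Delta_cup[OF D'(3) E'(3), of xs a]
    have L: "\<omega> (?L xs) a =
      \<omega> (ins D [(e, E)] xs) a - sg (d * e) (\<omega> (ins E [(d, D)] xs) a) -
      (sg w (\<omega> (Delta (cup d e D E) xs) a) + sg w (\<omega> (cup (d - 1) e (Delta D) E xs) a) -
       sg (d * e) (sg w (\<omega> (cup (e - 1) d (Delta E) D xs) a)))"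
      by (simp add: bracket_eq[OF D'(3) E'(3)] Delta_sg[OF cochains_cup[OF D'(3) E'(3)]]
          cup_sg_left[OF Delta_spec(1)[OF D'(3)] E'(3)] cup_sg_left[OF Delta_spec(1)[OF E'(3)] D'(3)]
          om_diff_left om_add_left om_sg_left)
    show "\<omega> (?L xs) a = \<omega> (?R xs) a"
      unfolding L unfolding 3 fun_diff_def sg_fun om_diff_left om_sg_left
      using 1 2 by (cases "even w"; cases "even d"; cases "even e") (simp_all add: sg_def algebra_simps)
  qed
  also have "\<dots> \<in> coboundaries (d + e)"
    using coboundaries_sg[OF coboundariesI[OF h(1)], of w] coboundaries_sg[OF coboundariesI[OF k(1)], of "d * e + w"]
    by (simp add: coboundaries_diff add.commute)
  finally show ?thesis .
qed

theorem bv_algebra_HH: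
  "bv_algebra HH HH_add HH_zero HH_smult HH_cup HH_bracket HH_BV_operator"
proof -
  interpret G: gerstenhaber_algebra HH HH_add HH_zero HH_smult HH_cup HH_bracket
    by (rule gerstenhaber_algebra_HH)
  note closed = HH_I cocycles_Delta cocycles_add cocycles_scale cocycles_sg
  show ?thesis
  proof
    fix p q :: int and x y and c :: 'k
    {
      assume "x \<in> HH p"
      then obtain D where D: "D \<in> cocycles p" "x = coset p D" by (rule HH_E)
      note D' = cocyclesD[OF D(1)]
      show "HH_BV_operator p x \<in> HH (p - 1)" by (simp add: D HH_BV_operator_coset closed)
      show "HH_BV_operator p (HH_smult p c x) = HH_smult (p - 1) c (HH_BV_operator p x)"
        by (simp add: D HH_BV_operator_coset closed HH_smult_coset Delta_scale[OF D'(3)] scale_sg sg_ext)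
      show "HH_BV_operator (p - 1) (HH_BV_operator p x) = HH_zero (p - 2)"
        by (simp add: D HH_BV_operator_coset closed HH_zero_def Delta_sg[OF Delta_spec(1)[OF D'(3)]]
            Delta_Delta_eq_0[OF D'(1)])
    }
    {
      assume "x \<in> HH p" "y \<in> HH p"
      then obtain D E where D: "D \<in> cocycles p" "x = coset p D" and E: "E \<in> cocycles p" "y = coset p E"
        by (meson HH_E)
      show "HH_BV_operator p (HH_add p x y) = HH_add (p - 1) (HH_BV_operator p x) (HH_BV_operator p y)"
        by (simp add: D E HH_BV_operator_coset closed HH_add_coset
            Delta_add[OF cocyclesD(3)[OF D(1)] cocyclesD(3)[OF E(1)]] sg_add)
    }
    {
      assume "x \<in> HH p" "y \<in> HH q"
      then obtain D E where D: "D \<in> cocycles p" "x = coset p D" and E: "E \<in> cocycles q" "y = coset q E"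
        by (meson HH_E)
      have idx: "p - 1 + q + 1 = p + q" "q - 1 + p + 1 = p + q" "p + q + 1 - 1 = p + q" by simp_all
      have "HH_BV_operator (p + q + 1) (HH_cup p q x y) = coset (p + q) (sg w (Delta (cup p q D E)))"
        using HH_BV_operator_coset[OF cocycles_cup[OF D(1) E(1)]]
        by (simp only: D(2) E(2) HH_cup_coset[OF D(1) E(1)] idx)
      moreover have "HH_cup (p - 1) q (HH_BV_operator p x) y = coset (p + q) (cup (p - 1) q (sg w (Delta D)) E)"
        using HH_cup_coset[OF cocycles_sg[OF cocycles_Delta[OF D(1)]] E(1), of w]
        by (simp only: D(2) E(2) HH_BV_operator_coset[OF D(1)] idx)
      moreover have "HH_cup (q - 1) p (HH_BV_operator q y) x = coset (p + q) (cup (q - 1) p (sg w (Delta E)) D)"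
        using HH_cup_coset[OF cocycles_sg[OF cocycles_Delta[OF E(1)]] D(1), of w]
        by (simp only: D(2) E(2) HH_BV_operator_coset[OF E(1)] idx)
      moreover have "HH_bracket p q x y = coset (p + q) (bracket p q D E)"
        by (simp only: D(2) E(2) HH_bracket_coset[OF D(1) E(1)])
      moreover have "coset (p + q) (bracket p q D E) = coset (p + q)
        (sg w (Delta (cup p q D E)) + cup (p - 1) q (sg w (Delta D)) E + - sg (p * q) (cup (q - 1) p (sg w (Delta E)) D))"
        using bracket_BV_homotopy[OF D(1) E(1)]
        by (intro coset_eqI) (simp add: Delta_sg[OF cochains_cup[OF cocyclesD(3)[OF D(1)] cocyclesD(3)[OF E(1)]]])
      ultimately show "HH_bracket p q x y =
         HH_add (p + q)
          (HH_add (p + q) (HH_BV_operator (p + q + 1) (HH_cup p q x y)) (HH_cup (p - 1) q (HH_BV_operator p x) y))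
          (HH_smult (p + q) (- ((-1) powi (p * q))) (HH_cup (q - 1) p (HH_BV_operator q y) x))"
        by (simp only: HH_add_coset HH_smult_sign)
    }
  qed
qed

end

theorem corollary1p3:
  fixes scale :: "'k::field \<Rightarrow> 'a::ab_group_add \<Rightarrow> 'a"
    and gr :: "int \<Rightarrow> 'a set"
    and m :: "'a list \<Rightarrow> 'a"
    and one :: 'a
    and \<omega> :: "'a \<Rightarrow> 'a \<Rightarrow> 'k"
    and w :: int
  assumes "cyclic_unital_A_infinity_algebra scale gr m one \<omega> w"
  shows "bv_algebra
           (unital_A_infinity_algebra.HH scale gr m one)
           (unital_A_infinity_algebra.HH_add scale gr m one)
           (unital_A_infinity_algebra.HH_zero scale gr m one)
           (unital_A_infinity_algebra.HH_smult scale gr m one)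
           (unital_A_infinity_algebra.HH_cup scale gr m one)
           (unital_A_infinity_algebra.HH_bracket scale gr m one)
           (cyclic_unital_A_infinity_algebra.HH_BV_operator scale gr m one \<omega> w)"
  by (rule cyclic_unital_A_infinity_algebra.bv_algebra_HH[OF assms])

end
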